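(* Let $K\subseteq\mathbb{R}^n$ be compact, let $0<s<1$, and let $(\phi,\psi)$ be a compactly supported $r$-regular orthonormal wavelet system on $\mathbb{R}^n$ with $r\geqslant 1$ and wavelet functions $\{\psi_\epsilon\}_{\epsilon\in\alpha}$. For $j_0\in\mathbb{Z}$ and $d\mu=p_\mu(\mathbf{x})d\mathbf{x}$, $d\nu=p_\nu(\mathbf{x})d\mathbf{x}$ in $\mathcal{P}_{\mathrm{ab2}}(K)$, define $$(W_{\mathrm{wav}}^{(\psi,j_0)})_s(\mu,\nu):=\sum_{\epsilon\in\alpha,\ j\geqslant j_0,\ \mathbf{k}\in\mathbb{Z}^n}2^{-j(s+\frac n2)}\,\bigl|(p_\mu-p_\nu)^{(d)}_{(\epsilon,(j,\mathbf{k}))}\bigr|.$$ Then for every $\eta>0$ there exists a (sufficiently small) integer $j_0\in\mathbb{Z}$, depending only on $\eta$, $K$, $s$ and the system $(\phi,\psi)$, such that for all $\mu,\nu\in\mathcal{P}_{\mathrm{ab2}}(K)$ $$E_{\psi,s}\,W_s(\mu,\nu)-\eta\ \leqslant\ (W_{\mathrm{wav}}^{(\psi,j_0)})_s(\mu,\nu)\ \leqslant\ \tilde E_{\psi,s,j_0}\,W_s(\mu,\nu),$$ where $E_{\psi,s}:=a_{14}(\psi,s)$, and $\tilde E_{\psi,s,j_0}:=a_{22}(\psi,s)+|j_0|\,a_{23}(\psi,s)$ if $j_0<0$, while $\tilde E_{\psi,s,j_0}:=a_{22}(\psi,s)$ if $j_0\geqslant 0$.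
   Context: $\mathcal{P}_{\mathrm{ab2}}(K)$ is the set of Borel probability measures on the compact set $K$ that are absolutely continuous with respect to $n$-dimensional Lebesgue measure with square-integrable density (extended by $0$ outside $K$). For $0<s\leqslant 1$, $W_s(\mu,\nu):=\inf_{\gamma\in\Gamma(\mu,\nu)}\int|\mathbf{x}-\mathbf{y}|^s\,d\gamma(\mathbf{x},\mathbf{y})$, where $\Gamma(\mu,\nu)$ is the set of couplings (transport plans) of $\mu$ and $\nu$; there is no power $1/s$. Orthonormal wavelet system. A multiresolution approximation of $L^2(\mathbb{R}^n)$ is an increasing sequence of closed subspaces $\{V_j\}_{j\in\mathbb{Z}}$ such that: (1) $\bigcap_j V_j=\{0\}$ and $\overline{\bigcup_j V_j}=L^2(\mathbb{R}^n)$; (2) for all $f\in L^2(\mathbb{R}^n)$, $j\in\mathbb{Z}$, $\mathbf{k}\in\mathbb{Z}^n$: $f(\mathbf{x})\in V_j\Leftrightarrow f(2\mathbf{x})\in V_{j+1}$, and $f(\mathbf{x})\in V_0\Leftrightarrow f(\mathbf{x}-\mathbf{k})\in V_0$; (3) there is a scaling function $\phi\in V_0$ with integral $1$ such that, for each $j$, the functions $\phi_{(j,\mathbf{k})}(\mathbf{x}):=2^{nj/2}\phi(2^j\mathbf{x}-\mathbf{k})$, $\mathbf{k}\in\mathbb{Z}^n$, form an orthonormal Hilbert basis of $V_j$. Let $W_j$ be the orthogonal complement of $V_j$ in $V_{j+1}$. It is an orthonormal wavelet system, denoted $(\phi,\psi)$, if there are functions $\psi_\epsilon\in W_0$, $\epsilon\in\alpha$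 ($\alpha$ a finite index set), called wavelet functions, each with integral $0$, such that for each $j$ the functions $\psi_{(\epsilon,(j,\mathbf{k}))}(\mathbf{x}):=2^{nj/2}\psi_\epsilon(2^j\mathbf{x}-\mathbf{k})$, $\epsilon\in\alpha$, $\mathbf{k}\in\mathbb{Z}^n$, form an orthonormal Hilbert basis of $W_j$. The system is $r$-regular if $\phi$ and all $\psi_\epsilon$ are continuously differentiable up to order $r$ and all these derivatives decay faster than the reciprocal of any polynomial at infinity; it is compactly supported if $\phi$ and all $\psi_\epsilon$ are. The detail coefficients of $f$ are $f^{(d)}_{(\epsilon,(j,\mathbf{k}))}:=\int_{\mathbb{R}^n}f(\mathbf{x})\,\overline{\psi_{(\epsilon,(j,\mathbf{k}))}(\mathbf{x})}\,d\mathbf{x}$. Constants. $a_{14}(\psi,s):=1/\max_{\epsilon\in\alpha}\|\psi_\epsilon\|_{(\dot C^s(\mathbb{R}^n))^*}$, where $\dot C^s(\mathbb{R}^n)$ is the space of $s$-Hölder continuous functions $f:\mathbb{R}^n\to\mathbb{C}$ modulo constants, normed by the Hölder seminorm $\sup_{\mathbf{x}\neq\mathbf{y}}|f(\mathbf{x})-f(\mathbf{y})|/|\mathbf{x}-\mathbf{y}|^s$, and $\psi_\epsilon$ acts by $f\mapsto\int f\psi_\epsilon\,d\mathbf{x}$; that is, $\|\psi_\epsilon\|_{(\dot C^s(\mathbb{R}^n))^*}=\sup\{|\int f\psi_\epsilon\,d\mathbf{x}|: f \text{ has Hölder seminorm}\leqslant 1\}$. With $\sigma=(\sigma_{\epsilon,\mathbf{k}})$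 ranging over all choices of signs in $\{+1,-1\}$, set $$\|\textstyle\sum\psi\|_\infty:=\sup_{\mathbf{x}\in\mathbb{R}^n,\ \sigma}\Bigl|\sum_{\mathbf{k}\in\mathbb{Z}^n,\epsilon\in\alpha}\sigma_{\epsilon,\mathbf{k}}\psi_{(\epsilon,(0,\mathbf{k}))}(\mathbf{x})\Bigr|,\qquad \|\textstyle\sum\psi^{(i)}\|_\infty:=\sup_{\mathbf{x}\in\mathbb{R}^n,\ \sigma}\Bigl|\sum_{\mathbf{k}\in\mathbb{Z}^n,\epsilon\in\alpha}\sigma_{\epsilon,\mathbf{k}}\frac{\partial\psi_{(\epsilon,(0,\mathbf{k}))}(\mathbf{x})}{\partial x_i}\Bigr|,$$ $$a_{22}(\psi,s):=\frac{\sum_{i=1}^n\|\sum\psi^{(i)}\|_\infty}{2^{1-s}(2^{1-s}-1)}+\frac{2\|\sum\psi\|_\infty}{1-2^{-s}},$$ $$a_{23}(\psi,s):=\sup_{\mathbf{x}\neq\mathbf{y},\ \sigma}\left|\frac{\sum_{\mathbf{k}\in\mathbb{Z}^n,\epsilon\in\alpha}\sigma_{\epsilon,\mathbf{k}}\psi_{(\epsilon,(0,\mathbf{k}))}(\mathbf{x})-\sum_{\mathbf{k}\in\mathbb{Z}^n,\epsilon\in\alpha}\sigma_{\epsilon,\mathbf{k}}\psi_{(\epsilon,(0,\mathbf{k}))}(\mathbf{y})}{|\mathbf{x}-\mathbf{y}|^s}\right|.$$ *)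

theory Defs
  imports "HOL-Probability.Probability"
begin

section \<open>The Hilbert space of square-integrable functions\<close>

text \<open>
  Elements are honest Borel functions rather than classes modulo null sets; the subspaces used
  below are closed for the seminorm, hence saturated under almost everywhere equality.
\<close>

definition L2 :: "(real ^ 'n \<Rightarrow> complex) set" where
  "L2 = {f \<in> borel_measurable lborel. integrable lborel (\<lambda>x. (norm (f x))\<^sup>2)}"

definition L2_inner :: "(real ^ 'n \<Rightarrow> complex) \<Rightarrow> (real ^ 'n \<Rightarrow> complex) \<Rightarrow> complex" where
  "L2_inner f g = (\<integral>x. f x * cnj (g x) \<partial>lborel)"

definition L2_norm :: "(real ^ 'n \<Rightarrow> complex) \<Rightarrow> real" where
  "L2_norm f = sqrt (\<integral>x. (norm (f x))\<^sup>2 \<partial>lborel)"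

definition L2_closure :: "(real ^ 'n \<Rightarrow> complex) set \<Rightarrow> (real ^ 'n \<Rightarrow> complex) set" where
  "L2_closure S = {f \<in> L2. \<forall>e>0. \<exists>g\<in>S. L2_norm (\<lambda>x. f x - g x) < e}"

definition L2_closed_subspace :: "(real ^ 'n \<Rightarrow> complex) set \<Rightarrow> bool" where
  "L2_closed_subspace V \<longleftrightarrow>
     V \<subseteq> L2 \<and> (\<lambda>x. 0) \<in> V \<and>
     (\<forall>f\<in>V. \<forall>g\<in>V. (\<lambda>x. f x + g x) \<in> V) \<and>
     (\<forall>c. \<forall>f\<in>V. (\<lambda>x. c * f x) \<in> V) \<and>
     L2_closure V = V"

definition L2_orth_complement_in ::
  "(real ^ 'n \<Rightarrow> complex) set \<Rightarrow> (real ^ 'n \<Rightarrow> complex) set \<Rightarrow> (real ^ 'n \<Rightarrow> complex) set" where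
  "L2_orth_complement_in U V = {f \<in> U. \<forall>g\<in>V. L2_inner f g = 0}"

definition L2_span :: "'i set \<Rightarrow> ('i \<Rightarrow> real ^ 'n \<Rightarrow> complex) \<Rightarrow> (real ^ 'n \<Rightarrow> complex) set" where
  "L2_span I b = {(\<lambda>x. \<Sum>i\<in>F. c i * b i x) | F c. finite F \<and> F \<subseteq> I}"

definition L2_orthonormal_basis ::
  "(real ^ 'n \<Rightarrow> complex) set \<Rightarrow> 'i set \<Rightarrow> ('i \<Rightarrow> real ^ 'n \<Rightarrow> complex) \<Rightarrow> bool" where
  "L2_orthonormal_basis V I b \<longleftrightarrow>
     (\<forall>i\<in>I. b i \<in> V) \<and>
     (\<forall>i\<in>I. \<forall>i'\<in>I. L2_inner (b i) (b i') = (if i = i' then 1 else 0)) \<and>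
     V \<subseteq> L2_closure (L2_span I b)"


section \<open>Wavelet systems\<close>

definition lattice_vec :: "int ^ 'n \<Rightarrow> real ^ 'n" where
  "lattice_vec k = (\<chi> i. real_of_int (k $ i))"

definition rescale ::
  "(real ^ 'n \<Rightarrow> complex) \<Rightarrow> int \<Rightarrow> int ^ 'n \<Rightarrow> real ^ 'n \<Rightarrow> complex" where
  "rescale f j k = (\<lambda>x. complex_of_real (2 powr (real CARD('n) * real_of_int j / 2)) *
                        f ((2 powi j) *\<^sub>R x - lattice_vec k))"

definition multiresolution ::
  "(int \<Rightarrow> (real ^ 'n \<Rightarrow> complex) set) \<Rightarrow> (real ^ 'n \<Rightarrow> complex) \<Rightarrow> bool" where
  "multiresolution V \<phi> \<longleftrightarrow>
     (\<forall>j. L2_closed_subspace (V j)) \<and>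
     (\<forall>j. V j \<subseteq> V (j + 1)) \<and>
     (\<Inter>j. V j) = {f \<in> L2. AE x in lborel. f x = 0} \<and>
     L2_closure (\<Union>j. V j) = L2 \<and>
     (\<forall>f\<in>L2. \<forall>j. f \<in> V j \<longleftrightarrow> (\<lambda>x. f (2 *\<^sub>R x)) \<in> V (j + 1)) \<and>
     (\<forall>f\<in>L2. \<forall>k. f \<in> V 0 \<longleftrightarrow> (\<lambda>x. f (x - lattice_vec k)) \<in> V 0) \<and>
     \<phi> \<in> V 0 \<and> has_bochner_integral lborel \<phi> 1 \<and>
     (\<forall>j. L2_orthonormal_basis (V j) UNIV (rescale \<phi> j))"

definition wavelet_system ::
  "'e set \<Rightarrow> (real ^ 'n \<Rightarrow> complex) \<Rightarrow> ('e \<Rightarrow> real ^ 'n \<Rightarrow> complex) \<Rightarrow> bool" where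
  "wavelet_system A \<phi> \<psi> \<longleftrightarrow>
     finite A \<and>
     (\<exists>V. multiresolution V \<phi> \<and>
        (let W = (\<lambda>j. L2_orth_complement_in (V (j + 1)) (V j)) in
           (\<forall>\<epsilon>\<in>A. \<psi> \<epsilon> \<in> W 0 \<and> has_bochner_integral lborel (\<psi> \<epsilon>) 0) \<and>
           (\<forall>j. L2_orthonormal_basis (W j) (A \<times> UNIV) (\<lambda>(\<epsilon>, k). rescale (\<psi> \<epsilon>) j k))))"

definition partially_differentiable :: "'n \<Rightarrow> (real ^ 'n \<Rightarrow> complex) \<Rightarrow> bool" where
  "partially_differentiable i f \<longleftrightarrow> (\<forall>x. (\<lambda>t. f (x + t *\<^sub>R axis i 1)) differentiable (at (0::real)))"

definition partial_deriv :: "'n \<Rightarrow> (real ^ 'n \<Rightarrow> complex) \<Rightarrow> real ^ 'n \<Rightarrow> complex" where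
  "partial_deriv i f x = vector_derivative (\<lambda>t. f (x + t *\<^sub>R axis i 1)) (at (0::real))"

definition rapidly_decaying :: "(real ^ 'n \<Rightarrow> complex) \<Rightarrow> bool" where
  "rapidly_decaying f \<longleftrightarrow> (\<forall>m::nat. ((\<lambda>x. norm x ^ m * norm (f x)) \<longlongrightarrow> 0) at_infinity)"

text \<open>All iterated partial derivatives up to the given order exist, are continuous and decay rapidly.\<close>

primrec regular_function :: "nat \<Rightarrow> (real ^ 'n \<Rightarrow> complex) \<Rightarrow> bool" where
  "regular_function 0 f \<longleftrightarrow> continuous_on UNIV f \<and> rapidly_decaying f"
| "regular_function (Suc r) f \<longleftrightarrow> continuous_on UNIV f \<and> rapidly_decaying f \<and>
     (\<forall>i. partially_differentiable i f \<and> regular_function r (partial_deriv i f))"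

definition regular_system ::
  "nat \<Rightarrow> 'e set \<Rightarrow> (real ^ 'n \<Rightarrow> complex) \<Rightarrow> ('e \<Rightarrow> real ^ 'n \<Rightarrow> complex) \<Rightarrow> bool" where
  "regular_system r A \<phi> \<psi> \<longleftrightarrow> regular_function r \<phi> \<and> (\<forall>\<epsilon>\<in>A. regular_function r (\<psi> \<epsilon>))"

definition compactly_supported :: "(real ^ 'n \<Rightarrow> complex) \<Rightarrow> bool" where
  "compactly_supported f \<longleftrightarrow> compact (closure {x. f x \<noteq> 0})"

definition compactly_supported_system ::
  "'e set \<Rightarrow> (real ^ 'n \<Rightarrow> complex) \<Rightarrow> ('e \<Rightarrow> real ^ 'n \<Rightarrow> complex) \<Rightarrow> bool" where
  "compactly_supported_system A \<phi> \<psi> \<longleftrightarrow>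
     compactly_supported \<phi> \<and> (\<forall>\<epsilon>\<in>A. compactly_supported (\<psi> \<epsilon>))"

definition detail_coeff ::
  "('e \<Rightarrow> real ^ 'n \<Rightarrow> complex) \<Rightarrow> (real ^ 'n \<Rightarrow> complex) \<Rightarrow> 'e \<Rightarrow> int \<Rightarrow> int ^ 'n \<Rightarrow> complex" where
  "detail_coeff \<psi> f \<epsilon> j k = (\<integral>x. f x * cnj (rescale (\<psi> \<epsilon>) j k x) \<partial>lborel)"


section \<open>Probability measures and transport distances\<close>

text \<open>
  The density is the Radon-Nikodym derivative, determined almost everywhere. For a member of
  \<open>prob_ab2 K\<close> it vanishes almost everywhere outside \<open>K\<close>, so integrals over the
  whole space are integrals of the density on \<open>K\<close> extended by 0.
\<close>

definition lebesgue_density :: "(real ^ 'n) measure \<Rightarrow> real ^ 'n \<Rightarrow> real" where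
  "lebesgue_density \<mu> x = enn2real (RN_deriv lborel \<mu> x)"

definition prob_ab2 :: "(real ^ 'n) set \<Rightarrow> (real ^ 'n) measure set" where
  "prob_ab2 K = {\<mu>. prob_space \<mu> \<and> sets \<mu> = sets borel \<and> emeasure \<mu> K = 1 \<and>
     absolutely_continuous lborel \<mu> \<and> integrable lborel (\<lambda>x. (lebesgue_density \<mu> x)\<^sup>2)}"

definition couplings ::
  "(real ^ 'n) measure \<Rightarrow> (real ^ 'n) measure \<Rightarrow> ((real ^ 'n) \<times> (real ^ 'n)) measure set" where
  "couplings \<mu> \<nu> = {\<gamma>. prob_space \<gamma> \<and> sets \<gamma> = sets borel \<and>
     distr \<gamma> borel fst = \<mu> \<and> distr \<gamma> borel snd = \<nu>}"

definition wasserstein ::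
  "real \<Rightarrow> (real ^ 'n) measure \<Rightarrow> (real ^ 'n) measure \<Rightarrow> ennreal" where
  "wasserstein s \<mu> \<nu> =
     (INF \<gamma>\<in>couplings \<mu> \<nu>. \<integral>\<^sup>+(x, y). ennreal (norm (x - y) powr s) \<partial>\<gamma>)"

definition wavelet_distance ::
  "'e set \<Rightarrow> ('e \<Rightarrow> real ^ 'n \<Rightarrow> complex) \<Rightarrow> int \<Rightarrow> real \<Rightarrow>
     (real ^ 'n) measure \<Rightarrow> (real ^ 'n) measure \<Rightarrow> ennreal" where
  "wavelet_distance A \<psi> j0 s \<mu> \<nu> =
     (\<Sum>\<^sub>\<infinity>(\<epsilon>, j, k)\<in>A \<times> {j0..} \<times> UNIV.
        ennreal (2 powr (- real_of_int j * (s + real CARD('n) / 2)) *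
          norm (detail_coeff \<psi>
            (\<lambda>x. complex_of_real (lebesgue_density \<mu> x - lebesgue_density \<nu> x)) \<epsilon> j k)))"


section \<open>The constants\<close>

text \<open>Suprema are taken in the extended nonnegative reals, so no boundedness is presupposed.\<close>

definition holder_seminorm :: "real \<Rightarrow> (real ^ 'n \<Rightarrow> complex) \<Rightarrow> ennreal" where
  "holder_seminorm s f =
     (SUP (x, y)\<in>{(x, y). x \<noteq> y}. ennreal (norm (f x - f y) / norm (x - y) powr s))"

definition holder_dual_norm :: "real \<Rightarrow> (real ^ 'n \<Rightarrow> complex) \<Rightarrow> ennreal" where
  "holder_dual_norm s g =
     (SUP f\<in>{f. holder_seminorm s f \<le> 1}. ennreal (norm (\<integral>x. f x * g x \<partial>lborel)))"

definition a14 :: "'e set \<Rightarrow> ('e \<Rightarrow> real ^ 'n \<Rightarrow> complex) \<Rightarrow> real \<Rightarrow> ennreal" where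
  "a14 A \<psi> s = 1 / Max ((\<lambda>\<epsilon>. holder_dual_norm s (\<psi> \<epsilon>)) ` A)"

definition signs :: "('e \<times> (int ^ 'n) \<Rightarrow> real) set" where
  "signs = {\<sigma>. \<forall>p. \<sigma> p \<in> {1, -1}}"

definition signed_sum ::
  "'e set \<Rightarrow> ('e \<times> (int ^ 'n) \<Rightarrow> real) \<Rightarrow> ('e \<Rightarrow> int ^ 'n \<Rightarrow> real ^ 'n \<Rightarrow> complex) \<Rightarrow>
     real ^ 'n \<Rightarrow> complex" where
  "signed_sum A \<sigma> g x = (\<Sum>\<^sub>\<infinity>(\<epsilon>, k)\<in>A \<times> UNIV. complex_of_real (\<sigma> (\<epsilon>, k)) * g \<epsilon> k x)"

definition signed_sum_norm ::
  "'e set \<Rightarrow> ('e \<Rightarrow> int ^ 'n \<Rightarrow> real ^ 'n \<Rightarrow> complex) \<Rightarrow> ennreal" where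
  "signed_sum_norm A g = (SUP \<sigma>\<in>signs. SUP x. ennreal (norm (signed_sum A \<sigma> g x)))"

definition a22 :: "'e set \<Rightarrow> ('e \<Rightarrow> real ^ 'n \<Rightarrow> complex) \<Rightarrow> real \<Rightarrow> ennreal" where
  "a22 A \<psi> s =
     (\<Sum>i\<in>UNIV. signed_sum_norm A (\<lambda>\<epsilon> k. partial_deriv i (rescale (\<psi> \<epsilon>) 0 k)))
       / ennreal (2 powr (1 - s) * (2 powr (1 - s) - 1))
     + 2 * signed_sum_norm A (\<lambda>\<epsilon> k. rescale (\<psi> \<epsilon>) 0 k) / ennreal (1 - 2 powr (- s))"

definition a23 :: "'e set \<Rightarrow> ('e \<Rightarrow> real ^ 'n \<Rightarrow> complex) \<Rightarrow> real \<Rightarrow> ennreal" where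
  "a23 A \<psi> s =
     (SUP \<sigma>\<in>signs. holder_seminorm s (signed_sum A \<sigma> (\<lambda>\<epsilon> k. rescale (\<psi> \<epsilon>) 0 k)))"

definition E_lower :: "'e set \<Rightarrow> ('e \<Rightarrow> real ^ 'n \<Rightarrow> complex) \<Rightarrow> real \<Rightarrow> ennreal" where
  "E_lower A \<psi> s = a14 A \<psi> s"

definition E_upper :: "'e set \<Rightarrow> ('e \<Rightarrow> real ^ 'n \<Rightarrow> complex) \<Rightarrow> real \<Rightarrow> int \<Rightarrow> ennreal" where
  "E_upper A \<psi> s j0 =
     (if j0 < 0 then a22 A \<psi> s + ennreal (real_of_int \<bar>j0\<bar>) * a23 A \<psi> s else a22 A \<psi> s)"

end

theory Submission
  imports Defs
begin

text \<open>
  Lower bound. By Kantorovich duality \<open>W\<^sub>s(\<mu>,\<nu>)\<close> is the supremum of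
  \<open>\<integral> f p\<close> over real \<open>f\<close> with \<open>|f x - f y| \<le> |x - y|\<^sup>s\<close>, where \<open>p\<close> is the difference of the
  densities. Since \<open>p\<close> and the wavelets have compact support, only finitely many coefficients
  of \<open>p\<close> at each scale are nonzero, so the projection of \<open>p\<close> to \<open>V J\<close> is a finite sum which
  telescopes into its projection to \<open>V j0\<close> and the details between \<open>j0\<close> and \<open>J\<close>
  (\<open>proj_telescope\<close>). Three contributions to \<open>\<integral> f p\<close> result (\<open>pairing_bound\<close>). The remainder
  tends to 0 as \<open>J\<close> grows, because all functions involved live in one ball. By dilation,
  \<open>f\<close> tested against a wavelet at scale \<open>j\<close> gives at most \<open>2 powr (- j * (s + n / 2))\<close> times the dual
  norm of the mother wavelet, so the details contribute at most the wavelet distance divided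
  by \<open>a14\<close>. The coarse projection is small (\<open>coarse_estimate\<close>): as \<open>p\<close> has mean zero, each of its
  boundedly many coefficients gains a factor \<open>2 powr j0\<close> from the Lipschitz bound on \<open>\<phi>\<close>, while
  \<open>f\<close> loses only \<open>2 powr (- s * j0)\<close>; the product \<open>2 powr (j0 * (1 - s))\<close> tends to 0 as
  \<open>j0\<close> decreases to \<open>- \<infinity>\<close>, uniformly in the two measures.

  Upper bound. A coupling turns each coefficient of \<open>p\<close> into the mean of a wavelet increment, so
  it suffices to bound the weighted sum of all increments between two points \<open>x\<close> and \<open>y\<close>. At each scale
  boundedly many wavelets meet \<open>x\<close> or \<open>y\<close>, and each increment is at most a constant times
  \<open>min (2\<^sup>j |x - y|) 1\<close>; for \<open>0 < s < 1\<close> the sum over all integers \<open>j\<close> of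
  \<open>2 powr (- j * s) * min (2\<^sup>j |x - y|) 1\<close> is at most a constant times \<open>|x - y|\<^sup>s\<close>. Hence the wavelet distance is
  at most \<open>C * W\<^sub>s\<close> with \<open>C\<close> independent of \<open>j0\<close> (\<open>wavelet_distance_le\<close>). As \<open>a23 > 0\<close>, a
  sufficiently negative \<open>j0\<close> makes \<open>|j0| * a23\<close>, and with it \<open>E_upper\<close>, at least \<open>C\<close>. The same choice
  serves the lower bound.

  Duality (\<open>wasserstein_le_dual\<close>) follows by cutting the compact set into small cells, which reduces
  it to finitely many points. There the marginal constraints are replaced
  by a quadratic penalty; the minimiser exists by compactness, its first-order conditions exhibit dual
  potentials, and letting the penalty grow restores the constraints.
\<close>

section \<open>Transport duality on a finite set\<close>

text \<open>
  Tychonoff's theorem, in the form in which transport plans on a finite set are minimised over.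
\<close>

lemma compact_Pi_interval:
  "compact {\<pi> :: 'a \<Rightarrow> real. \<forall>x. 0 \<le> \<pi> x \<and> \<pi> x \<le> R}"
proof -
  have "compactin (product_topology (\<lambda>_. euclidean) UNIV) (PiE (UNIV :: 'a set) (\<lambda>_. {0..R}))"
    by (subst compactin_PiE) (simp add: compactin_euclidean_iff)
  then have "compact (PiE (UNIV :: 'a set) (\<lambda>_. {0..R}))"
    by (simp add: compactin_euclidean_iff euclidean_product_topology)
  moreover have "PiE (UNIV :: 'a set) (\<lambda>_. {0..R}) = {\<pi>. \<forall>x. 0 \<le> \<pi> x \<and> \<pi> x \<le> R}"
    by (auto simp: PiE_def Pi_def)
  ultimately show ?thesis by simp
qed

text \<open>
  The first-order condition at a minimum approached from one side only, as it occurs at the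
  boundary of the box of admissible plans.
\<close>

lemma first_order_nonneg:
  fixes a b \<delta> :: real
  assumes "\<delta> > 0" and "\<And>t. 0 < t \<Longrightarrow> t \<le> \<delta> \<Longrightarrow> 0 \<le> t * a + t\<^sup>2 * b"
  shows "0 \<le> a"
proof (rule ccontr)
  assume "\<not> 0 \<le> a"
  define t where "t = min \<delta> (- a / (2 * (\<bar>b\<bar> + 1)))"
  have t: "0 < t" "t \<le> \<delta>" using assms(1) \<open>\<not> 0 \<le> a\<close> by (auto simp: t_def divide_neg_pos)
  have "t \<le> - a / (2 * (\<bar>b\<bar> + 1))" by (simp add: t_def)
  then have "t * (2 * (\<bar>b\<bar> + 1)) \<le> - a" by (simp add: field_simps)
  moreover have "t * b \<le> t * (\<bar>b\<bar> + 1)" using t by (intro mult_left_mono) auto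
  ultimately have "a + t * b < 0" using \<open>\<not> 0 \<le> a\<close> by linarith
  then have "t * (a + t * b) < 0" using t by (simp add: mult_pos_neg)
  with assms(2)[OF t] show False by (simp add: power2_eq_square algebra_simps)
qed

lemma sum_square_deviation_update:
  fixes u :: "'i \<Rightarrow> real"
  assumes "finite I" "i \<in> I"
  shows "(\<Sum>k\<in>I. (u k - (if k = i then t else 0))\<^sup>2) = (\<Sum>k\<in>I. (u k)\<^sup>2) + (t\<^sup>2 - 2 * t * u i)"
proof -
  have "(\<Sum>k\<in>I. (u k - (if k = i then t else 0))\<^sup>2)
      = (\<Sum>k\<in>I. (u k)\<^sup>2 + (if k = i then t\<^sup>2 - 2 * t * u k else 0))"
    by (intro sum.cong refl) (auto simp: power2_eq_square algebra_simps)
  then show ?thesis using assms by (simp add: sum.distrib sum.delta)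
qed

text \<open>
  For fixed \<open>e > 0\<close> minimise the cost plus \<open>1 / (2 * e)\<close> times the squared deviation from the prescribed
  marginals. At a minimiser put \<open>f i = (m i - row i) / e\<close> and \<open>g j = (n j - col j) / e\<close>. Varying a single
  entry gives \<open>f i + g j \<le> c i j\<close>, with equality where the plan charges \<open>(i, j)\<close>, so that
  \<open>cost + deviation / e = \<Sum> f m + \<Sum> g n\<close>. Replacing the pair \<open>f, g\<close> by the single potential
  \<open>h i = min\<^sub>j (c i j - g j)\<close>, which is 1-Lipschitz for \<open>c\<close> and satisfies \<open>f \<le> h \<le> - g\<close>, bounds the right-hand side
  by the dual value. Both the cost and the deviation are controlled by this one identity.
\<close>

lemma penalised_transport:
  fixes c :: "'i \<Rightarrow> 'i \<Rightarrow> real" and m n :: "'i \<Rightarrow> real"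
  assumes fin: "finite I" and "I \<noteq> {}"
    and c_nonneg: "\<And>i j. 0 \<le> c i j" and c_refl: "\<And>i. c i i = 0"
    and c_sym: "\<And>i j. c i j = c j i"
    and c_tri: "\<And>i j k. c i k \<le> c i j + c j k"
    and m: "\<And>i. 0 \<le> m i" "\<And>i. m i \<le> 1" and n: "\<And>i. 0 \<le> n i" "\<And>i. n i \<le> 1"
    and dual: "\<And>h. (\<And>i j. \<bar>h i - h j\<bar> \<le> c i j) \<Longrightarrow> (\<Sum>i\<in>I. h i * (m i - n i)) \<le> D"
    and e: "0 < e"
  obtains \<pi> :: "'i \<times> 'i \<Rightarrow> real" where "\<And>p. 0 \<le> \<pi> p" "\<And>p. \<pi> p \<le> 2"
    "(\<Sum>i\<in>I. \<Sum>j\<in>I. \<pi> (i, j) * c i j) \<le> D"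
    "(\<Sum>i\<in>I. (m i - (\<Sum>j\<in>I. \<pi> (i, j)))\<^sup>2) + (\<Sum>j\<in>I. (n j - (\<Sum>i\<in>I. \<pi> (i, j)))\<^sup>2) \<le> e * D"
proof -
  define row where "row \<pi> i = (\<Sum>j\<in>I. \<pi> (i, j))" for \<pi> :: "'i \<times> 'i \<Rightarrow> real" and i
  define col where "col \<pi> j = (\<Sum>i\<in>I. \<pi> (i, j))" for \<pi> :: "'i \<times> 'i \<Rightarrow> real" and j
  define cost where "cost \<pi> = (\<Sum>i\<in>I. \<Sum>j\<in>I. \<pi> (i, j) * c i j)" for \<pi> :: "'i \<times> 'i \<Rightarrow> real"
  define dev where "dev \<pi> = (\<Sum>i\<in>I. (m i - row \<pi> i)\<^sup>2) + (\<Sum>j\<in>I. (n j - col \<pi> j)\<^sup>2)"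
    for \<pi> :: "'i \<times> 'i \<Rightarrow> real"
  \<comment> \<open>The bound 2 exceeds all marginals, so that a minimiser never touches it.\<close>
  define box where "box = {\<pi> :: 'i \<times> 'i \<Rightarrow> real. \<forall>x. 0 \<le> \<pi> x \<and> \<pi> x \<le> 2}"
  have "compact box" unfolding box_def by (rule compact_Pi_interval)
  moreover have "(\<lambda>_. 0) \<in> box" by (simp add: box_def)
  moreover have "continuous_on box (\<lambda>\<pi>. cost \<pi> + dev \<pi> / (2 * e))"
    unfolding cost_def dev_def row_def col_def
    using e by (intro continuous_intros continuous_on_product_coordinates[THEN continuous_on_subset]) auto
  ultimately obtain \<pi> where \<pi>: "\<pi> \<in> box"
    and min: "\<And>\<rho>. \<rho> \<in> box \<Longrightarrow> cost \<pi> + dev \<pi> / (2 * e) \<le> cost \<rho> + dev \<rho> / (2 * e)"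
    using continuous_attains_inf[of box "\<lambda>\<pi>. cost \<pi> + dev \<pi> / (2 * e)"] by blast
  have \<pi>0: "0 \<le> \<pi> p" and \<pi>2: "\<pi> p \<le> 2" for p
    using \<pi> unfolding box_def by blast+
  define f where "f i = (m i - row \<pi> i) / e" for i
  define g where "g j = (n j - col \<pi> j) / e" for j
  have variation: "0 \<le> t * (c i j - f i - g j) + t\<^sup>2 * (1 / e)"
    if "i \<in> I" "j \<in> I" "0 \<le> \<pi> (i, j) + t" "\<pi> (i, j) + t \<le> 2" for i j t
  proof -
    define \<rho> where "\<rho> = \<pi>((i, j) := \<pi> (i, j) + t)"
    have \<rho>: "\<rho> (i', j') = \<pi> (i', j') + (if i' = i \<and> j' = j then t else 0)" for i' j'
      by (auto simp: \<rho>_def)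
    have "\<rho> \<in> box" using that \<pi> by (auto simp: \<rho>_def box_def)
    have row: "row \<rho> i' = row \<pi> i' + (if i' = i then t else 0)" for i'
      unfolding row_def \<rho> using fin that by (cases "i' = i") (simp_all add: sum.distrib)
    have col: "col \<rho> j' = col \<pi> j' + (if j' = j then t else 0)" for j'
      unfolding col_def \<rho> using fin that by (cases "j' = j") (simp_all add: sum.distrib)
    have inner: "(\<Sum>j'\<in>I. \<rho> (i', j') * c i' j')
        = (\<Sum>j'\<in>I. \<pi> (i', j') * c i' j') + (if i' = i then t * c i j else 0)" for i'
      unfolding \<rho> using fin that
      by (cases "i' = i") (simp_all add: sum.distrib distrib_right if_distrib[of "\<lambda>x. x * _"] cong: if_cong)
    have "cost \<rho> = cost \<pi> + t * c i j"
      unfolding cost_def inner using fin that by (simp add: sum.distrib)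
    moreover have "dev \<rho> = dev \<pi> + (t\<^sup>2 - 2 * t * (m i - row \<pi> i)) + (t\<^sup>2 - 2 * t * (n j - col \<pi> j))"
      unfolding dev_def row col diff_diff_eq[symmetric]
      using sum_square_deviation_update[OF fin that(1), of "\<lambda>i. m i - row \<pi> i" t]
        sum_square_deviation_update[OF fin that(2), of "\<lambda>i. n i - col \<pi> i" t] by simp
    ultimately have "0 \<le> t * c i j + ((t\<^sup>2 - 2 * t * (m i - row \<pi> i)) + (t\<^sup>2 - 2 * t * (n j - col \<pi> j))) / (2 * e)"
      using min[OF \<open>\<rho> \<in> box\<close>] by (simp add: add_divide_distrib)
    also have "\<dots> = t * (c i j - f i - g j) + t\<^sup>2 * (1 / e)"
      using e by (simp add: f_def g_def field_simps)
    finally show ?thesis .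
  qed
  have row_ge: "\<pi> (i, j) \<le> row \<pi> i" if "i \<in> I" "j \<in> I" for i j
    unfolding row_def using that fin \<pi>0 by (intro member_le_sum) auto
  have col_ge: "\<pi> (i, j) \<le> col \<pi> j" if "i \<in> I" "j \<in> I" for i j
    unfolding col_def using that fin \<pi>0 by (intro member_le_sum[of i I "\<lambda>i. \<pi> (i, j)"]) auto
  have stationary_le: "c i j - f i - g j \<le> 0" if "i \<in> I" "j \<in> I" "0 < \<pi> (i, j)" for i j
  proof -
    have "0 \<le> - (c i j - f i - g j)"
    proof (rule first_order_nonneg[OF that(3)])
      fix t assume "0 < t" "t \<le> \<pi> (i, j)"
      then show "0 \<le> t * - (c i j - f i - g j) + t\<^sup>2 * (1 / e)"
        using variation[OF that(1,2), of "- t"] \<pi>2[of "(i, j)"]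
        by (simp add: algebra_simps)
    qed
    then show ?thesis by simp
  qed
  have lt2: "\<pi> (i, j) < 2" if "i \<in> I" "j \<in> I" for i j
  proof (rule ccontr)
    assume "\<not> \<pi> (i, j) < 2"
    then have p2: "\<pi> (i, j) = 2" using \<pi>2[of "(i, j)"] by simp
    have "f i < 0" "g j < 0"
      using row_ge[OF that] col_ge[OF that] p2 m(2)[of i] n(2)[of j] e
      by (auto simp: f_def g_def divide_neg_pos)
    with stationary_le[OF that] p2 c_nonneg[of i j] show False by simp
  qed
  have feasible: "f i + g j \<le> c i j" if "i \<in> I" "j \<in> I" for i j
  proof -
    have "0 \<le> c i j - f i - g j"
    proof (rule first_order_nonneg[of "2 - \<pi> (i, j)"])
      show "0 < 2 - \<pi> (i, j)" using lt2[OF that] by simp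
    next
      fix t assume "0 < t" "t \<le> 2 - \<pi> (i, j)"
      then show "0 \<le> t * (c i j - f i - g j) + t\<^sup>2 * (1 / e)"
        using variation[OF that, of t] \<pi>0[of "(i, j)"] by simp
    qed
    then show ?thesis by simp
  qed
  have slack: "\<pi> (i, j) * c i j = f i * \<pi> (i, j) + g j * \<pi> (i, j)" if "i \<in> I" "j \<in> I" for i j
  proof (cases "\<pi> (i, j) = 0")
    case False
    then have "c i j = f i + g j"
      using feasible[OF that] stationary_le[OF that] \<pi>0[of "(i, j)"] by fastforce
    then show ?thesis by (simp add: algebra_simps)
  qed simp
  \<comment> \<open>The c-transform of the potential g.\<close>
  define h where "h i = Min ((\<lambda>j. c i j - g j) ` I)" for i
  have h_le: "h i \<le> c i j - g j" if "j \<in> I" for i j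
    unfolding h_def using fin that by (intro Min_le) auto
  have h_attained: "\<exists>j\<in>I. h i = c i j - g j" for i
  proof -
    have "h i \<in> (\<lambda>j. c i j - g j) ` I"
      unfolding h_def using fin \<open>I \<noteq> {}\<close> by (intro Min_in) auto
    then show ?thesis by auto
  qed
  have h_lip1: "h i - h k \<le> c i k" for i k
  proof -
    obtain j where "j \<in> I" "h k = c k j - g j" using h_attained by blast
    then show ?thesis using h_le[of j i] c_tri[of i j k] by linarith
  qed
  have "\<bar>h i - h k\<bar> \<le> c i k" for i k
    using h_lip1[of i k] h_lip1[of k i] c_sym[of i k] by linarith
  then have hD: "(\<Sum>i\<in>I. h i * (m i - n i)) \<le> D" by (rule dual)
  have hf: "f i \<le> h i" if "i \<in> I" for i
    using h_attained[of i] feasible[OF that] by force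
  have hg: "g i \<le> - h i" if "i \<in> I" for i
    using h_le[OF that, of i] c_refl[of i] by simp
  have "(\<Sum>i\<in>I. f i * m i) + (\<Sum>i\<in>I. g i * n i) \<le> (\<Sum>i\<in>I. h i * m i) + (\<Sum>i\<in>I. - h i * n i)"
    by (intro add_mono sum_mono mult_right_mono hf hg m n)
  also have "\<dots> = (\<Sum>i\<in>I. h i * (m i - n i))"
    by (simp add: sum.distrib[symmetric] algebra_simps)
  finally have fgD: "(\<Sum>i\<in>I. f i * m i) + (\<Sum>i\<in>I. g i * n i) \<le> D" using hD by linarith
  have "cost \<pi> = (\<Sum>i\<in>I. \<Sum>j\<in>I. f i * \<pi> (i, j) + g j * \<pi> (i, j))"
    unfolding cost_def by (intro sum.cong refl) (simp only: slack)
  also have "\<dots> = (\<Sum>i\<in>I. f i * row \<pi> i) + (\<Sum>j\<in>I. g j * col \<pi> j)"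
    by (simp add: sum.distrib row_def col_def sum_distrib_left sum.swap[of "\<lambda>i j. g j * \<pi> (i, j)"])
  also have "\<dots> = (\<Sum>i\<in>I. f i * m i - e * (f i)\<^sup>2) + (\<Sum>i\<in>I. g i * n i - e * (g i)\<^sup>2)"
  proof -
    have "row \<pi> i = m i - e * f i" "col \<pi> i = n i - e * g i" for i using e by (auto simp: f_def g_def)
    then have "f i * row \<pi> i = f i * m i - e * (f i)\<^sup>2" "g i * col \<pi> i = g i * n i - e * (g i)\<^sup>2" for i
      by (simp_all only: right_diff_distrib power2_eq_square mult.left_commute)
    then show ?thesis by simp
  qed
  finally have cost_eq: "cost \<pi> + e * ((\<Sum>i\<in>I. (f i)\<^sup>2) + (\<Sum>i\<in>I. (g i)\<^sup>2))
      = (\<Sum>i\<in>I. f i * m i) + (\<Sum>i\<in>I. g i * n i)"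
    by (simp add: sum_subtractf sum_distrib_left algebra_simps)
  have "dev \<pi> = e\<^sup>2 * ((\<Sum>i\<in>I. (f i)\<^sup>2) + (\<Sum>i\<in>I. (g i)\<^sup>2))"
    using e by (simp add: dev_def f_def g_def power_divide sum_divide_distrib[symmetric] distrib_left)
  then have dev_eq: "dev \<pi> = e * (e * ((\<Sum>i\<in>I. (f i)\<^sup>2) + (\<Sum>i\<in>I. (g i)\<^sup>2)))"
    by (simp add: power2_eq_square)
  have cost0: "0 \<le> cost \<pi>" unfolding cost_def using \<pi>0 c_nonneg by (intro sum_nonneg) auto
  have "dev \<pi> \<le> e * D" unfolding dev_eq
    using cost_eq cost0 fgD e by (intro mult_left_mono) auto
  moreover have "0 \<le> e * ((\<Sum>i\<in>I. (f i)\<^sup>2) + (\<Sum>i\<in>I. (g i)\<^sup>2))"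
    using e by (intro mult_nonneg_nonneg add_nonneg_nonneg sum_nonneg) auto
  then have "cost \<pi> \<le> D" using cost_eq fgD by linarith
  ultimately show thesis using that[of \<pi>] \<pi>0 \<pi>2 by (simp add: dev_def cost_def row_def col_def)
qed

text \<open>
  Let the penalty parameter tend to 0. Instead of extracting a convergent subsequence of penalised
  minimisers, minimise the sum of the deviation and the excess cost over the compact box: the
  previous lemma shows that its infimum is 0, and a minimiser attains it.
\<close>

lemma finite_transport_duality:
  fixes c :: "'i \<Rightarrow> 'i \<Rightarrow> real" and m n :: "'i \<Rightarrow> real"
  assumes fin: "finite I" and "I \<noteq> {}"
    and c_nonneg: "\<And>i j. 0 \<le> c i j" and c_refl: "\<And>i. c i i = 0"
    and c_sym: "\<And>i j. c i j = c j i"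
    and c_tri: "\<And>i j k. c i k \<le> c i j + c j k"
    and m: "\<And>i. 0 \<le> m i" "\<And>i. m i \<le> 1" and n: "\<And>i. 0 \<le> n i" "\<And>i. n i \<le> 1"
    and dual: "\<And>h. (\<And>i j. \<bar>h i - h j\<bar> \<le> c i j) \<Longrightarrow> (\<Sum>i\<in>I. h i * (m i - n i)) \<le> D"
  obtains \<pi> :: "'i \<times> 'i \<Rightarrow> real" where "\<And>p. 0 \<le> \<pi> p"
    "\<And>i. i \<in> I \<Longrightarrow> (\<Sum>j\<in>I. \<pi> (i, j)) = m i"
    "\<And>j. j \<in> I \<Longrightarrow> (\<Sum>i\<in>I. \<pi> (i, j)) = n j"
    "(\<Sum>i\<in>I. \<Sum>j\<in>I. \<pi> (i, j) * c i j) \<le> D"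
proof -
  define cost where "cost \<pi> = (\<Sum>i\<in>I. \<Sum>j\<in>I. \<pi> (i, j) * c i j)" for \<pi> :: "'i \<times> 'i \<Rightarrow> real"
  define dev where "dev \<pi> = (\<Sum>i\<in>I. (m i - (\<Sum>j\<in>I. \<pi> (i, j)))\<^sup>2) + (\<Sum>j\<in>I. (n j - (\<Sum>i\<in>I. \<pi> (i, j)))\<^sup>2)"
    for \<pi> :: "'i \<times> 'i \<Rightarrow> real"
  define box where "box = {\<pi> :: 'i \<times> 'i \<Rightarrow> real. \<forall>x. 0 \<le> \<pi> x \<and> \<pi> x \<le> 2}"
  define excess where "excess \<pi> = dev \<pi> + max 0 (cost \<pi> - D)" for \<pi>
  have "compact box" unfolding box_def by (rule compact_Pi_interval)
  moreover have "(\<lambda>_. 0) \<in> box" by (simp add: box_def)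
  moreover have "continuous_on box excess"
    unfolding cost_def dev_def excess_def
    by (intro continuous_intros continuous_on_product_coordinates[THEN continuous_on_subset]) auto
  ultimately obtain \<pi> where \<pi>: "\<pi> \<in> box" and min: "\<And>\<rho>. \<rho> \<in> box \<Longrightarrow> excess \<pi> \<le> excess \<rho>"
    using continuous_attains_inf[of box excess] by blast
  have small: "excess \<pi> \<le> e * D" if e: "0 < e" for e
  proof -
    have "\<exists>\<rho>\<in>box. cost \<rho> \<le> D \<and> dev \<rho> \<le> e * D"
    proof (rule penalised_transport[where c = c, OF assms e])
      fix \<rho> :: "'i \<times> 'i \<Rightarrow> real"
      assume "\<And>p. 0 \<le> \<rho> p" "\<And>p. \<rho> p \<le> 2" and "(\<Sum>i\<in>I. \<Sum>j\<in>I. \<rho> (i, j) * c i j) \<le> D"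
        and "(\<Sum>i\<in>I. (m i - (\<Sum>j\<in>I. \<rho> (i, j)))\<^sup>2) + (\<Sum>j\<in>I. (n j - (\<Sum>i\<in>I. \<rho> (i, j)))\<^sup>2) \<le> e * D"
      then show ?thesis
        by (intro bexI[of _ \<rho>]) (simp_all add: cost_def dev_def box_def del: split_paired_All)
    qed
    then obtain \<rho> where "\<rho> \<in> box" "cost \<rho> \<le> D" "dev \<rho> \<le> e * D" by blast
    then show ?thesis using min[of \<rho>] by (simp add: excess_def)
  qed
  have "D \<ge> 0" using dual[of "\<lambda>_. 0"] c_nonneg by simp
  have "excess \<pi> \<le> 0"
  proof (rule field_le_epsilon)
    fix e :: real assume "0 < e"
    have "excess \<pi> \<le> (e / (D + 1)) * D" using \<open>D \<ge> 0\<close> \<open>0 < e\<close> by (intro small) simp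
    also have "\<dots> \<le> e" using \<open>D \<ge> 0\<close> \<open>0 < e\<close> by (simp add: field_simps)
    finally show "excess \<pi> \<le> 0 + e" by simp
  qed
  moreover have sq: "0 \<le> (\<Sum>i\<in>I. (m i - (\<Sum>j\<in>I. \<pi> (i, j)))\<^sup>2)" "0 \<le> (\<Sum>j\<in>I. (n j - (\<Sum>i\<in>I. \<pi> (i, j)))\<^sup>2)"
    by (auto intro: sum_nonneg)
  ultimately have "cost \<pi> \<le> D" and z: "(\<Sum>i\<in>I. (m i - (\<Sum>j\<in>I. \<pi> (i, j)))\<^sup>2) = 0"
    "(\<Sum>j\<in>I. (n j - (\<Sum>i\<in>I. \<pi> (i, j)))\<^sup>2) = 0"
    unfolding excess_def dev_def by linarith+
  from z fin have "\<And>i. i \<in> I \<Longrightarrow> (\<Sum>j\<in>I. \<pi> (i, j)) = m i" "\<And>j. j \<in> I \<Longrightarrow> (\<Sum>i\<in>I. \<pi> (i, j)) = n j"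
    by (simp_all add: sum_nonneg_eq_0_iff)
  moreover have "\<And>p. 0 \<le> \<pi> p" using \<pi> unfolding box_def by blast
  ultimately show thesis using that[of \<pi>] \<open>cost \<pi> \<le> D\<close> by (simp add: cost_def)
qed

section \<open>Kantorovich duality on a compact set\<close>

text \<open>
  Subadditivity of \<open>t \<mapsto> t powr s\<close> makes \<open>norm (x - y) powr s\<close> a metric, which is what the
  duality argument needs of the cost.
\<close>

lemma powr_add_le:
  fixes a b s :: real
  assumes "0 \<le> a" "0 \<le> b" "0 < s" "s \<le> 1"
  shows "(a + b) powr s \<le> a powr s + b powr s"
proof (cases "a + b = 0")
  case False
  then have pos: "0 < a + b" using assms by simp
  have split: "t \<le> t powr s" if "0 \<le> t" "t \<le> 1" for t :: real
  proof (cases "t = 0")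
    case False
    then have "t powr 1 \<le> t powr s" using that assms by (intro powr_mono') auto
    then show ?thesis using that False by simp
  qed simp
  have "1 = a / (a + b) + b / (a + b)" using pos by (simp add: add_divide_distrib[symmetric])
  also have "\<dots> \<le> (a / (a + b)) powr s + (b / (a + b)) powr s"
    using assms pos by (intro add_mono split) auto
  also have "\<dots> = (a powr s + b powr s) / (a + b) powr s"
    using assms pos by (simp add: powr_divide add_divide_distrib)
  finally show ?thesis using pos by (simp add: field_simps)
qed (use assms in auto)

lemma norm_powr_triangle:
  fixes x y z :: "'a :: real_normed_vector"
  assumes "0 < s" "s \<le> 1"
  shows "norm (x - z) powr s \<le> norm (x - y) powr s + norm (y - z) powr s"
proof -
  have "norm (x - z) powr s \<le> (norm (x - y) + norm (y - z)) powr s"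
    using assms by (intro powr_mono2) (auto intro: norm_triangle_sub order_trans[OF _ norm_triangle_ineq])
  also have "\<dots> \<le> norm (x - y) powr s + norm (y - z) powr s"
    using assms by (intro powr_add_le) auto
  finally show ?thesis .
qed

lemma continuous_on_holder:
  fixes f :: "'a :: real_normed_vector \<Rightarrow> 'b :: real_normed_vector"
  assumes "\<And>x y. norm (f x - f y) \<le> C * norm (x - y) powr s" and "0 < s"
  shows "continuous_on S f"
proof -
  have "(f \<longlongrightarrow> f x) (at x within S)" for x
  proof -
    have "((\<lambda>y. C * norm (y - x) powr s) \<longlongrightarrow> C * norm (x - x) powr s) (at x within S)"
      using \<open>0 < s\<close> by (intro tendsto_intros tendsto_powr') auto
    then have "((\<lambda>y. C * norm (y - x) powr s) \<longlongrightarrow> 0) (at x within S)" by simp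
    moreover have "\<forall>\<^sub>F y in at x within S. norm (f y - f x) \<le> C * norm (y - x) powr s"
      by (intro always_eventually allI assms(1))
    ultimately have "((\<lambda>y. f y - f x) \<longlongrightarrow> 0) (at x within S)"
      by (rule Lim_null_comparison[rotated])
    then show ?thesis by (rule LIM_zero_cancel)
  qed
  then show ?thesis by (simp add: continuous_on_def)
qed

lemma nn_integral_finite_partition:
  assumes idx: "idx \<in> M \<rightarrow>\<^sub>M count_space UNIV" and "\<And>x. idx x < (N::nat)"
  shows "(\<integral>\<^sup>+x. g (idx x) \<partial>M) = (\<Sum>i<N. g i * emeasure M (idx -` {i} \<inter> space M))"
proof -
  have meas: "idx -` {i} \<inter> space M \<in> sets M" for i using idx by (rule measurable_sets) simp
  have "(\<integral>\<^sup>+x. g (idx x) \<partial>M) = (\<integral>\<^sup>+x. (\<Sum>i<N. g i * indicator (idx -` {i} \<inter> space M) x) \<partial>M)"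
  proof (intro nn_integral_cong)
    fix x assume "x \<in> space M"
    then have "(\<Sum>i<N. g i * indicator (idx -` {i} \<inter> space M) x) = (\<Sum>i<N. if i = idx x then g i else 0)"
      by (intro sum.cong refl) (auto simp: indicator_def)
    then show "g (idx x) = (\<Sum>i<N. g i * indicator (idx -` {i} \<inter> space M) x)"
      using assms(2) by simp
  qed
  also have "\<dots> = (\<Sum>i<N. \<integral>\<^sup>+x. g i * indicator (idx -` {i} \<inter> space M) x \<partial>M)"
    using meas by (intro nn_integral_sum) (auto intro!: borel_measurable_times_ennreal borel_measurable_indicator)
  also have "\<dots> = (\<Sum>i<N. g i * emeasure M (idx -` {i} \<inter> space M))"
    using meas by (intro sum.cong refl nn_integral_cmult_indicator) auto
  finally show ?thesis .
qed

lemma integral_finite_partition: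
  fixes h :: "nat \<Rightarrow> real"
  assumes "prob_space M" and idx: "idx \<in> M \<rightarrow>\<^sub>M count_space UNIV" and "\<And>x. idx x < (N::nat)"
  shows "(\<integral>x. h (idx x) \<partial>M) = (\<Sum>i<N. h i * measure M (idx -` {i} \<inter> space M))"
    and "integrable M (\<lambda>x. h (idx x))"
proof -
  interpret prob_space M by fact
  have meas: "idx -` {i} \<inter> space M \<in> sets M" for i using idx by (rule measurable_sets) simp
  have eq: "h (idx x) = (\<Sum>i<N. h i * indicator (idx -` {i} \<inter> space M) x)" if "x \<in> space M" for x
  proof -
    have "(\<Sum>i<N. h i * indicator (idx -` {i} \<inter> space M) x) = (\<Sum>i<N. if i = idx x then h i else 0)"
      using that by (intro sum.cong refl) (auto simp: indicator_def)
    then show ?thesis using assms(3) by simp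
  qed
  have int: "integrable M (\<lambda>x. h i * indicator (idx -` {i} \<inter> space M) x)" for i
    using meas by (intro integrable_mult_right integrable_real_indicator) (auto simp: emeasure_eq_measure)
  have "(\<integral>x. h (idx x) \<partial>M) = (\<integral>x. (\<Sum>i<N. h i * indicator (idx -` {i} \<inter> space M) x) \<partial>M)"
    by (intro Bochner_Integration.integral_cong refl eq)
  also have "\<dots> = (\<Sum>i<N. h i * measure M (idx -` {i} \<inter> space M))"
    using int meas by (subst Bochner_Integration.integral_sum) auto
  finally show "(\<integral>x. h (idx x) \<partial>M) = (\<Sum>i<N. h i * measure M (idx -` {i} \<inter> space M))" .
  show "integrable M (\<lambda>x. h (idx x))"
    by (subst Bochner_Integration.integrable_cong[OF refl eq], assumption)
      (intro Bochner_Integration.integrable_sum int)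
qed

lemma AE_fibre_not_null:
  assumes "finite_measure M" and idx: "idx \<in> M \<rightarrow>\<^sub>M count_space (UNIV :: nat set)"
  shows "AE x in M. measure M (idx -` {idx x} \<inter> space M) \<noteq> 0"
proof -
  interpret finite_measure M by fact
  have "AE x in M. \<forall>i. measure M (idx -` {i} \<inter> space M) = 0 \<longrightarrow> idx x \<noteq> i"
  proof (subst AE_all_countable, intro allI)
    fix i
    show "AE x in M. measure M (idx -` {i} \<inter> space M) = 0 \<longrightarrow> idx x \<noteq> i"
    proof (cases "measure M (idx -` {i} \<inter> space M) = 0")
      case True
      then have "idx -` {i} \<inter> space M \<in> null_sets M"
        using measurable_sets[OF idx, of "{i}"] by (intro null_setsI) (auto simp: emeasure_eq_measure)
      then have "AE x in M. x \<notin> idx -` {i} \<inter> space M" by (rule AE_not_in)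
      then show ?thesis using AE_space by eventually_elim auto
    qed simp
  qed
  then show ?thesis by eventually_elim auto
qed

text \<open>
  A plan between cells lifts to a coupling by spreading the mass \<open>\<pi> (i, j)\<close> over the product of
  cell \<open>i\<close> and cell \<open>j\<close> in proportion to \<open>\<mu> \<Otimes> \<nu>\<close>; this gives a density with respect to the product
  measure that is constant on products of cells.
\<close>

lemma coupling_from_cell_plan:
  fixes \<mu> \<nu> :: "(real ^ 'n) measure" and \<pi> :: "nat \<times> nat \<Rightarrow> real" and idx :: "real ^ 'n \<Rightarrow> nat"
  assumes "prob_space \<mu>" "sets \<mu> = sets borel" "prob_space \<nu>" "sets \<nu> = sets borel"
    and idx[measurable]: "idx \<in> borel \<rightarrow>\<^sub>M count_space UNIV" and idx_less: "\<And>x. idx x < N"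
    and pos: "\<And>p. 0 \<le> \<pi> p"
    and row: "\<And>i. i < N \<Longrightarrow> (\<Sum>j<N. \<pi> (i, j)) = measure \<mu> (idx -` {i})"
    and col: "\<And>j. j < N \<Longrightarrow> (\<Sum>i<N. \<pi> (i, j)) = measure \<nu> (idx -` {j})"
    and F[measurable]: "F \<in> borel_measurable borel" and G: "\<And>i j. 0 \<le> G i j"
    and FG: "AE x in \<mu>. AE y in \<nu>. F (x, y) \<le> ennreal (G (idx x) (idx y))"
  obtains \<gamma> where "\<gamma> \<in> couplings \<mu> \<nu>"
    "(\<integral>\<^sup>+p. F p \<partial>\<gamma>) \<le> ennreal (\<Sum>i<N. \<Sum>j<N. \<pi> (i, j) * G i j)"
proof -
  interpret \<mu>: prob_space \<mu> by fact
  interpret \<nu>: prob_space \<nu> by fact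
  interpret P: pair_prob_space \<mu> \<nu> ..
  have sets[measurable_cong]: "sets \<mu> = sets borel" "sets \<nu> = sets borel" by fact+
  have space: "space \<mu> = UNIV" "space \<nu> = UNIV"
    using sets_eq_imp_space_eq[OF sets(1)] sets_eq_imp_space_eq[OF sets(2)] by auto
  define m where "m i = measure \<mu> (idx -` {i})" for i
  define n where "n i = measure \<nu> (idx -` {i})" for i
  \<comment> \<open>Division by 0 yields 0, which is harmless: a plan does not charge cells of mass 0.\<close>
  define w where "w i j = \<pi> (i, j) / (m i * n j)" for i j
  have mn: "0 \<le> m i" "0 \<le> n i" for i by (auto simp: m_def n_def)
  have w0: "0 \<le> w i j" for i j using pos mn by (simp add: w_def)
  have em: "emeasure \<mu> (idx -` {i} \<inter> space \<mu>) = ennreal (m i)"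
    "emeasure \<nu> (idx -` {i} \<inter> space \<nu>) = ennreal (n i)" for i
    by (simp_all add: m_def n_def space \<mu>.emeasure_eq_measure \<nu>.emeasure_eq_measure)
  have zero_row: "\<pi> (i, j) = 0" if "m i = 0" "i < N" "j < N" for i j
    using row[OF that(2)] that pos by (auto simp: m_def sum_nonneg_eq_0_iff)
  have zero_col: "\<pi> (i, j) = 0" if "n j = 0" "i < N" "j < N" for i j
    using col[OF that(3)] that pos by (auto simp: n_def sum_nonneg_eq_0_iff)
  have wmn: "w i j * m i * n j = \<pi> (i, j)" if "i < N" "j < N" for i j
    using zero_row[OF _ that] zero_col[OF _ that] by (auto simp: w_def)
  have part: "(\<integral>\<^sup>+x. g (idx x) \<partial>\<mu>) = (\<Sum>i<N. g i * ennreal (m i))"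
    "(\<integral>\<^sup>+x. g (idx x) \<partial>\<nu>) = (\<Sum>i<N. g i * ennreal (n i))" for g
    using nn_integral_finite_partition[of idx \<mu> N g] nn_integral_finite_partition[of idx \<nu> N g] idx_less
    by (simp_all only: em) measurable
  define W where "W = (\<lambda>(x, y). ennreal (w (idx x) (idx y)))"
  have W[measurable]: "W \<in> borel_measurable (borel \<Otimes>\<^sub>M borel)" unfolding W_def by measurable
  define \<gamma> where "\<gamma> = density (\<mu> \<Otimes>\<^sub>M \<nu>) W"
  have sp: "sets (\<mu> \<Otimes>\<^sub>M \<nu>) = sets borel"
    unfolding borel_prod[symmetric] by (intro sets_pair_measure_cong sets)
  have row1: "AE x in \<mu>. (\<integral>\<^sup>+y. W (x, y) \<partial>\<nu>) = 1"
  proof -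
    have "idx \<in> \<mu> \<rightarrow>\<^sub>M count_space UNIV" by measurable
    from AE_fibre_not_null[OF \<mu>.finite_measure_axioms this]
    have "AE x in \<mu>. m (idx x) \<noteq> 0" by (simp add: m_def space)
    then show ?thesis
    proof eventually_elim
      case (elim x)
      have "(\<integral>\<^sup>+y. W (x, y) \<partial>\<nu>) = (\<Sum>j<N. ennreal (w (idx x) j) * ennreal (n j))"
        unfolding W_def prod.case by (rule part(2))
      also have "\<dots> = ennreal (\<Sum>j<N. w (idx x) j * n j)"
        using w0 mn by (simp add: ennreal_mult[symmetric] sum_ennreal)
      also have "(\<Sum>j<N. w (idx x) j * n j) = (\<Sum>j<N. \<pi> (idx x, j) / m (idx x))"
        using elim by (intro sum.cong refl) (simp add: wmn[OF idx_less, symmetric])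
      also have "\<dots> = 1" using elim row[OF idx_less, of x] by (simp add: m_def sum_divide_distrib[symmetric])
      finally show ?case by simp
    qed
  qed
  have col1: "AE y in \<nu>. (\<integral>\<^sup>+x. W (x, y) \<partial>\<mu>) = 1"
  proof -
    have "idx \<in> \<nu> \<rightarrow>\<^sub>M count_space UNIV" by measurable
    from AE_fibre_not_null[OF \<nu>.finite_measure_axioms this]
    have "AE x in \<nu>. n (idx x) \<noteq> 0" by (simp add: n_def space)
    then show ?thesis
    proof eventually_elim
      case (elim y)
      have "(\<integral>\<^sup>+x. W (x, y) \<partial>\<mu>) = (\<Sum>i<N. ennreal (w i (idx y)) * ennreal (m i))"
        unfolding W_def prod.case by (rule part(1))
      also have "\<dots> = ennreal (\<Sum>i<N. w i (idx y) * m i)"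
        using w0 mn by (simp add: ennreal_mult[symmetric] sum_ennreal)
      also have "(\<Sum>i<N. w i (idx y) * m i) = (\<Sum>i<N. \<pi> (i, idx y) / n (idx y))"
        using elim by (intro sum.cong refl) (simp add: wmn[OF _ idx_less, symmetric])
      also have "\<dots> = 1" using elim col[OF idx_less, of y] by (simp add: n_def sum_divide_distrib[symmetric])
      finally show ?case by simp
    qed
  qed
  have "distr \<gamma> borel fst = \<mu>"
  proof (rule measure_eqI)
    fix B assume "B \<in> sets (distr \<gamma> borel fst)"
    then have B[measurable]: "B \<in> sets borel" by simp
    have "emeasure (distr \<gamma> borel fst) B = (\<integral>\<^sup>+p. W p * indicator (fst -` B \<inter> space \<gamma>) p \<partial>(\<mu> \<Otimes>\<^sub>M \<nu>))"
      unfolding \<gamma>_def by (subst emeasure_distr, measurable) (subst emeasure_density, auto)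
    also have "\<dots> = (\<integral>\<^sup>+p. W p * indicator B (fst p) \<partial>(\<mu> \<Otimes>\<^sub>M \<nu>))"
      by (intro nn_integral_cong) (auto simp: \<gamma>_def indicator_def)
    also have "\<dots> = (\<integral>\<^sup>+x. \<integral>\<^sup>+y. W (x, y) * indicator B x \<partial>\<nu> \<partial>\<mu>)"
      by (subst \<nu>.nn_integral_fst[symmetric]) auto
    also have "\<dots> = (\<integral>\<^sup>+x. (\<integral>\<^sup>+y. W (x, y) \<partial>\<nu>) * indicator B x \<partial>\<mu>)"
      by (intro nn_integral_cong nn_integral_multc) measurable
    also have "\<dots> = (\<integral>\<^sup>+x. indicator B x \<partial>\<mu>)"
      using row1 by (intro nn_integral_cong_AE) (auto elim: eventually_mono)
    finally show "emeasure (distr \<gamma> borel fst) B = emeasure \<mu> B" using B sets by simp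
  qed (simp add: sets)
  moreover have "distr \<gamma> borel snd = \<nu>"
  proof (rule measure_eqI)
    fix B assume "B \<in> sets (distr \<gamma> borel snd)"
    then have B[measurable]: "B \<in> sets borel" by simp
    have "emeasure (distr \<gamma> borel snd) B = (\<integral>\<^sup>+p. W p * indicator (snd -` B \<inter> space \<gamma>) p \<partial>(\<mu> \<Otimes>\<^sub>M \<nu>))"
      unfolding \<gamma>_def by (subst emeasure_distr, measurable) (subst emeasure_density, auto)
    also have "\<dots> = (\<integral>\<^sup>+p. W p * indicator B (snd p) \<partial>(\<mu> \<Otimes>\<^sub>M \<nu>))"
      by (intro nn_integral_cong) (auto simp: \<gamma>_def indicator_def)
    also have "\<dots> = (\<integral>\<^sup>+y. \<integral>\<^sup>+x. W (x, y) * indicator B y \<partial>\<mu> \<partial>\<nu>)"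
      by (subst P.nn_integral_snd[symmetric]) auto
    also have "\<dots> = (\<integral>\<^sup>+y. (\<integral>\<^sup>+x. W (x, y) \<partial>\<mu>) * indicator B y \<partial>\<nu>)"
      by (intro nn_integral_cong nn_integral_multc) measurable
    also have "\<dots> = (\<integral>\<^sup>+y. indicator B y \<partial>\<nu>)"
      using col1 by (intro nn_integral_cong_AE) (auto elim: eventually_mono)
    finally show "emeasure (distr \<gamma> borel snd) B = emeasure \<nu> B" using B sets by simp
  qed (simp add: sets)
  moreover have "prob_space \<gamma>"
  proof (rule prob_spaceI)
    have "emeasure \<gamma> (space \<gamma>) = (\<integral>\<^sup>+p. W p \<partial>(\<mu> \<Otimes>\<^sub>M \<nu>))"
      unfolding \<gamma>_def by (subst emeasure_density) (auto intro!: nn_integral_cong simp: indicator_def)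
    also have "\<dots> = (\<integral>\<^sup>+x. \<integral>\<^sup>+y. W (x, y) \<partial>\<nu> \<partial>\<mu>)"
      by (rule \<nu>.nn_integral_fst[symmetric]) measurable
    also have "\<dots> = (\<integral>\<^sup>+x. 1 \<partial>\<mu>)" by (intro nn_integral_cong_AE row1)
    also have "\<dots> = 1" by (simp add: \<mu>.emeasure_space_1)
    finally show "emeasure \<gamma> (space \<gamma>) = 1" .
  qed
  ultimately have "\<gamma> \<in> couplings \<mu> \<nu>" by (simp add: couplings_def \<gamma>_def sp)
  moreover have "(\<integral>\<^sup>+p. F p \<partial>\<gamma>) \<le> ennreal (\<Sum>i<N. \<Sum>j<N. \<pi> (i, j) * G i j)"
  proof -
    have F'[measurable]: "F \<in> borel_measurable (borel \<Otimes>\<^sub>M borel)" using F by (simp add: borel_prod)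
    have "(\<integral>\<^sup>+p. F p \<partial>\<gamma>) = (\<integral>\<^sup>+x. \<integral>\<^sup>+y. W (x, y) * F (x, y) \<partial>\<nu> \<partial>\<mu>)"
      unfolding \<gamma>_def by (subst nn_integral_density, measurable) (subst \<nu>.nn_integral_fst, auto)
    also have "\<dots> \<le> (\<integral>\<^sup>+x. \<integral>\<^sup>+y. ennreal (w (idx x) (idx y)) * ennreal (G (idx x) (idx y)) \<partial>\<nu> \<partial>\<mu>)"
      using FG unfolding W_def prod.case
      by (intro nn_integral_mono_AE) (auto elim!: eventually_mono intro!: nn_integral_mono_AE mult_left_mono)
    also have "\<dots> = (\<integral>\<^sup>+x. (\<Sum>j<N. (ennreal (w (idx x) j) * ennreal (G (idx x) j)) * ennreal (n j)) \<partial>\<mu>)"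
      by (intro nn_integral_cong part(2))
    also have "\<dots> = (\<Sum>i<N. (\<Sum>j<N. (ennreal (w i j) * ennreal (G i j)) * ennreal (n j)) * ennreal (m i))"
      by (rule part(1))
    also have "\<dots> = ennreal (\<Sum>i<N. (\<Sum>j<N. w i j * G i j * n j) * m i)"
      using w0 mn G by (simp add: ennreal_mult[symmetric] sum_ennreal sum_nonneg)
    also have "(\<Sum>i<N. (\<Sum>j<N. w i j * G i j * n j) * m i) = (\<Sum>i<N. \<Sum>j<N. \<pi> (i, j) * G i j)"
      unfolding sum_distrib_right by (intro sum.cong refl) (simp add: wmn[symmetric])
    finally show ?thesis .
  qed
  ultimately show thesis by (rule that)
qed

text \<open>
  The cells are the fibres of \<open>idx\<close>, which maps a point to the first of finitely many balls that
  contains it.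
\<close>

lemma finite_small_cells:
  fixes K :: "(real ^ 'n) set"
  assumes "compact K" "K \<noteq> {}" "0 < \<delta>"
  obtains idx :: "real ^ 'n \<Rightarrow> nat" and N and ctr :: "nat \<Rightarrow> real ^ 'n"
  where "idx \<in> borel \<rightarrow>\<^sub>M count_space UNIV" "\<And>x. idx x < N"
    "\<And>x. x \<in> K \<Longrightarrow> norm (x - ctr (idx x)) < \<delta>"
proof -
  obtain T where T: "T \<subseteq> K" "finite T" "K \<subseteq> (\<Union>x\<in>T. ball x \<delta>)"
    using compactE_image[OF \<open>compact K\<close>, of K "\<lambda>x. ball x \<delta>"] \<open>0 < \<delta>\<close> by force
  obtain xs where xs: "set xs = T" using finite_list[OF T(2)] by blast
  define N where "N = length xs"
  have "T \<noteq> {}" using T \<open>K \<noteq> {}\<close> by auto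
  then have "N > 0" using xs by (auto simp: N_def)
  \<comment> \<open>The first alternative sends points outside all balls to the last index.\<close>
  define idx where "idx x = (LEAST i. N \<le> Suc i \<or> norm (x - xs ! i) < \<delta>)" for x
  have idx_le: "idx x \<le> N - 1" for x unfolding idx_def by (rule Least_le) linarith
  show thesis
  proof (rule that[of idx N "\<lambda>i. xs ! i"])
    show "idx \<in> borel \<rightarrow>\<^sub>M count_space UNIV" unfolding idx_def by measurable
    show "idx x < N" for x using idx_le[of x] \<open>N > 0\<close> by simp
    show "norm (x - xs ! idx x) < \<delta>" if "x \<in> K" for x
    proof -
      obtain t where "t \<in> set xs" "x \<in> ball t \<delta>" using T(3) \<open>x \<in> K\<close> xs by blast
      then obtain i where i: "i < N" "norm (x - xs ! i) < \<delta>"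
        by (auto simp: N_def in_set_conv_nth dist_norm norm_minus_commute)
      then have "idx x \<le> i" unfolding idx_def by (intro Least_le) simp
      have "N \<le> Suc (idx x) \<or> norm (x - xs ! idx x) < \<delta>"
        unfolding idx_def using i
        by (intro LeastI[of "\<lambda>i. N \<le> Suc i \<or> norm (x - xs ! i) < \<delta>" i]) simp
      then show ?thesis
      proof
        assume "N \<le> Suc (idx x)"
        then have "idx x = i" using \<open>idx x \<le> i\<close> i(1) by linarith
        then show ?thesis using i(2) by simp
      qed
    qed
  qed
qed

text \<open>
  The hard half of Kantorovich duality. Choose cells of diameter so small that replacing a point
  by the centre of its cell changes the cost by at most \<open>e / 4\<close>. A 1-Lipschitz function on the centres extends to
  the whole space by the formula of McShane, so the dual bound passes to the finite problem with an
  error \<open>e / 2\<close>; the lifted finite plan costs at most another \<open>e / 2\<close>.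
\<close>

lemma wasserstein_le_dual:
  fixes \<mu> \<nu> :: "(real ^ 'n) measure"
  assumes s: "0 < s" "s \<le> 1" and "compact K"
    and \<mu>: "prob_space \<mu>" "sets \<mu> = sets borel" "emeasure \<mu> K = 1"
    and \<nu>: "prob_space \<nu>" "sets \<nu> = sets borel" "emeasure \<nu> K = 1"
    and dual: "\<And>f. (\<And>x y. \<bar>f x - f y\<bar> \<le> norm (x - y) powr s) \<Longrightarrow> (\<integral>x. f x \<partial>\<mu>) - (\<integral>x. f x \<partial>\<nu>) \<le> D"
  shows "wasserstein s \<mu> \<nu> \<le> ennreal D"
proof (rule ennreal_le_epsilon)
  fix e :: real assume "0 < e"
  interpret \<mu>: prob_space \<mu> by fact
  interpret \<nu>: prob_space \<nu> by fact
  have sets[measurable_cong]: "sets \<mu> = sets borel" "sets \<nu> = sets borel" by fact+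
  have space: "space \<mu> = UNIV" "space \<nu> = UNIV"
    using sets_eq_imp_space_eq[OF sets(1)] sets_eq_imp_space_eq[OF sets(2)] by auto
  have "K \<noteq> {}" using \<mu>(3) by auto
  have "K \<in> sets borel" using \<open>compact K\<close> by (simp add: borel_compact)
  have AEK: "AE x in \<mu>. x \<in> K" "AE x in \<nu>. x \<in> K"
    using \<mu>(3) \<nu>(3) \<open>K \<in> sets borel\<close> sets
    by (auto intro!: \<mu>.AE_prob_1 \<nu>.AE_prob_1 simp: measure_def)
  define \<delta> where "\<delta> = (e / 4) powr (1 / s)"
  have \<delta>: "0 < \<delta>" "\<delta> powr s = e / 4" using s \<open>0 < e\<close> by (auto simp: \<delta>_def powr_powr)
  obtain idx N ctr where idx[measurable]: "idx \<in> borel \<rightarrow>\<^sub>M count_space (UNIV :: nat set)"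
    and idx_less: "\<And>x. idx x < N" and ctr: "\<And>x. x \<in> K \<Longrightarrow> norm (x - ctr (idx x)) < \<delta>"
    using finite_small_cells[OF \<open>compact K\<close> \<open>K \<noteq> {}\<close> \<delta>(1)] by metis
  define d where "d x y = norm (x - y) powr s" for x y :: "real ^ 'n"
  have d_tri: "d x z \<le> d x y + d y z" for x y z
    unfolding d_def using s by (rule norm_powr_triangle)
  have d_sym: "d x y = d y x" for x y by (simp add: d_def norm_minus_commute)
  have near: "d x (ctr (idx x)) \<le> e / 4" if "x \<in> K" for x
    unfolding d_def \<delta>(2)[symmetric] using ctr[OF that] s by (intro powr_mono2) auto
  define c where "c i j = d (ctr i) (ctr j)" for i j
  define m where "m i = measure \<mu> (idx -` {i})" for i
  define n where "n i = measure \<nu> (idx -` {i})" for i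
  have "N > 0" using idx_less[of undefined] by simp
  have finite_dual: "(\<Sum>i<N. h i * (m i - n i)) \<le> D + e / 2"
    if h: "\<And>i j. \<bar>h i - h j\<bar> \<le> c i j" for h
  proof -
    \<comment> \<open>The McShane extension of h.\<close>
    define f where "f x = Min ((\<lambda>i. h i + d x (ctr i)) ` {..<N})" for x
    have f_le: "f x \<le> h i + d x (ctr i)" if "i < N" for x i
      unfolding f_def using that by (intro Min_le) auto
    have f_attained: "\<exists>i<N. f x = h i + d x (ctr i)" for x
    proof -
      have "f x \<in> (\<lambda>i. h i + d x (ctr i)) ` {..<N}"
        unfolding f_def using \<open>N > 0\<close> by (intro Min_in) auto
      then show ?thesis by auto
    qed
    have "f x - f y \<le> d x y" for x y
    proof -
      obtain i where "i < N" "f y = h i + d y (ctr i)" using f_attained by blast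
      then show ?thesis using f_le[of i x] d_tri[of x "ctr i" y] by linarith
    qed
    from this[of x y for x y] this[of y x for x y]
    have f_holder: "\<bar>f x - f y\<bar> \<le> d x y" for x y
      using d_sym[of x y] by (smt (verit))
    have "continuous_on UNIV f"
      using f_holder s by (intro continuous_on_holder[where C = 1 and s = s]) (auto simp: d_def)
    then have [measurable]: "f \<in> borel_measurable borel" by (rule borel_measurable_continuous_onI)
    have f_ctr: "f (ctr i) = h i" if "i < N" for i
    proof (rule antisym)
      show "f (ctr i) \<le> h i" using f_le[OF that, of "ctr i"] by (simp add: d_def)
      obtain j where "f (ctr i) = h j + d (ctr i) (ctr j)" using f_attained by blast
      then show "h i \<le> f (ctr i)" using h[of i j] by (simp add: c_def)
    qed
    have close: "\<bar>f x - h (idx x)\<bar> \<le> e / 4" if "x \<in> K" for x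
      using f_holder[of x "ctr (idx x)"] near[OF that] f_ctr[OF idx_less] by simp
    have close_le: "h (idx x) \<le> f x + e / 4" "f x - e / 4 \<le> h (idx x)" if "x \<in> K" for x
      using close[OF that] by linarith+
    have bound: "\<bar>f x\<bar> \<le> (\<Sum>i<N. \<bar>h i\<bar>) + e / 4" if "x \<in> K" for x
    proof -
      have "\<bar>h (idx x)\<bar> \<le> (\<Sum>i<N. \<bar>h i\<bar>)"
        using idx_less by (intro member_le_sum[of "idx x" _ "\<lambda>i. \<bar>h i\<bar>"]) auto
      then show ?thesis using close[OF that] by linarith
    qed
    have intf: "integrable \<mu> f" "integrable \<nu> f"
      using AEK by (auto intro!: \<mu>.integrable_const_bound \<nu>.integrable_const_bound
          elim!: eventually_mono intro: bound)
    have \<mu>h: "(\<integral>x. h (idx x) \<partial>\<mu>) = (\<Sum>i<N. h i * m i)" "integrable \<mu> (\<lambda>x. h (idx x))"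
      using integral_finite_partition[OF \<mu>(1), of idx N h] idx_less by (auto simp: space m_def)
    have \<nu>h: "(\<integral>x. h (idx x) \<partial>\<nu>) = (\<Sum>i<N. h i * n i)" "integrable \<nu> (\<lambda>x. h (idx x))"
      using integral_finite_partition[OF \<nu>(1), of idx N h] idx_less by (auto simp: space n_def)
    have "(\<integral>x. h (idx x) \<partial>\<mu>) \<le> (\<integral>x. f x + e / 4 \<partial>\<mu>)"
      using AEK(1) intf \<mu>h by (intro integral_mono_AE) (auto elim!: eventually_mono intro: close_le)
    moreover have "(\<integral>x. f x - e / 4 \<partial>\<nu>) \<le> (\<integral>x. h (idx x) \<partial>\<nu>)"
      using AEK(2) intf \<nu>h by (intro integral_mono_AE) (auto elim!: eventually_mono intro: close_le)
    moreover have "(\<integral>x. f x \<partial>\<mu>) - (\<integral>x. f x \<partial>\<nu>) \<le> D"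
      using f_holder by (intro dual) (simp add: d_def)
    ultimately show ?thesis
      using intf \<mu>h \<nu>h by (simp add: right_diff_distrib sum_subtractf \<mu>.prob_space \<nu>.prob_space)
  qed
  obtain \<pi> where \<pi>: "\<And>p. 0 \<le> \<pi> p"
    and row: "\<And>i. i \<in> {..<N} \<Longrightarrow> (\<Sum>j<N. \<pi> (i, j)) = m i"
    and col: "\<And>j. j \<in> {..<N} \<Longrightarrow> (\<Sum>i<N. \<pi> (i, j)) = n j"
    and cost: "(\<Sum>i<N. \<Sum>j<N. \<pi> (i, j) * c i j) \<le> D + e / 2"
  proof (rule finite_transport_duality[of "{..<N}" c m n "D + e / 2"])
    show "c i k \<le> c i j + c j k" for i j k unfolding c_def by (rule d_tri)
    show "c i j = c j i" for i j unfolding c_def by (rule d_sym)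
  qed (use \<open>N > 0\<close> finite_dual in \<open>auto simp: c_def d_def m_def n_def\<close>)
  have total: "(\<Sum>i<N. \<Sum>j<N. \<pi> (i, j)) = 1"
    using row integral_finite_partition(1)[OF \<mu>(1), of idx N "\<lambda>_. 1"] idx_less
    by (simp add: m_def space \<mu>.prob_space[unfolded space])
  obtain \<gamma> where \<gamma>: "\<gamma> \<in> couplings \<mu> \<nu>"
    and le: "(\<integral>\<^sup>+p. ennreal (d (fst p) (snd p)) \<partial>\<gamma>) \<le> ennreal (\<Sum>i<N. \<Sum>j<N. \<pi> (i, j) * (c i j + e / 2))"
  proof (rule coupling_from_cell_plan[of \<mu> \<nu> idx N \<pi> "\<lambda>p. ennreal (d (fst p) (snd p))" "\<lambda>i j. c i j + e / 2"])
    show "(\<lambda>p. ennreal (d (fst p) (snd p))) \<in> borel_measurable borel"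
      unfolding d_def borel_prod[symmetric] by measurable
    show "AE x in \<mu>. AE y in \<nu>. ennreal (d (fst (x, y)) (snd (x, y))) \<le> ennreal (c (idx x) (idx y) + e / 2)"
      using AEK(1)
    proof eventually_elim
      case (elim x)
      show ?case using AEK(2)
      proof eventually_elim
        case (elim y)
        have "d x y \<le> d x (ctr (idx x)) + (d (ctr (idx x)) (ctr (idx y)) + d (ctr (idx y)) y)"
          using d_tri[of x y "ctr (idx x)"] d_tri[of "ctr (idx x)" y "ctr (idx y)"] by linarith
        then show ?case
          using near[OF \<open>x \<in> K\<close>] near[OF elim] d_sym[of y]
          by (intro ennreal_leI) (simp add: c_def)
      qed
    qed
  qed (use \<mu> \<nu> \<pi> row col idx_less \<open>0 < e\<close> in \<open>auto simp: m_def n_def c_def d_def\<close>)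
  have "wasserstein s \<mu> \<nu> \<le> (\<integral>\<^sup>+(x, y). ennreal (norm (x - y) powr s) \<partial>\<gamma>)"
    unfolding wasserstein_def using \<gamma> by (rule INF_lower)
  also have "\<dots> = (\<integral>\<^sup>+p. ennreal (d (fst p) (snd p)) \<partial>\<gamma>)" by (simp add: d_def case_prod_unfold)
  also note le
  also have "(\<Sum>i<N. \<Sum>j<N. \<pi> (i, j) * (c i j + e / 2)) \<le> D + e"
    using cost total by (simp add: distrib_left sum.distrib sum_divide_distrib[symmetric] sum_distrib_right[symmetric])
  also have "ennreal (D + e) \<le> ennreal D + ennreal e"
    using dual[of "\<lambda>_. 0"] \<open>0 < e\<close> by (simp add: ennreal_plus)
  finally show "wasserstein s \<mu> \<nu> \<le> ennreal D + ennreal e" by (simp add: ennreal_leI)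
qed

section \<open>Square-integrable functions\<close>

lemma L2_measurable: "f \<in> L2 \<Longrightarrow> f \<in> borel_measurable borel"
  by (simp add: L2_def)

lemma L2_square_integrable: "f \<in> L2 \<Longrightarrow> integrable lborel (\<lambda>x. (norm (f x))\<^sup>2)"
  by (simp add: L2_def)

lemma L2_norm_product_integrable:
  assumes "f \<in> L2" "g \<in> L2"
  shows "integrable lborel (\<lambda>x. norm (f x) * norm (g x))"
proof (rule Bochner_Integration.integrable_bound)
  show "integrable lborel (\<lambda>x. (norm (f x))\<^sup>2 + (norm (g x))\<^sup>2)"
    using assms by (intro Bochner_Integration.integrable_add L2_square_integrable)
  show "(\<lambda>x. norm (f x) * norm (g x)) \<in> borel_measurable lborel"
    using assms by (auto dest!: L2_measurable)
  have "a * b \<le> a\<^sup>2 + b\<^sup>2" if "0 \<le> a" "0 \<le> b" for a b :: real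
  proof -
    have "2 * (a * b) \<le> a\<^sup>2 + b\<^sup>2" using sum_squares_bound[of a b] by (simp add: mult.assoc)
    moreover have "0 \<le> a * b" using that by simp
    ultimately show ?thesis by linarith
  qed
  then show "AE x in lborel. norm (norm (f x) * norm (g x)) \<le> norm ((norm (f x))\<^sup>2 + (norm (g x))\<^sup>2)"
    by (simp add: abs_mult)
qed

lemma borel_measurable_cnj_compose [measurable]:
  fixes f :: "'a \<Rightarrow> complex"
  assumes "f \<in> borel_measurable M"
  shows "(\<lambda>x. cnj (f x)) \<in> borel_measurable M"
proof -
  have "cnj \<in> borel_measurable borel"
    by (intro borel_measurable_continuous_onI continuous_on_cnj continuous_on_id)
  with assms show ?thesis by (rule measurable_compose)
qed

lemma L2_product_integrable:
  assumes "f \<in> L2" "g \<in> L2"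
  shows "integrable lborel (\<lambda>x. f x * cnj (g x))"
proof (rule Bochner_Integration.integrable_bound[OF L2_norm_product_integrable[OF assms]])
  show "(\<lambda>x. f x * cnj (g x)) \<in> borel_measurable lborel"
    using assms by (auto dest!: L2_measurable)
qed (simp add: norm_mult)

lemma L2_add:
  assumes "f \<in> L2" "g \<in> L2"
  shows "(\<lambda>x. f x + g x) \<in> L2"
proof -
  have meas: "f \<in> borel_measurable borel" "g \<in> borel_measurable borel" using assms by (auto dest: L2_measurable)
  have "integrable lborel (\<lambda>x. (norm (f x + g x))\<^sup>2)"
  proof (rule Bochner_Integration.integrable_bound)
    show "integrable lborel (\<lambda>x. (norm (f x))\<^sup>2 + 2 * (norm (f x) * norm (g x)) + (norm (g x))\<^sup>2)"
      using assms by (intro Bochner_Integration.integrable_add integrable_mult_right L2_square_integrable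
          L2_norm_product_integrable)
    have "(norm (f x + g x))\<^sup>2 \<le> (norm (f x))\<^sup>2 + 2 * (norm (f x) * norm (g x)) + (norm (g x))\<^sup>2" for x
      using power_mono[OF norm_triangle_ineq[of "f x" "g x"], of 2]
      by (simp add: power2_eq_square algebra_simps)
    then show "AE x in lborel. norm ((norm (f x + g x))\<^sup>2)
        \<le> norm ((norm (f x))\<^sup>2 + 2 * (norm (f x) * norm (g x)) + (norm (g x))\<^sup>2)"
      by (auto intro!: AE_I2 order_trans[OF _ abs_ge_self])
  qed (use meas in measurable)
  then show ?thesis using meas by (simp add: L2_def)
qed

lemma L2_cmult: "f \<in> L2 \<Longrightarrow> (\<lambda>x. c * f x) \<in> L2"
  by (auto simp: L2_def norm_mult power_mult_distrib)

lemma L2_diff: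
  assumes "f \<in> L2" "g \<in> L2"
  shows "(\<lambda>x. f x - g x) \<in> L2"
  using L2_add[OF assms(1) L2_cmult[OF assms(2), of "-1"]] by simp

lemma L2_zero: "(\<lambda>x. 0) \<in> L2"
  by (simp add: L2_def)

lemma L2_sum:
  assumes "\<And>i. i \<in> F \<Longrightarrow> f i \<in> L2"
  shows "(\<lambda>x. \<Sum>i\<in>F. f i x) \<in> L2"
  using assms by (induction F rule: infinite_finite_induct) (auto intro: L2_add L2_zero)

lemma L2_inner_add_left:
  assumes "f \<in> L2" "g \<in> L2" "h \<in> L2"
  shows "L2_inner (\<lambda>x. f x + g x) h = L2_inner f h + L2_inner g h"
  unfolding L2_inner_def distrib_right
  by (intro Bochner_Integration.integral_add L2_product_integrable assms)

lemma L2_inner_diff_left: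
  assumes "f \<in> L2" "g \<in> L2" "h \<in> L2"
  shows "L2_inner (\<lambda>x. f x - g x) h = L2_inner f h - L2_inner g h"
  unfolding L2_inner_def left_diff_distrib
  by (intro Bochner_Integration.integral_diff L2_product_integrable assms)

lemma L2_inner_commute: "L2_inner g f = cnj (L2_inner f g)"
  unfolding L2_inner_def by (subst Bochner_Integration.integral_cnj[symmetric]) (simp add: mult.commute)

lemma L2_inner_sum_left:
  assumes "\<And>i. i \<in> F \<Longrightarrow> f i \<in> L2" "h \<in> L2"
  shows "L2_inner (\<lambda>x. \<Sum>i\<in>F. c i * f i x) h = (\<Sum>i\<in>F. c i * L2_inner (f i) h)"
proof -
  have "L2_inner (\<lambda>x. \<Sum>i\<in>F. c i * f i x) h = (\<integral>x. (\<Sum>i\<in>F. c i * f i x * cnj (h x)) \<partial>lborel)"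
    unfolding L2_inner_def sum_distrib_right ..
  also have "\<dots> = (\<Sum>i\<in>F. \<integral>x. c i * f i x * cnj (h x) \<partial>lborel)"
    using assms by (intro Bochner_Integration.integral_sum L2_product_integrable L2_cmult) auto
  also have "\<dots> = (\<Sum>i\<in>F. c i * L2_inner (f i) h)"
    unfolding L2_inner_def mult.assoc by (simp only: integral_mult_right_zero)
  finally show ?thesis .
qed

lemma L2_norm_nonneg: "0 \<le> L2_norm f"
  by (simp add: L2_norm_def)

lemma L2_inner_self: "L2_inner f f = complex_of_real ((L2_norm f)\<^sup>2)"
proof -
  have "L2_inner f f = (\<integral>x. complex_of_real ((norm (f x))\<^sup>2) \<partial>lborel)"
    unfolding L2_inner_def by (simp only: complex_norm_square)
  then show ?thesis by (simp add: L2_norm_def del: of_real_power)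
qed

lemma L2_Cauchy_Schwarz_norm:
  assumes "f \<in> L2" "g \<in> L2"
  shows "(\<integral>x. norm (f x) * norm (g x) \<partial>lborel) \<le> L2_norm f * L2_norm g"
proof (rule power2_le_imp_le)
  have meas[measurable]: "f \<in> borel_measurable borel" "g \<in> borel_measurable borel"
    using assms by (auto dest: L2_measurable)
  have "(\<integral>\<^sup>+x. ennreal (norm (f x)) * ennreal (norm (g x)) \<partial>lborel)\<^sup>2
      \<le> (\<integral>\<^sup>+x. ennreal (norm (f x)) ^ 2 \<partial>lborel) * (\<integral>\<^sup>+x. ennreal (norm (g x)) ^ 2 \<partial>lborel)"
    by (rule Cauchy_Schwarz_nn_integral) measurable
  moreover have "(\<integral>\<^sup>+x. ennreal (norm (f x)) * ennreal (norm (g x)) \<partial>lborel)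
      = ennreal (\<integral>x. norm (f x) * norm (g x) \<partial>lborel)"
    using L2_norm_product_integrable[OF assms]
    by (simp add: ennreal_mult[symmetric] nn_integral_eq_integral)
  moreover have "(\<integral>\<^sup>+x. ennreal (norm (h x)) ^ 2 \<partial>lborel) = ennreal ((L2_norm h)\<^sup>2)" if "h \<in> L2" for h
    using L2_square_integrable[OF that]
    by (simp add: ennreal_power nn_integral_eq_integral L2_norm_def)
  note this[OF assms(1)] this[OF assms(2)]
  ultimately have "ennreal ((\<integral>x. norm (f x) * norm (g x) \<partial>lborel)\<^sup>2) \<le> ennreal ((L2_norm f)\<^sup>2 * (L2_norm g)\<^sup>2)"
    by (simp add: ennreal_power ennreal_mult)
  then show "(\<integral>x. norm (f x) * norm (g x) \<partial>lborel)\<^sup>2 \<le> (L2_norm f * L2_norm g)\<^sup>2"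
    by (simp add: power_mult_distrib)
qed (simp add: L2_norm_nonneg)

lemma L2_Cauchy_Schwarz:
  assumes "f \<in> L2" "g \<in> L2"
  shows "norm (L2_inner f g) \<le> L2_norm f * L2_norm g"
proof -
  have "norm (L2_inner f g) \<le> (\<integral>x. norm (f x * cnj (g x)) \<partial>lborel)"
    unfolding L2_inner_def by (rule integral_norm_bound)
  also have "\<dots> \<le> L2_norm f * L2_norm g"
    using L2_Cauchy_Schwarz_norm[OF assms] by (simp add: norm_mult)
  finally show ?thesis .
qed

lemma L2_norm_zero_AE:
  assumes "f \<in> L2" "L2_norm f = 0"
  shows "AE x in lborel. f x = 0"
proof -
  have "(\<integral>x. (norm (f x))\<^sup>2 \<partial>lborel) = 0" using assms(2) by (simp add: L2_norm_def)
  then have "AE x in lborel. (norm (f x))\<^sup>2 = 0"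
    using integral_nonneg_eq_0_iff_AE[OF L2_square_integrable[OF assms(1)]] by simp
  then show ?thesis by (rule eventually_mono) simp
qed

text \<open>
  Vectors orthogonal to a basis are orthogonal to its closed span, by the Cauchy-Schwarz
  inequality.
\<close>

lemma L2_orthogonal_to_basis:
  assumes f: "f \<in> L2" and b: "\<And>i. i \<in> I \<Longrightarrow> b i \<in> L2"
    and orth: "\<And>i. i \<in> I \<Longrightarrow> L2_inner f (b i) = 0"
    and v: "v \<in> L2_closure (L2_span I b)"
  shows "L2_inner f v = 0"
proof -
  have small: "norm (L2_inner f v) \<le> L2_norm f * e" if "0 < e" for e
  proof -
    have "v \<in> L2" and "\<exists>g\<in>L2_span I b. L2_norm (\<lambda>x. v x - g x) < e"
      using v \<open>0 < e\<close> by (auto simp: L2_closure_def)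
    then obtain g where g: "g \<in> L2_span I b" "L2_norm (\<lambda>x. v x - g x) < e" by blast
    obtain F c where F: "finite F" "F \<subseteq> I" and g_eq: "g = (\<lambda>x. \<Sum>i\<in>F. c i * b i x)"
      using g(1) by (auto simp: L2_span_def)
    have "g \<in> L2" unfolding g_eq using F b by (intro L2_sum L2_cmult) auto
    have "L2_inner g f = (\<Sum>i\<in>F. c i * L2_inner (b i) f)"
      unfolding g_eq using F b f by (intro L2_inner_sum_left) auto
    also have "\<dots> = 0"
      using F orth by (intro sum.neutral) (auto simp: L2_inner_commute[of "b _" f])
    finally have "L2_inner v f = L2_inner (\<lambda>x. v x - g x) f"
      using \<open>v \<in> L2\<close> \<open>g \<in> L2\<close> f by (simp add: L2_inner_diff_left)
    then have "norm (L2_inner f v) = norm (L2_inner (\<lambda>x. v x - g x) f)"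
      by (subst L2_inner_commute) simp
    also have "\<dots> \<le> L2_norm (\<lambda>x. v x - g x) * L2_norm f"
      using \<open>v \<in> L2\<close> \<open>g \<in> L2\<close> f by (intro L2_Cauchy_Schwarz L2_diff)
    also have "\<dots> \<le> L2_norm f * e"
      using g(2) L2_norm_nonneg[of f] mult_right_mono[of "L2_norm (\<lambda>x. v x - g x)" e "L2_norm f"]
      by (simp add: mult.commute[of e])
    finally show ?thesis .
  qed
  have "norm (L2_inner f v) \<le> 0"
  proof (rule field_le_epsilon)
    fix e :: real assume "0 < e"
    have "norm (L2_inner f v) \<le> L2_norm f * (e / (L2_norm f + 1))"
      using \<open>0 < e\<close> L2_norm_nonneg[of f] by (intro small) (simp add: divide_pos_pos add_nonneg_pos)
    also have "\<dots> \<le> e" using \<open>0 < e\<close> L2_norm_nonneg[of f] by (simp add: field_simps)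
    finally show "norm (L2_inner f v) \<le> 0 + e" by simp
  qed
  then show ?thesis by simp
qed

text \<open>
  The orthogonal projection is the best approximation.
\<close>

lemma L2_norm_le_of_orthogonal:
  assumes "f \<in> L2" "P \<in> L2" "g \<in> L2" and "L2_inner (\<lambda>x. f x - P x) g = 0" "L2_inner (\<lambda>x. f x - P x) P = 0"
  shows "L2_norm (\<lambda>x. f x - P x) \<le> L2_norm (\<lambda>x. f x - g x)"
proof -
  let ?u = "\<lambda>x. f x - P x"
  have u: "?u \<in> L2" using assms by (intro L2_diff)
  have "L2_inner P ?u = 0" "L2_inner g ?u = 0"
    using assms(4,5) L2_inner_commute[of P ?u] L2_inner_commute[of g ?u] by simp_all
  then have eq: "L2_inner ?u ?u = L2_inner (\<lambda>x. f x - g x) ?u"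
    using L2_inner_diff_left[OF assms(1,2) u] L2_inner_diff_left[OF assms(1,3) u] by simp
  have "(L2_norm ?u)\<^sup>2 = norm (L2_inner ?u ?u)"
    by (simp only: L2_inner_self norm_of_real abs_power2)
  also have "\<dots> = norm (L2_inner (\<lambda>x. f x - g x) ?u)" by (simp only: eq)
  also have "\<dots> \<le> L2_norm (\<lambda>x. f x - g x) * L2_norm ?u"
    using assms u by (intro L2_Cauchy_Schwarz L2_diff)
  finally have "L2_norm ?u * L2_norm ?u \<le> L2_norm (\<lambda>x. f x - g x) * L2_norm ?u"
    by (simp add: power2_eq_square)
  then show ?thesis
    using L2_norm_nonneg[of ?u] L2_norm_nonneg[of "\<lambda>x. f x - g x"]
    by (cases "L2_norm ?u = 0") auto
qed

lemma integrable_bounded_support: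
  fixes f :: "real ^ 'n \<Rightarrow> 'b :: {banach, second_countable_topology}"
  assumes "f \<in> borel_measurable borel" "\<And>x. norm x \<le> R \<Longrightarrow> norm (f x) \<le> B" "\<And>x. R < norm x \<Longrightarrow> f x = 0"
  shows "integrable lborel f"
  by (rule integrableI_bounded_set[where A = "cball 0 R" and B = B])
    (use assms emeasure_lborel_cball_finite[of 0 R] in \<open>auto simp: less_top not_le\<close>)

lemma L2_bounded_support:
  assumes "f \<in> borel_measurable borel" "\<And>x. norm x \<le> R \<Longrightarrow> norm (f x) \<le> B" "\<And>x. R < norm x \<Longrightarrow> f x = 0"
  shows "f \<in> L2"
proof -
  have "integrable lborel (\<lambda>x. (norm (f x))\<^sup>2)"
    by (rule integrable_bounded_support[where R = R and B = "B\<^sup>2"])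
      (use assms in \<open>auto intro: power_mono\<close>)
  then show ?thesis using assms by (simp add: L2_def)
qed

section \<open>Dilations, lattice points and regular functions\<close>

lemma lborel_integral_affine:
  fixes f :: "real ^ 'n \<Rightarrow> 'b :: {banach, second_countable_topology}"
  assumes "0 < c" and f: "f \<in> borel_measurable borel"
  shows "(\<integral>x. f (c *\<^sub>R x - v) \<partial>lborel) = (1 / c ^ CARD('n)) *\<^sub>R (\<integral>y. f y \<partial>lborel)"
proof -
  have "(\<integral>y. f y \<partial>lborel) = integral\<^sup>L (density (distr lborel borel (\<lambda>x. - v + c *\<^sub>R x)) (\<lambda>_. \<bar>c\<bar> ^ CARD('n))) f"
    using \<open>0 < c\<close> lborel_affine[of c "- v"] by simp
  also have "\<dots> = (\<integral>y. \<bar>c\<bar> ^ CARD('n) *\<^sub>R f y \<partial>(distr lborel borel (\<lambda>x. - v + c *\<^sub>R x)))"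
    using f by (intro integral_density) auto
  also have "\<dots> = (\<integral>x. \<bar>c\<bar> ^ CARD('n) *\<^sub>R f (- v + c *\<^sub>R x) \<partial>lborel)"
    using f by (intro integral_distr) auto
  also have "\<dots> = c ^ CARD('n) *\<^sub>R (\<integral>x. f (c *\<^sub>R x - v) \<partial>lborel)"
    using \<open>0 < c\<close> by simp
  finally show ?thesis using \<open>0 < c\<close> by simp
qed

lemma powi_eq_powr: "2 powi j = 2 powr real_of_int j"
  by (simp add: powr_real_of_int')

text \<open>
  Moves the dilation and the translation from the wavelet to the test function.
\<close>

lemma integral_mult_rescale:
  fixes g :: "real ^ 'n \<Rightarrow> complex"
  assumes "g \<in> borel_measurable borel" "\<psi> \<in> borel_measurable borel"
  shows "(\<integral>x. g x * rescale \<psi> j k x \<partial>lborel)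
    = complex_of_real (2 powr (- real CARD('n) * real_of_int j / 2)) *
        (\<integral>y. g ((1 / 2 powi j) *\<^sub>R (y + lattice_vec k)) * \<psi> y \<partial>lborel)"
proof -
  let ?c = "2 powi j :: real"
  let ?h = "\<lambda>y. g ((1 / ?c) *\<^sub>R (y + lattice_vec k)) * \<psi> y"
  have "?c > 0" by simp
  have "(\<integral>x. g x * rescale \<psi> j k x \<partial>lborel)
      = (\<integral>x. complex_of_real (2 powr (real CARD('n) * real_of_int j / 2)) * ?h (?c *\<^sub>R x - lattice_vec k) \<partial>lborel)"
    unfolding rescale_def by (intro Bochner_Integration.integral_cong refl) simp
  also have "\<dots> = complex_of_real (2 powr (real CARD('n) * real_of_int j / 2)) *
      (\<integral>x. ?h (?c *\<^sub>R x - lattice_vec k) \<partial>lborel)"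
    by (rule integral_mult_right_zero)
  also have "(\<integral>x. ?h (?c *\<^sub>R x - lattice_vec k) \<partial>lborel) = (1 / ?c ^ CARD('n)) *\<^sub>R (\<integral>y. ?h y \<partial>lborel)"
    by (rule lborel_integral_affine[OF \<open>?c > 0\<close>]) (use assms in measurable)
  also have "1 / ?c ^ CARD('n) = 2 powr (- real CARD('n) * real_of_int j)"
    by (simp add: powi_eq_powr powr_powr powr_minus_divide mult.commute flip: powr_realpow)
  also have "complex_of_real (2 powr (real CARD('n) * real_of_int j / 2)) *
      (2 powr (- real CARD('n) * real_of_int j)) *\<^sub>R (\<integral>y. ?h y \<partial>lborel)
    = complex_of_real (2 powr (real CARD('n) * real_of_int j / 2) * 2 powr (- real CARD('n) * real_of_int j))
      * (\<integral>y. ?h y \<partial>lborel)"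
    by (simp add: scaleR_conv_of_real)
  also have "2 powr (real CARD('n) * real_of_int j / 2) * 2 powr (- real CARD('n) * real_of_int j)
      = 2 powr (- real CARD('n) * real_of_int j / 2)"
    by (simp add: powr_add[symmetric] field_simps)
  finally show ?thesis .
qed

lemma lattice_vec_diff: "lattice_vec (k - l) = lattice_vec k - lattice_vec l"
  by (simp add: lattice_vec_def vec_eq_iff)

lemma finite_lattice_ball: "finite {k :: int ^ 'n. norm (lattice_vec k) \<le> B}"
proof (rule finite_subset)
  let ?S = "{- \<lceil>B\<rceil>..\<lceil>B\<rceil>}"
  show "{k :: int ^ 'n. norm (lattice_vec k) \<le> B} \<subseteq> vec_lambda ` (PiE UNIV (\<lambda>_. ?S))"
  proof
    fix k :: "int ^ 'n" assume "k \<in> {k. norm (lattice_vec k) \<le> B}"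
    then have "\<bar>lattice_vec k $ i\<bar> \<le> B" for i
      using component_le_norm_cart[of "lattice_vec k" i] by simp
    then have "\<bar>real_of_int (k $ i)\<bar> \<le> B" for i by (simp add: lattice_vec_def)
    then have "k $ i \<in> ?S" for i
      by (smt (verit) atLeastAtMost_iff le_of_int_ceiling of_int_le_iff of_int_minus)
    then show "k \<in> vec_lambda ` (PiE UNIV (\<lambda>_. ?S))"
      by (intro image_eqI[of _ _ "\<lambda>i. k $ i"]) auto
  qed
  show "finite (vec_lambda ` (PiE (UNIV :: 'n set) (\<lambda>_. ?S)))"
    by (intro finite_imageI finite_PiE) auto
qed

text \<open>
  Translating by the componentwise floor of the centre reduces to a single ball about the origin.
\<close>

lemma lattice_points_near:
  obtains N where "\<And>z :: real ^ 'n. finite {k. norm (z - lattice_vec k) \<le> R}"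
    "\<And>z :: real ^ 'n. card {k. norm (z - lattice_vec k) \<le> R} \<le> N"
proof -
  define N where "N = {k :: int ^ 'n. norm (lattice_vec k) \<le> R + CARD('n)}"
  have "finite N" unfolding N_def by (rule finite_lattice_ball)
  have sub: "{k. norm (z - lattice_vec k) \<le> R} \<subseteq> (\<lambda>l. l + (\<chi> i. \<lfloor>z $ i\<rfloor>)) ` N" for z :: "real ^ 'n"
  proof
    fix k assume k: "k \<in> {k. norm (z - lattice_vec k) \<le> R}"
    let ?z = "\<chi> i. \<lfloor>z $ i\<rfloor>"
    have "norm (z - lattice_vec ?z) \<le> (\<Sum>i\<in>UNIV. \<bar>(z - lattice_vec ?z) $ i\<bar>)" by (rule norm_le_l1_cart)
    also have "\<dots> \<le> (\<Sum>i\<in>(UNIV :: 'n set). 1)"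
      by (intro sum_mono) (simp add: lattice_vec_def, linarith)
    finally have "norm (z - lattice_vec ?z) \<le> CARD('n)" by simp
    moreover have "lattice_vec (k - ?z) = (z - lattice_vec ?z) - (z - lattice_vec k)"
      by (simp add: lattice_vec_diff)
    ultimately have "norm (lattice_vec (k - ?z)) \<le> R + CARD('n)"
      using k norm_triangle_ineq4[of "z - lattice_vec ?z" "z - lattice_vec k"] by simp
    then show "k \<in> (\<lambda>l. l + ?z) ` N" by (intro image_eqI[of _ _ "k - ?z"]) (auto simp: N_def)
  qed
  show thesis
  proof (rule that[of "card N"])
    fix z :: "real ^ 'n"
    show "finite {k. norm (z - lattice_vec k) \<le> R}" using sub finite_imageI[OF \<open>finite N\<close>] by (rule finite_subset)
    show "card {k. norm (z - lattice_vec k) \<le> R} \<le> card N"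
      using card_mono[OF finite_imageI[OF \<open>finite N\<close>] sub[of z]] card_image_le[OF \<open>finite N\<close>]
      by (rule order_trans)
  qed
qed

lemma bounded_of_decay:
  fixes f :: "real ^ 'n \<Rightarrow> complex"
  assumes "continuous_on UNIV f" "rapidly_decaying f"
  obtains B where "0 \<le> B" "\<And>x. norm (f x) \<le> B"
proof -
  have "((\<lambda>x. norm (f x)) \<longlongrightarrow> 0) at_infinity"
    using assms(2) unfolding rapidly_decaying_def by (auto dest: spec[of _ 0])
  then have "\<forall>\<^sub>F x in at_infinity. norm (f x) < 1" by (rule order_tendstoD) simp
  then obtain R where R: "\<And>x. R \<le> norm x \<Longrightarrow> norm (f x) < 1"
    by (auto simp: eventually_at_infinity)
  have "compact (f ` cball 0 R)"
    using assms(1) by (intro compact_continuous_image continuous_on_subset[OF assms(1)]) auto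
  then obtain B where "\<forall>y\<in>f ` cball 0 R. norm y \<le> B"
    using compact_imp_bounded bounded_iff by metis
  then have B: "norm x \<le> R \<Longrightarrow> norm (f x) \<le> B" for x by simp
  show thesis
  proof (rule that[of "max 1 B"])
    show "norm (f x) \<le> max 1 B" for x
      using B[of x] R[of x] by (cases "norm x \<le> R") (auto simp: le_max_iff_disj)
  qed simp
qed

text \<open>
  Change the coordinates one after the other and apply the mean value inequality on each axis-parallel
  segment.
\<close>

lemma lipschitz_of_bounded_partials:
  fixes f :: "real ^ 'n \<Rightarrow> complex"
  assumes diff: "\<And>i. partially_differentiable i f"
    and bound: "\<And>i x. norm (partial_deriv i f x) \<le> B"
  shows "norm (f x - f y) \<le> (real CARD('n) * B) * norm (x - y)"
proof -
  have line: "norm (f (z + t *\<^sub>R axis i 1) - f z) \<le> B * \<bar>t\<bar>" for z t i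
  proof -
    have deriv: "((\<lambda>t. f (z + t *\<^sub>R axis i 1)) has_vector_derivative partial_deriv i f (z + u *\<^sub>R axis i 1)) (at u)" for u
    proof -
      have "(\<lambda>t. f ((z + u *\<^sub>R axis i 1) + t *\<^sub>R axis i 1)) differentiable (at 0)"
        using diff[of i] by (simp add: partially_differentiable_def)
      then have "((\<lambda>t. f ((z + u *\<^sub>R axis i 1) + t *\<^sub>R axis i 1))
          has_vector_derivative partial_deriv i f (z + u *\<^sub>R axis i 1)) (at (u - u))"
        by (simp add: partial_deriv_def vector_derivative_works)
      then have "((\<lambda>t. f ((z + u *\<^sub>R axis i 1) + t *\<^sub>R axis i 1)) \<circ> (\<lambda>t. t - u)
          has_vector_derivative (1 *\<^sub>R partial_deriv i f (z + u *\<^sub>R axis i 1))) (at u)"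
        by (intro vector_diff_chain_at) (auto intro!: derivative_eq_intros)
      moreover have "(\<lambda>t. f ((z + u *\<^sub>R axis i 1) + t *\<^sub>R axis i 1)) \<circ> (\<lambda>t. t - u) = (\<lambda>t. f (z + t *\<^sub>R axis i 1))"
        by (simp add: fun_eq_iff algebra_simps)
      ultimately show ?thesis by simp
    qed
    have "norm (f (z + t *\<^sub>R axis i 1) - f (z + 0 *\<^sub>R axis i 1)) \<le> B * norm (t - 0)"
      by (rule differentiable_bound[of UNIV _ "\<lambda>u h. h *\<^sub>R partial_deriv i f (z + u *\<^sub>R axis i 1)"])
        (use deriv bound in \<open>auto simp: has_vector_derivative_def onorm_scaleR_left onorm_id intro!: onorm_bound\<close>)
    then show ?thesis by simp
  qed
  \<comment> \<open>Interpolates from y (S empty) to x (S full), one coordinate at a time.\<close>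
  define z where "z S = (\<chi> i. if i \<in> S then x $ i else y $ i)" for S
  have "norm (f (z S) - f y) \<le> (\<Sum>i\<in>S. B * \<bar>x $ i - y $ i\<bar>)" if "finite S" for S
    using that
  proof (induction S)
    case empty
    have "z {} = y" by (simp add: z_def vec_eq_iff)
    then show ?case by simp
  next
    case (insert i S)
    have "z (insert i S) = z S + (x $ i - y $ i) *\<^sub>R axis i 1"
      using insert.hyps by (auto simp: z_def vec_eq_iff axis_def)
    then have "norm (f (z (insert i S)) - f (z S)) \<le> B * \<bar>x $ i - y $ i\<bar>" using line by simp
    then show ?case
      using insert norm_triangle_ineq[of "f (z (insert i S)) - f (z S)" "f (z S) - f y"] by simp
  qed
  moreover have "z UNIV = x" by (simp add: z_def vec_eq_iff)
  ultimately have "norm (f x - f y) \<le> (\<Sum>i\<in>UNIV. B * \<bar>x $ i - y $ i\<bar>)" by (metis finite_class.finite_UNIV)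
  also have "\<dots> \<le> (\<Sum>i\<in>(UNIV :: 'n set). B * norm (x - y))"
  proof (intro sum_mono mult_left_mono)
    show "\<bar>x $ i - y $ i\<bar> \<le> norm (x - y)" for i using component_le_norm_cart[of "x - y" i] by simp
    show "0 \<le> B" using bound[of undefined undefined] norm_ge_zero order_trans by blast
  qed
  finally show ?thesis by simp
qed

lemma regular_compactly_supported_bounds:
  fixes f :: "real ^ 'n \<Rightarrow> complex"
  assumes "regular_function r f" "1 \<le> r" "compactly_supported f"
  obtains B L R where "0 \<le> B" "0 \<le> L" "0 \<le> R" "\<And>x. norm (f x) \<le> B"
    "\<And>x y. norm (f x - f y) \<le> L * norm (x - y)" "\<And>x. R < norm x \<Longrightarrow> f x = 0"
    "f \<in> borel_measurable borel"
proof -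
  obtain q where r: "r = Suc q" using assms(2) by (cases r) auto
  have f: "continuous_on UNIV f" "rapidly_decaying f" "\<And>i. partially_differentiable i f"
    "\<And>i. regular_function q (partial_deriv i f)" using assms(1) by (auto simp: r)
  obtain B where B: "0 \<le> B" "\<And>x. norm (f x) \<le> B" using bounded_of_decay[OF f(1,2)] by blast
  have "\<exists>C. 0 \<le> C \<and> (\<forall>x. norm (partial_deriv i f x) \<le> C)" for i
  proof -
    have "continuous_on UNIV (partial_deriv i f)" "rapidly_decaying (partial_deriv i f)"
      using f(4)[of i] by (cases q; auto)+
    then show ?thesis using bounded_of_decay by metis
  qed
  then obtain C where C: "\<And>i. 0 \<le> C i" "\<And>i x. norm (partial_deriv i f x) \<le> C i" by metis
  define M where "M = (\<Sum>i\<in>UNIV. C i)"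
  have "C i \<le> M" for i unfolding M_def using C by (intro member_le_sum) auto
  then have M: "norm (partial_deriv i f x) \<le> M" for i x using C(2) order_trans by blast
  have "0 \<le> M" unfolding M_def using C by (intro sum_nonneg) auto
  have "bounded (closure {x. f x \<noteq> 0})"
    using assms(3) by (auto simp: compactly_supported_def intro: compact_imp_bounded)
  then have "bounded {x. f x \<noteq> 0}" by (rule bounded_subset) (rule closure_subset)
  then obtain R where "\<And>x. f x \<noteq> 0 \<Longrightarrow> norm x \<le> R" by (auto simp: bounded_iff)
  then have R: "max R 0 < norm x \<Longrightarrow> f x = 0" for x by force
  show thesis
  proof (rule that[of B "real CARD('n) * M" "max R 0"])
    show "norm (f x - f y) \<le> real CARD('n) * M * norm (x - y)" for x y
      using f(3) M by (rule lipschitz_of_bounded_partials)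
    show "f \<in> borel_measurable borel" using f(1) by (rule borel_measurable_continuous_onI)
  qed (use B R \<open>0 \<le> M\<close> in auto)
qed

section \<open>Expansions of compactly supported functions\<close>

lemma rescale_0: "rescale f 0 0 = f"
  by (simp add: rescale_def lattice_vec_def zero_vec_def[symmetric])

lemma closed_subspace_L2: "L2_closed_subspace V \<Longrightarrow> f \<in> V \<Longrightarrow> f \<in> L2"
  by (auto simp: L2_closed_subspace_def)

lemma closed_subspace_add: "L2_closed_subspace V \<Longrightarrow> f \<in> V \<Longrightarrow> g \<in> V \<Longrightarrow> (\<lambda>x. f x + g x) \<in> V"
  by (simp add: L2_closed_subspace_def)

lemma closed_subspace_cmult: "L2_closed_subspace V \<Longrightarrow> f \<in> V \<Longrightarrow> (\<lambda>x. c * f x) \<in> V"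
  by (simp add: L2_closed_subspace_def)

lemma closed_subspace_diff:
  assumes "L2_closed_subspace V" "f \<in> V" "g \<in> V"
  shows "(\<lambda>x. f x - g x) \<in> V"
  using closed_subspace_add[OF assms(1,2) closed_subspace_cmult[OF assms(1,3), of "-1"]] by simp

lemma closed_subspace_sum:
  assumes V: "L2_closed_subspace V" and "\<And>i. i \<in> F \<Longrightarrow> f i \<in> V"
  shows "(\<lambda>x. \<Sum>i\<in>F. c i * f i x) \<in> V"
  using assms(2)
proof (induction F rule: infinite_finite_induct)
  case (insert i F)
  then have "(\<lambda>x. c i * f i x + (\<Sum>i\<in>F. c i * f i x)) \<in> V"
    using V by (intro closed_subspace_add closed_subspace_cmult) auto
  then show ?case using insert.hyps by simp
qed (use V in \<open>auto simp: L2_closed_subspace_def\<close>)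

lemma L2_inner_finite_expansion:
  assumes b: "\<And>i. i \<in> I \<Longrightarrow> b i \<in> L2"
    and orthonormal: "\<And>i j. i \<in> I \<Longrightarrow> j \<in> I \<Longrightarrow> L2_inner (b i) (b j) = (if i = j then 1 else 0)"
    and fin: "finite {i \<in> I. c i \<noteq> 0}" and l: "l \<in> I"
  shows "L2_inner (\<lambda>x. \<Sum>i | i \<in> I \<and> c i \<noteq> 0. c i * b i x) (b l) = c l"
proof -
  have "L2_inner (\<lambda>x. \<Sum>i | i \<in> I \<and> c i \<noteq> 0. c i * b i x) (b l)
      = (\<Sum>i | i \<in> I \<and> c i \<noteq> 0. c i * L2_inner (b i) (b l))"
    using b l by (intro L2_inner_sum_left) auto
  also have "\<dots> = (\<Sum>i | i \<in> I \<and> c i \<noteq> 0. if i = l then c i else 0)"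
    using orthonormal l by (intro sum.cong) auto
  also have "\<dots> = c l" using fin l by (simp add: sum.delta)
  finally show ?thesis .
qed

text \<open>
  Unless the supports meet, the coefficient vanishes.
\<close>

lemma rescale_coefficient_support:
  assumes supp: "AE x in lborel. \<rho> < norm x \<longrightarrow> p x = 0" and g: "\<And>x. R < norm x \<Longrightarrow> g x = 0"
    and nz: "L2_inner p (rescale g j k) \<noteq> 0"
  shows "\<exists>x. norm x \<le> \<rho> \<and> norm (2 powi j *\<^sub>R x - lattice_vec k) \<le> R"
proof (rule ccontr)
  assume "\<not> ?thesis"
  then have none: "R < norm (2 powi j *\<^sub>R x - lattice_vec k)" if "norm x \<le> \<rho>" for x
    using that by force
  have "AE x in lborel. p x * cnj (rescale g j k x) = 0"
    using supp
  proof eventually_elim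
    case (elim x)
    then show ?case using none[of x] g by (cases "norm x \<le> \<rho>") (auto simp: rescale_def)
  qed
  then have "L2_inner p (rescale g j k) = 0" unfolding L2_inner_def by (rule integral_eq_zero_AE)
  with nz show False by simp
qed

lemma finite_rescale_coefficients:
  assumes "AE x in lborel. \<rho> < norm x \<longrightarrow> p x = 0" "\<And>x. R < norm x \<Longrightarrow> g x = 0"
  shows "finite {k. L2_inner p (rescale g j k) \<noteq> 0}"
proof (rule finite_subset[OF _ finite_lattice_ball[of "2 powi j * \<rho> + R"]], safe)
  fix k assume "L2_inner p (rescale g j k) \<noteq> 0"
  then obtain x where x: "norm x \<le> \<rho>" "norm (2 powi j *\<^sub>R x - lattice_vec k) \<le> R"
    using rescale_coefficient_support[where g = g and R = R, OF assms] by blast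
  have "norm (lattice_vec k) \<le> norm (2 powi j *\<^sub>R x) + norm (2 powi j *\<^sub>R x - lattice_vec k)"
    using norm_triangle_sub[of "lattice_vec k" "2 powi j *\<^sub>R x"] by (simp add: norm_minus_commute)
  also have "\<dots> \<le> 2 powi j * \<rho> + R"
    unfolding norm_scaleR using x by (intro add_mono) (simp_all add: mult_left_mono)
  finally show "norm (lattice_vec k) \<le> 2 powi j * \<rho> + R" .
qed

text \<open>
  Wavelets of scale at least \<open>j0\<close> that meet the support of \<open>p\<close> live in a ball that depends on \<open>j0\<close> only;
  this makes the expansion of \<open>p\<close> beyond \<open>j0\<close> converge even against unbounded test functions.
\<close>

lemma rescale_localised:
  assumes p_supp: "AE x in lborel. \<rho> < norm x \<longrightarrow> p x = 0" and g_supp: "\<And>x. R < norm x \<Longrightarrow> g x = 0"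
    and "0 \<le> R" "j0 \<le> J" and nz: "L2_inner p (rescale g J k) \<noteq> 0"
    and far: "\<rho> + 2 * R / 2 powi j0 < norm x"
  shows "rescale g J k x = 0"
proof (rule ccontr)
  assume "rescale g J k x \<noteq> 0"
  then have "g (2 powi J *\<^sub>R x - lattice_vec k) \<noteq> 0" by (auto simp: rescale_def)
  then have 1: "norm (2 powi J *\<^sub>R x - lattice_vec k) \<le> R" using g_supp by force
  obtain y where y: "norm y \<le> \<rho>" "norm (2 powi J *\<^sub>R y - lattice_vec k) \<le> R"
    using rescale_coefficient_support[where g = g and R = R, OF p_supp g_supp nz] by blast
  have "2 powi J * norm (x - y) = norm ((2 powi J *\<^sub>R x - lattice_vec k) - (2 powi J *\<^sub>R y - lattice_vec k))"
    by (simp flip: scaleR_diff_right)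
  also have "\<dots> \<le> 2 * R"
    using norm_triangle_ineq4[of "2 powi J *\<^sub>R x - lattice_vec k" "2 powi J *\<^sub>R y - lattice_vec k"] 1 y(2)
    by linarith
  finally have "norm (x - y) \<le> 2 * R / 2 powi J" by (simp add: field_simps)
  also have "\<dots> \<le> 2 * R / 2 powi j0"
    using \<open>0 \<le> R\<close> \<open>j0 \<le> J\<close> by (intro divide_left_mono) (auto simp: powi_eq_powr)
  finally have "norm x \<le> \<rho> + 2 * R / 2 powi j0" using norm_triangle_sub[of x y] y(1) by simp
  with far show False by simp
qed

text \<open>
  The consequences of regularity and compact support that the argument uses: the
  scaling function and all wavelets share a bound \<open>B\<close>, a Lipschitz constant \<open>L\<close> and a ball of radius
  \<open>R\<close> that contains their supports.
\<close>

locale compact_wavelet_system =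
  fixes A :: "'e set" and \<phi> :: "real ^ 'n \<Rightarrow> complex" and \<psi> :: "'e \<Rightarrow> real ^ 'n \<Rightarrow> complex"
    and V :: "int \<Rightarrow> (real ^ 'n \<Rightarrow> complex) set" and B L R :: real
  assumes finite_A: "finite A" and mra: "multiresolution V \<phi>"
    and detail_basis: "\<And>j. L2_orthonormal_basis (L2_orth_complement_in (V (j + 1)) (V j)) (A \<times> UNIV)
          (\<lambda>(\<epsilon>, k). rescale (\<psi> \<epsilon>) j k)"
    and mean_zero: "\<And>\<epsilon>. \<epsilon> \<in> A \<Longrightarrow> has_bochner_integral lborel (\<psi> \<epsilon>) 0"
    and BLR: "0 \<le> B" "0 \<le> L" "0 \<le> R"
    and \<phi>_meas: "\<phi> \<in> borel_measurable borel" and \<phi>_bound: "\<And>x. norm (\<phi> x) \<le> B"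
    and \<phi>_lipschitz: "\<And>x y. norm (\<phi> x - \<phi> y) \<le> L * norm (x - y)"
    and \<phi>_supp: "\<And>x. R < norm x \<Longrightarrow> \<phi> x = 0"
    and \<psi>_meas: "\<And>\<epsilon>. \<epsilon> \<in> A \<Longrightarrow> \<psi> \<epsilon> \<in> borel_measurable borel"
    and \<psi>_bound: "\<And>\<epsilon> x. \<epsilon> \<in> A \<Longrightarrow> norm (\<psi> \<epsilon> x) \<le> B"
    and \<psi>_lipschitz: "\<And>\<epsilon> x y. \<epsilon> \<in> A \<Longrightarrow> norm (\<psi> \<epsilon> x - \<psi> \<epsilon> y) \<le> L * norm (x - y)"
    and \<psi>_supp: "\<And>\<epsilon> x. \<epsilon> \<in> A \<Longrightarrow> R < norm x \<Longrightarrow> \<psi> \<epsilon> x = 0"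
begin

abbreviation W where "W j \<equiv> L2_orth_complement_in (V (j + 1)) (V j)"

abbreviation \<psi>' where "\<psi>' j i \<equiv> (case i of (\<epsilon>, k) \<Rightarrow> rescale (\<psi> \<epsilon>) j k)"

lemma V_closed: "L2_closed_subspace (V j)"
  and V_mono1: "V j \<subseteq> V (j + 1)"
  and V_inter: "(\<Inter>j. V j) = {f \<in> L2. AE x in lborel. f x = 0}"
  and V_dense: "L2_closure (\<Union>j. V j) = L2"
  and \<phi>_in_V0: "\<phi> \<in> V 0"
  and V_basis: "L2_orthonormal_basis (V j) UNIV (rescale \<phi> j)"
  using mra by (auto simp: multiresolution_def)

lemma V_L2: "f \<in> V j \<Longrightarrow> f \<in> L2"
  using V_closed by (rule closed_subspace_L2)

lemma V_mono: "i \<le> j \<Longrightarrow> V i \<subseteq> V j"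
  by (induction j rule: int_ge_induct) (use V_mono1 in blast)+

lemma W_V: "f \<in> W j \<Longrightarrow> f \<in> V (j + 1)"
  by (simp add: L2_orth_complement_in_def)

lemma W_orth: "f \<in> W j \<Longrightarrow> g \<in> V j \<Longrightarrow> L2_inner f g = 0"
  by (simp add: L2_orth_complement_in_def)

lemma \<phi>_basis:
  shows "rescale \<phi> j k \<in> V j"
    and "L2_inner (rescale \<phi> j k) (rescale \<phi> j l) = (if k = l then 1 else 0)"
    and "V j \<subseteq> L2_closure (L2_span UNIV (rescale \<phi> j))"
  using V_basis[of j] by (auto simp: L2_orthonormal_basis_def)

lemma \<psi>_basis:
  shows "i \<in> A \<times> UNIV \<Longrightarrow> \<psi>' j i \<in> W j"
    and "i \<in> A \<times> UNIV \<Longrightarrow> l \<in> A \<times> UNIV \<Longrightarrow> L2_inner (\<psi>' j i) (\<psi>' j l) = (if i = l then 1 else 0)"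
    and "W j \<subseteq> L2_closure (L2_span (A \<times> UNIV) (\<psi>' j))"
  using detail_basis[of j] unfolding L2_orthonormal_basis_def by blast+

lemma \<psi>_L2: "i \<in> A \<times> UNIV \<Longrightarrow> \<psi>' j i \<in> L2"
  using \<psi>_basis(1) W_V V_L2 by blast

lemma \<phi>_L2: "rescale \<phi> j k \<in> L2"
  using \<phi>_basis(1) V_L2 by blast

text \<open>
  The restriction to nonzero coefficients makes the sum finite when \<open>p\<close> has compact support.
\<close>

definition proj where
  "proj j p x = (\<Sum>k | k \<in> UNIV \<and> L2_inner p (rescale \<phi> j k) \<noteq> 0. L2_inner p (rescale \<phi> j k) * rescale \<phi> j k x)"

definition detail where
  "detail j p x = (\<Sum>i | i \<in> A \<times> UNIV \<and> L2_inner p (\<psi>' j i) \<noteq> 0. L2_inner p (\<psi>' j i) * \<psi>' j i x)"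

context
  fixes p :: "real ^ 'n \<Rightarrow> complex" and \<rho> :: real
  assumes p: "p \<in> L2" and p_supp: "AE x in lborel. \<rho> < norm x \<longrightarrow> p x = 0"
begin

lemma finite_\<phi>_coefficients: "finite {k. L2_inner p (rescale \<phi> j k) \<noteq> 0}"
  by (rule finite_rescale_coefficients[OF p_supp \<phi>_supp])

lemma finite_\<psi>_coefficients: "finite {i \<in> A \<times> UNIV. L2_inner p (\<psi>' j i) \<noteq> 0}"
proof (rule finite_subset)
  show "{i \<in> A \<times> UNIV. L2_inner p (\<psi>' j i) \<noteq> 0}
      \<subseteq> Sigma A (\<lambda>\<epsilon>. {k. L2_inner p (rescale (\<psi> \<epsilon>) j k) \<noteq> 0})" by auto
  show "finite (Sigma A (\<lambda>\<epsilon>. {k. L2_inner p (rescale (\<psi> \<epsilon>) j k) \<noteq> 0}))"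
    using finite_A finite_rescale_coefficients[OF p_supp \<psi>_supp] by (intro finite_SigmaI) auto
qed

lemma proj_in_V: "proj j p \<in> V j"
  unfolding proj_def[abs_def] by (intro closed_subspace_sum V_closed \<phi>_basis(1))

lemma proj_L2: "proj j p \<in> L2"
  using proj_in_V V_L2 by blast

lemma detail_L2: "detail j p \<in> L2"
  unfolding detail_def[abs_def] by (intro L2_sum L2_cmult \<psi>_L2) auto

lemma proj_orthogonal:
  assumes "v \<in> V j"
  shows "L2_inner (\<lambda>x. p x - proj j p x) v = 0"
proof (rule L2_orthogonal_to_basis[where I = UNIV and b = "rescale \<phi> j"])
  have "L2_inner (proj j p) (rescale \<phi> j k) = L2_inner p (rescale \<phi> j k)" for k
    unfolding proj_def[abs_def]
    by (rule L2_inner_finite_expansion) (use \<phi>_L2 \<phi>_basis(2) finite_\<phi>_coefficients in simp_all)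
  then show "L2_inner (\<lambda>x. p x - proj j p x) (rescale \<phi> j k) = 0" for k
    using L2_inner_diff_left[OF p proj_L2 \<phi>_L2, of j j k] by simp
  show "v \<in> L2_closure (L2_span UNIV (rescale \<phi> j))" using assms \<phi>_basis(3) by blast
qed (use p proj_L2 \<phi>_L2 in \<open>auto intro: L2_diff\<close>)

lemma proj_best:
  assumes "v \<in> V j"
  shows "L2_norm (\<lambda>x. p x - proj j p x) \<le> L2_norm (\<lambda>x. p x - v x)"
  using assms proj_in_V by (intro L2_norm_le_of_orthogonal p proj_L2 proj_orthogonal V_L2)

lemma proj_converges:
  assumes "0 < e"
  obtains J where "j0 \<le> J" "L2_norm (\<lambda>x. p x - proj J p x) < e"
proof -
  have "p \<in> L2_closure (\<Union>j. V j)" using V_dense p by simp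
  then obtain j g where "g \<in> V j" "L2_norm (\<lambda>x. p x - g x) < e"
    using assms by (auto simp: L2_closure_def)
  then show thesis
    using that[of "max j0 j"] V_mono[of j "max j0 j"] proj_best[of g "max j0 j"] by force
qed

text \<open>
  The difference of consecutive projections lies in \<open>W j\<close> and has the same wavelet coefficients as
  \<open>p\<close>. Since it lies in the closed span of the wavelets of scale \<open>j\<close>, it equals its finite expansion up to a
  null set.
\<close>

lemma proj_step: "AE x in lborel. proj (j + 1) p x = proj j p x + detail j p x"
proof -
  define u where "u x = proj (j + 1) p x - proj j p x" for x
  define r where "r x = u x - detail j p x" for x
  have "u \<in> V (j + 1)"
    unfolding u_def[abs_def] using proj_in_V V_mono1 by (intro closed_subspace_diff V_closed) auto
  then have u: "u \<in> L2" by (rule V_L2)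
  have r: "r \<in> L2" unfolding r_def[abs_def] by (intro L2_diff u detail_L2)
  have pL: "(\<lambda>x. p x - proj i p x) \<in> L2" for i by (intro L2_diff p proj_L2)
  have u_inner: "L2_inner u v = L2_inner (\<lambda>x. p x - proj j p x) v" if "v \<in> V (j + 1)" for v
  proof -
    have "u = (\<lambda>x. (p x - proj j p x) - (p x - proj (j + 1) p x))" by (simp add: u_def fun_eq_iff)
    then have "L2_inner u v = L2_inner (\<lambda>x. p x - proj j p x) v - L2_inner (\<lambda>x. p x - proj (j + 1) p x) v"
      using L2_inner_diff_left[OF pL pL V_L2[OF that], of j "j + 1"] by simp
    then show ?thesis using proj_orthogonal[OF that] by simp
  qed
  have "u \<in> W j"
    unfolding L2_orth_complement_in_def
  proof (intro CollectI conjI ballI)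
    fix g assume "g \<in> V j"
    then show "L2_inner u g = 0" using u_inner[of g] V_mono1 proj_orthogonal[of g j] by auto
  qed fact
  have r_orth: "L2_inner r (\<psi>' j i) = 0" if i: "i \<in> A \<times> UNIV" for i
  proof -
    have "L2_inner (proj j p) (\<psi>' j i) = 0"
      using W_orth[OF \<psi>_basis(1)[OF i] proj_in_V] L2_inner_commute[of "proj j p" "\<psi>' j i"] by simp
    then have "L2_inner u (\<psi>' j i) = L2_inner p (\<psi>' j i)"
      using u_inner[OF W_V[OF \<psi>_basis(1)[OF i]]] L2_inner_diff_left[OF p proj_L2 \<psi>_L2[OF i]] by simp
    moreover have "L2_inner (detail j p) (\<psi>' j i) = L2_inner p (\<psi>' j i)"
      unfolding detail_def[abs_def]
      by (rule L2_inner_finite_expansion[OF \<psi>_L2 \<psi>_basis(2) finite_\<psi>_coefficients i])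
    ultimately show ?thesis
      unfolding r_def[abs_def] using L2_inner_diff_left[OF u detail_L2 \<psi>_L2[OF i]] by simp
  qed
  \<comment> \<open>Being orthogonal to all wavelets of scale j, r is orthogonal to u and to the detail, hence to itself.\<close>
  have "L2_inner r u = 0"
    by (rule L2_orthogonal_to_basis[OF r \<psi>_L2 r_orth]) (use \<open>u \<in> W j\<close> \<psi>_basis(3) in auto)
  moreover have "L2_inner (detail j p) r = 0"
  proof -
    have "L2_inner (detail j p) r
        = (\<Sum>i | i \<in> A \<times> UNIV \<and> L2_inner p (\<psi>' j i) \<noteq> 0. L2_inner p (\<psi>' j i) * L2_inner (\<psi>' j i) r)"
      unfolding detail_def[abs_def] by (intro L2_inner_sum_left \<psi>_L2 r) simp
    also have "\<dots> = 0"
    proof (intro sum.neutral ballI)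
      fix i assume "i \<in> {i. i \<in> A \<times> UNIV \<and> L2_inner p (\<psi>' j i) \<noteq> 0}"
      then have "L2_inner r (\<psi>' j i) = 0" by (intro r_orth) simp
      then show "L2_inner p (\<psi>' j i) * L2_inner (\<psi>' j i) r = 0"
        using L2_inner_commute[of "\<psi>' j i" r] by simp
    qed
    finally show ?thesis .
  qed
  moreover have "L2_inner r r = L2_inner u r - L2_inner (detail j p) r"
    using L2_inner_diff_left[OF u detail_L2 r] by (simp add: r_def[abs_def])
  moreover have "L2_inner u r = cnj (L2_inner r u)" by (rule L2_inner_commute)
  ultimately have "L2_inner r r = 0" by simp
  then have "L2_norm r = 0" by (simp add: L2_inner_self)
  then have "AE x in lborel. r x = 0" by (intro L2_norm_zero_AE r)
  then show ?thesis by eventually_elim (simp add: r_def u_def algebra_simps)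
qed

lemma proj_telescope:
  assumes "j0 \<le> J"
  shows "AE x in lborel. proj J p x = proj j0 p x + (\<Sum>j\<in>{j0..<J}. detail j p x)"
  using assms
proof (induction J rule: int_ge_induct)
  case (step J)
  have "{j0..<J + 1} = insert J {j0..<J}" using step.hyps by auto
  moreover note step.IH proj_step[of J]
  ultimately show ?case by (auto elim!: eventually_elim2 simp: algebra_simps)
qed simp

lemma proj_support:
  assumes "j0 \<le> J" "\<rho> + 2 * R / 2 powi j0 < norm x"
  shows "proj J p x = 0"
  unfolding proj_def
  using rescale_localised[where g = \<phi> and R = R, OF p_supp \<phi>_supp BLR(3) assms(1) _ assms(2)]
  by (intro sum.neutral) auto

end

lemma \<phi>_self: "\<phi> \<in> L2" "AE x in lborel. R < norm x \<longrightarrow> \<phi> x = 0"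
  using \<phi>_L2[of 0 0] \<phi>_supp by (auto simp: rescale_0)

text \<open>
  Without wavelets all projections of \<open>\<phi>\<close> would agree, so \<open>\<phi>\<close> would lie in every \<open>V j\<close> and vanish.
\<close>

lemma A_nonempty: "A \<noteq> {}"
proof
  assume "A = {}"
  have "\<phi> \<in> V j" for j
  proof (cases "0 \<le> j")
    case True
    then show ?thesis using \<phi>_in_V0 V_mono by blast
  next
    case False
    have "L2_norm (\<lambda>x. \<phi> x - proj 0 \<phi> x) \<le> 0"
      using proj_best[OF \<phi>_self \<phi>_in_V0] by (simp add: L2_norm_def)
    then have "AE x in lborel. \<phi> x - proj 0 \<phi> x = 0"
      using L2_norm_nonneg[of "\<lambda>x. \<phi> x - proj 0 \<phi> x"]
      by (intro L2_norm_zero_AE L2_diff \<phi>_self(1) proj_L2[OF \<phi>_self]) auto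
    moreover have "detail i \<phi> x = 0" for i x unfolding detail_def using \<open>A = {}\<close> by simp
    then have "AE x in lborel. proj 0 \<phi> x = proj j \<phi> x"
      using proj_telescope[OF \<phi>_self, of j 0] False by simp
    ultimately have "AE x in lborel. \<phi> x - proj j \<phi> x = 0" by eventually_elim simp
    then have "L2_norm (\<lambda>x. \<phi> x - proj j \<phi> x) = 0"
      unfolding L2_norm_def by (subst integral_eq_zero_AE) (auto elim: eventually_mono)
    then have "\<phi> \<in> L2_closure (V j)"
      using \<phi>_self(1) proj_in_V[OF \<phi>_self, of j] by (force simp: L2_closure_def)
    then show ?thesis using V_closed by (simp add: L2_closed_subspace_def)
  qed
  then have "AE x in lborel. \<phi> x = 0" using V_inter by auto
  then have "L2_inner \<phi> \<phi> = 0" unfolding L2_inner_def by (intro integral_eq_zero_AE) (auto elim: eventually_mono)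
  then show False using \<phi>_basis(2)[of 0 0 0] by (simp add: rescale_0)
qed

end

section \<open>Hoelder increments and dyadic sums\<close>

lemma holder_seminorm_le_iff:
  fixes f :: "real ^ 'n \<Rightarrow> complex"
  assumes "0 \<le> C"
  shows "holder_seminorm s f \<le> ennreal C \<longleftrightarrow> (\<forall>x y. norm (f x - f y) \<le> C * norm (x - y) powr s)"
proof -
  have "ennreal (norm (f x - f y) / norm (x - y) powr s) \<le> ennreal C
      \<longleftrightarrow> norm (f x - f y) \<le> C * norm (x - y) powr s" if "x \<noteq> y" for x y
    using that assms by (simp add: divide_le_eq)
  moreover have "(\<forall>x y. norm (f x - f y) \<le> C * norm (x - y) powr s)
      \<longleftrightarrow> (\<forall>x y. x \<noteq> y \<longrightarrow> norm (f x - f y) \<le> C * norm (x - y) powr s)"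
  proof -
    have "norm (f x - f x) \<le> C * norm (x - x) powr s" for x by simp
    then show ?thesis by metis
  qed
  ultimately show ?thesis unfolding holder_seminorm_def SUP_le_iff by auto
qed

lemma min_powr_le:
  fixes t s :: real
  assumes "0 \<le> t" "0 < s" "s \<le> 1"
  shows "min t 1 \<le> t powr s"
proof (cases "t = 0 \<or> 1 \<le> t")
  case True
  then show ?thesis using assms by (auto simp: min_def ge_one_powr_ge_zero)
next
  case False
  then have "t powr 1 \<le> t powr s" using assms by (intro powr_mono') auto
  then show ?thesis using False assms by simp
qed

text \<open>
  The Lipschitz bound serves at short distances and the uniform bound at long ones.
\<close>

lemma increment_le_min:
  fixes g :: "real ^ 'n \<Rightarrow> complex"
  assumes "0 \<le> L" "0 \<le> B" "norm (g x - g y) \<le> L * norm (x - y)" "norm (g x) \<le> B" "norm (g y) \<le> B"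
  shows "norm (g x - g y) \<le> (L + 2 * B) * min (norm (x - y)) 1"
proof (cases "norm (x - y) \<le> 1")
  case True
  have "norm (g x - g y) \<le> (L + 2 * B) * norm (x - y)"
    using assms(3) mult_right_mono[of L "L + 2 * B" "norm (x - y)"] \<open>0 \<le> B\<close> by simp
  then show ?thesis using True by simp
next
  case False
  have "norm (g x - g y) \<le> B + B" using norm_triangle_ineq4[of "g x" "g y"] assms(4,5) by linarith
  then show ?thesis using False \<open>0 \<le> L\<close> by simp
qed

lemma sum_power_inj_le:
  fixes q :: real
  assumes "0 \<le> q" "q < 1" "finite S" "inj_on h S"
  shows "(\<Sum>i\<in>S. q ^ (h i :: nat)) \<le> 1 / (1 - q)"
proof -
  have "(\<Sum>i\<in>S. q ^ h i) = (\<Sum>m\<in>h ` S. q ^ m)" using assms(4) by (simp add: sum.reindex)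
  also have "\<dots> \<le> (\<Sum>m. q ^ m)"
    using assms by (intro sum_le_suminf summable_geometric) auto
  also have "\<dots> = 1 / (1 - q)" using assms by (intro suminf_geometric) auto
  finally show ?thesis .
qed

lemma sum_geometric_two_sided:
  fixes q :: real
  assumes q: "0 \<le> q" "q < 1" and fin: "finite J"
  shows "(\<Sum>j\<in>J. q ^ nat \<bar>j + m\<bar>) \<le> 2 / (1 - q)"
proof -
  let ?P = "{j \<in> J. 0 \<le> j + m}" and ?N = "{j \<in> J. j + m < 0}"
  have "(\<Sum>j\<in>J. q ^ nat \<bar>j + m\<bar>) = (\<Sum>j\<in>?P \<union> ?N. q ^ nat \<bar>j + m\<bar>)"
    by (intro sum.cong) auto
  also have "\<dots> = (\<Sum>j\<in>?P. q ^ nat \<bar>j + m\<bar>) + (\<Sum>j\<in>?N. q ^ nat \<bar>j + m\<bar>)"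
    using fin by (intro sum.union_disjoint) auto
  also have "\<dots> \<le> 1 / (1 - q) + 1 / (1 - q)"
    using q fin by (intro add_mono sum_power_inj_le) (auto simp: inj_on_def)
  finally show ?thesis by simp
qed

text \<open>
  Write \<open>t = 2 powr \<tau>\<close> and \<open>u = j + \<tau>\<close>. The summand is \<open>t powr s\<close> times
  \<open>min (2 powr ((1 - s) * u)) (2 powr (- s * u))\<close>, which decays geometrically in both directions with
  exponent \<open>min s (1 - s)\<close>. This is where \<open>0 < s < 1\<close> is essential.
\<close>

lemma dyadic_sum_bound:
  fixes s :: real
  assumes "0 < s" "s < 1"
  obtains C where "0 < C"
    "\<And>J t. finite J \<Longrightarrow> 0 \<le> t \<Longrightarrow> (\<Sum>j\<in>J. 2 powr (- real_of_int j * s) * min (2 powr real_of_int j * t) 1) \<le> C * t powr s"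
proof -
  define \<kappa> where "\<kappa> = min s (1 - s)"
  have \<kappa>: "0 < \<kappa>" "\<kappa> \<le> s" "\<kappa> \<le> 1 - s" using assms by (auto simp: \<kappa>_def)
  define q where "q = (2 :: real) powr - \<kappa>"
  have q: "0 < q" "q < 1" using \<kappa> by (auto simp: q_def powr_minus_divide)
  define C where "C = 2 powr \<kappa> * (2 / (1 - q))"
  have bound: "(\<Sum>j\<in>J. 2 powr (- real_of_int j * s) * min (2 powr real_of_int j * t) 1) \<le> C * t powr s"
    if J: "finite J" and t: "0 \<le> t" for J t
  proof (cases "t = 0")
    case False
    then have "t > 0" using t by simp
    define \<tau> where "\<tau> = log 2 t"
    have t_eq: "t = 2 powr \<tau>" using \<open>t > 0\<close> by (simp add: \<tau>_def)
    have summand_le: "2 powr (- real_of_int j * s) * min (2 powr real_of_int j * t) 1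
        \<le> t powr s * 2 powr \<kappa> * q ^ nat \<bar>j + \<lfloor>\<tau>\<rfloor>\<bar>" for j
    proof -
      define u where "u = real_of_int j + \<tau>"
      have e1: "2 powr (- real_of_int j * s) = t powr s * 2 powr (- s * u)"
        by (simp add: t_eq u_def powr_powr powr_add[symmetric] algebra_simps)
      have e2: "2 powr real_of_int j * t = 2 powr u" by (simp add: t_eq u_def powr_add)
      have b1: "2 powr (- s * u) * min (2 powr u) 1 \<le> 2 powr (- \<kappa> * \<bar>u\<bar>)"
      proof (cases "0 \<le> u")
        case True
        then have "2 powr (- s * u) * min (2 powr u) 1 \<le> 2 powr (- s * u)" by simp
        also have "\<dots> \<le> 2 powr (- \<kappa> * \<bar>u\<bar>)"
          using True \<kappa> by (intro powr_mono) (auto intro: mult_right_mono)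
        finally show ?thesis .
      next
        case False
        then have "2 powr (- s * u) * min (2 powr u) 1 \<le> 2 powr (- s * u) * 2 powr u" by simp
        also have "\<dots> = 2 powr ((1 - s) * u)" by (simp add: powr_add[symmetric] algebra_simps)
        also have "\<dots> \<le> 2 powr (- \<kappa> * \<bar>u\<bar>)"
          using False \<kappa> by (intro powr_mono) (auto intro: mult_right_mono_neg)
        finally show ?thesis .
      qed
      have b2: "2 powr (- \<kappa> * \<bar>u\<bar>) \<le> 2 powr \<kappa> * q ^ nat \<bar>j + \<lfloor>\<tau>\<rfloor>\<bar>"
      proof -
        have "\<bar>real_of_int (j + \<lfloor>\<tau>\<rfloor>)\<bar> \<le> \<bar>u\<bar> + 1" unfolding u_def by linarith
        then have "\<kappa> * \<bar>real_of_int (j + \<lfloor>\<tau>\<rfloor>)\<bar> \<le> \<kappa> * (\<bar>u\<bar> + 1)" using \<kappa> by (intro mult_left_mono) auto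
        then have "- \<kappa> * \<bar>u\<bar> \<le> \<kappa> + - \<kappa> * real (nat \<bar>j + \<lfloor>\<tau>\<rfloor>\<bar>)" by (simp add: algebra_simps)
        then have "2 powr (- \<kappa> * \<bar>u\<bar>) \<le> 2 powr (\<kappa> + - \<kappa> * real (nat \<bar>j + \<lfloor>\<tau>\<rfloor>\<bar>))"
          by (intro powr_mono) auto
        also have "\<dots> = 2 powr \<kappa> * q ^ nat \<bar>j + \<lfloor>\<tau>\<rfloor>\<bar>"
          by (simp only: powr_add q_def powr_realpow[symmetric] powr_powr powr_gt_zero)
        finally show ?thesis .
      qed
      show ?thesis
        unfolding e1 e2 mult.assoc using b1 b2 by (intro mult_left_mono) auto
    qed
    have "(\<Sum>j\<in>J. 2 powr (- real_of_int j * s) * min (2 powr real_of_int j * t) 1)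
        \<le> (\<Sum>j\<in>J. t powr s * 2 powr \<kappa> * q ^ nat \<bar>j + \<lfloor>\<tau>\<rfloor>\<bar>)"
      by (intro sum_mono summand_le)
    also have "\<dots> = t powr s * 2 powr \<kappa> * (\<Sum>j\<in>J. q ^ nat \<bar>j + \<lfloor>\<tau>\<rfloor>\<bar>)" by (simp add: sum_distrib_left)
    also have "\<dots> \<le> t powr s * 2 powr \<kappa> * (2 / (1 - q))"
      using q J by (intro mult_left_mono sum_geometric_two_sided) auto
    finally show ?thesis by (simp add: C_def mult_ac)
  qed simp
  have "0 < C" using q by (simp add: C_def)
  then show thesis using that bound by blast
qed

section \<open>Measures with square-integrable density\<close>

lemma prob_ab2_density:
  assumes "\<mu> \<in> prob_ab2 K"
  shows "prob_space \<mu>" "sets \<mu> = sets borel" "emeasure \<mu> K = 1"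
    and "lebesgue_density \<mu> \<in> borel_measurable borel" "\<And>x. 0 \<le> lebesgue_density \<mu> x"
    and "density lborel (\<lambda>x. ennreal (lebesgue_density \<mu> x)) = \<mu>"
    and "integrable lborel (\<lambda>x. (lebesgue_density \<mu> x)\<^sup>2)"
proof -
  show \<mu>: "prob_space \<mu>" "sets \<mu> = sets borel" "emeasure \<mu> K = 1"
    and "integrable lborel (\<lambda>x. (lebesgue_density \<mu> x)\<^sup>2)"
    using assms by (auto simp: prob_ab2_def)
  have ac: "absolutely_continuous lborel \<mu>" using assms by (auto simp: prob_ab2_def)
  show meas: "lebesgue_density \<mu> \<in> borel_measurable borel"
    unfolding lebesgue_density_def[abs_def]
    using borel_measurable_RN_deriv[of lborel \<mu>] by simp
  show "0 \<le> lebesgue_density \<mu> x" for x by (simp add: lebesgue_density_def)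
  interpret prob_space \<mu> by fact
  have "AE x in lborel. RN_deriv lborel \<mu> x \<noteq> \<infinity>"
    using ac \<mu>(2) by (intro sigma_finite_measure.RN_deriv_finite[OF lborel.sigma_finite_measure_axioms]) (auto intro: sigma_finite_measure_axioms)
  then have "AE x in lborel. ennreal (lebesgue_density \<mu> x) = RN_deriv lborel \<mu> x"
    by eventually_elim (simp add: lebesgue_density_def less_top)
  then have "density lborel (\<lambda>x. ennreal (lebesgue_density \<mu> x)) = density lborel (RN_deriv lborel \<mu>)"
    using meas by (intro density_cong) auto
  also have "\<dots> = \<mu>" using ac \<mu>(2) by (intro sigma_finite_measure.density_RN_deriv[OF lborel.sigma_finite_measure_axioms]) auto
  finally show "density lborel (\<lambda>x. ennreal (lebesgue_density \<mu> x)) = \<mu>" .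
qed

lemma prob_ab2_integral:
  fixes g :: "real ^ 'n \<Rightarrow> 'b :: {banach, second_countable_topology}"
  assumes \<mu>: "\<mu> \<in> prob_ab2 K" and g: "g \<in> borel_measurable borel"
  shows "(\<integral>x. g x \<partial>\<mu>) = (\<integral>x. lebesgue_density \<mu> x *\<^sub>R g x \<partial>lborel)"
    and "integrable \<mu> g \<longleftrightarrow> integrable lborel (\<lambda>x. lebesgue_density \<mu> x *\<^sub>R g x)"
proof -
  note d = prob_ab2_density[OF \<mu>]
  show "(\<integral>x. g x \<partial>\<mu>) = (\<integral>x. lebesgue_density \<mu> x *\<^sub>R g x \<partial>lborel)"
    using integral_density[of g lborel "lebesgue_density \<mu>"] d g by simp
  show "integrable \<mu> g \<longleftrightarrow> integrable lborel (\<lambda>x. lebesgue_density \<mu> x *\<^sub>R g x)"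
    using integrable_density[of g lborel "lebesgue_density \<mu>"] d g by simp
qed

lemma prob_ab2_density_support:
  assumes \<mu>: "\<mu> \<in> prob_ab2 K" and "K \<in> sets borel"
  shows "AE x in lborel. x \<notin> K \<longrightarrow> lebesgue_density \<mu> x = 0"
proof -
  note d = prob_ab2_density[OF \<mu>]
  interpret prob_space \<mu> by (rule d(1))
  have "AE x in \<mu>. x \<in> K"
    using d(2,3) assms(2) by (intro AE_prob_1) (auto simp: measure_def)
  then have "AE x in density lborel (\<lambda>x. ennreal (lebesgue_density \<mu> x)). x \<in> K" by (simp only: d(6))
  then have "AE x in lborel. 0 < ennreal (lebesgue_density \<mu> x) \<longrightarrow> x \<in> K"
    using d(4) by (subst (asm) AE_density) auto
  then show ?thesis
  proof eventually_elim
    case (elim x)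
    then show ?case using d(5)[of x] by (auto simp: ennreal_less_zero_iff less_le)
  qed
qed

lemma prob_ab2_density_integrable:
  assumes "\<mu> \<in> prob_ab2 K"
  shows "integrable lborel (lebesgue_density \<mu>)" "(\<integral>x. lebesgue_density \<mu> x \<partial>lborel) = 1"
proof -
  interpret prob_space \<mu> by (rule prob_ab2_density(1)[OF assms])
  show "integrable lborel (lebesgue_density \<mu>)"
    using prob_ab2_integral(2)[OF assms, of "\<lambda>_. 1 :: real"] by simp
  show "(\<integral>x. lebesgue_density \<mu> x \<partial>lborel) = 1"
    using prob_ab2_integral(1)[OF assms, of "\<lambda>_. 1 :: real"] by (simp add: prob_space)
qed

lemma density_difference:
  assumes \<mu>: "\<mu> \<in> prob_ab2 K" and \<nu>: "\<nu> \<in> prob_ab2 K" and K: "K \<in> sets borel" "K \<subseteq> cball 0 \<rho>"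
  defines "p \<equiv> \<lambda>x. complex_of_real (lebesgue_density \<mu> x - lebesgue_density \<nu> x)"
  shows "p \<in> L2" "AE x in lborel. \<rho> < norm x \<longrightarrow> p x = 0" "integrable lborel p"
    "(\<integral>x. p x \<partial>lborel) = 0" "(\<integral>x. norm (p x) \<partial>lborel) \<le> 2"
proof -
  note d\<mu> = prob_ab2_density[OF \<mu>] and d\<nu> = prob_ab2_density[OF \<nu>]
  note i\<mu> = prob_ab2_density_integrable[OF \<mu>] and i\<nu> = prob_ab2_density_integrable[OF \<nu>]
  have [measurable]: "lebesgue_density \<mu> \<in> borel_measurable borel" "lebesgue_density \<nu> \<in> borel_measurable borel"
    by (rule d\<mu>(4), rule d\<nu>(4))
  have "integrable lborel (\<lambda>x. (lebesgue_density \<mu> x - lebesgue_density \<nu> x)\<^sup>2)"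
  proof (rule Bochner_Integration.integrable_bound)
    show "integrable lborel (\<lambda>x. (lebesgue_density \<mu> x)\<^sup>2 + (lebesgue_density \<nu> x)\<^sup>2)"
      by (intro Bochner_Integration.integrable_add d\<mu>(7) d\<nu>(7))
    have "(lebesgue_density \<mu> x - lebesgue_density \<nu> x)\<^sup>2 \<le> (lebesgue_density \<mu> x)\<^sup>2 + (lebesgue_density \<nu> x)\<^sup>2" for x
      using d\<mu>(5)[of x] d\<nu>(5)[of x] by (simp add: power2_diff)
    then show "AE x in lborel. norm ((lebesgue_density \<mu> x - lebesgue_density \<nu> x)\<^sup>2)
        \<le> norm ((lebesgue_density \<mu> x)\<^sup>2 + (lebesgue_density \<nu> x)\<^sup>2)" by simp
  qed measurable
  then show "p \<in> L2"
    unfolding L2_def p_def by (simp add: norm_of_real del: of_real_diff)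
  show "AE x in lborel. \<rho> < norm x \<longrightarrow> p x = 0"
    using prob_ab2_density_support[OF \<mu> K(1)] prob_ab2_density_support[OF \<nu> K(1)]
  proof eventually_elim
    case (elim x)
    then show ?case using K(2) by (auto simp: p_def subset_iff)
  qed
  have int: "integrable lborel (\<lambda>x. lebesgue_density \<mu> x - lebesgue_density \<nu> x)"
    by (intro Bochner_Integration.integrable_diff i\<mu> i\<nu>)
  then show "integrable lborel p" unfolding p_def by (rule integrable_of_real)
  show "(\<integral>x. p x \<partial>lborel) = 0"
    unfolding p_def integral_complex_of_real using i\<mu> i\<nu> by simp
  have "(\<integral>x. norm (p x) \<partial>lborel) \<le> (\<integral>x. lebesgue_density \<mu> x + lebesgue_density \<nu> x \<partial>lborel)"
  proof (rule integral_mono)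
    show "norm (p x) \<le> lebesgue_density \<mu> x + lebesgue_density \<nu> x" for x
      unfolding p_def norm_of_real using d\<mu>(5)[of x] d\<nu>(5)[of x] by linarith
  qed (use \<open>integrable lborel p\<close> i\<mu> i\<nu> in auto)
  also have "\<dots> = 2" using i\<mu> i\<nu> by simp
  finally show "(\<integral>x. norm (p x) \<partial>lborel) \<le> 2" .
qed

text \<open>
  Subtracting \<open>f 0\<close> changes nothing because both measures have mass 1; it makes the test function
  vanish at the origin, so that it is bounded by \<open>norm x powr s\<close>.
\<close>

lemma test_function_difference:
  fixes f :: "real ^ 'n \<Rightarrow> real"
  assumes \<mu>: "\<mu> \<in> prob_ab2 K" and \<nu>: "\<nu> \<in> prob_ab2 K" and K: "K \<in> sets borel" "K \<subseteq> cball 0 \<rho>"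
    and s: "0 < s" "s \<le> 1" and f: "\<And>x y. \<bar>f x - f y\<bar> \<le> norm (x - y) powr s"
  shows "complex_of_real ((\<integral>x. f x \<partial>\<mu>) - (\<integral>x. f x \<partial>\<nu>))
    = (\<integral>x. complex_of_real (lebesgue_density \<mu> x - lebesgue_density \<nu> x) * complex_of_real (f x - f 0) \<partial>lborel)"
proof -
  define h where "h x = f x - f 0" for x
  have "continuous_on UNIV f" using f s by (intro continuous_on_holder[where C = 1 and s = s]) auto
  then have [measurable]: "f \<in> borel_measurable borel" by (rule borel_measurable_continuous_onI)
  have h_meas[measurable]: "h \<in> borel_measurable borel" unfolding h_def[abs_def] by measurable
  have bound: "\<bar>h x\<bar> \<le> \<rho> powr s" if "x \<in> K" for x
  proof -
    have "norm x \<le> \<rho>" using that K(2) by auto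
    then show ?thesis using f[of x 0] s powr_mono2[of s "norm x" \<rho>] by (simp add: h_def)
  qed
  have int: "integrable \<kappa> h" "(\<integral>x. f x \<partial>\<kappa>) = (\<integral>x. h x \<partial>\<kappa>) + f 0" if \<kappa>: "\<kappa> \<in> prob_ab2 K" for \<kappa>
  proof -
    interpret prob_space \<kappa> by (rule prob_ab2_density(1)[OF \<kappa>])
    have [measurable_cong]: "sets \<kappa> = sets borel" by (rule prob_ab2_density(2)[OF \<kappa>])
    have "AE x in \<kappa>. x \<in> K"
      using prob_ab2_density(2,3)[OF \<kappa>] K(1) by (intro AE_prob_1) (auto simp: measure_def)
    then have "AE x in \<kappa>. norm (h x) \<le> \<rho> powr s" by eventually_elim (simp add: bound)
    then show int_h: "integrable \<kappa> h" by (rule integrable_const_bound) measurable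
    have "(\<integral>x. f x \<partial>\<kappa>) = (\<integral>x. h x + f 0 \<partial>\<kappa>)" by (simp add: h_def)
    also have "\<dots> = (\<integral>x. h x \<partial>\<kappa>) + f 0" using int_h by (simp add: prob_space)
    finally show "(\<integral>x. f x \<partial>\<kappa>) = (\<integral>x. h x \<partial>\<kappa>) + f 0" .
  qed
  have "(\<integral>x. f x \<partial>\<mu>) - (\<integral>x. f x \<partial>\<nu>)
      = (\<integral>x. lebesgue_density \<mu> x *\<^sub>R h x \<partial>lborel) - (\<integral>x. lebesgue_density \<nu> x *\<^sub>R h x \<partial>lborel)"
    using int(2)[OF \<mu>] int(2)[OF \<nu>] prob_ab2_integral(1)[OF \<mu> h_meas] prob_ab2_integral(1)[OF \<nu> h_meas] by simp
  also have "\<dots> = (\<integral>x. (lebesgue_density \<mu> x - lebesgue_density \<nu> x) * h x \<partial>lborel)"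
    using int(1)[OF \<mu>] int(1)[OF \<nu>] prob_ab2_integral(2)[OF \<mu> h_meas] prob_ab2_integral(2)[OF \<nu> h_meas]
    by (subst Bochner_Integration.integral_diff[symmetric]) (auto simp: left_diff_distrib)
  finally show ?thesis
    by (simp only: integral_complex_of_real[symmetric] of_real_mult h_def)
qed

section \<open>Test functions against wavelets\<close>

context compact_wavelet_system
begin

lemma \<psi>_holder:
  assumes "\<epsilon> \<in> A" "0 < s" "s < 1"
  shows "norm (\<psi> \<epsilon> x - \<psi> \<epsilon> y) \<le> (L + 2 * B) * norm (x - y) powr s"
proof -
  have "norm (\<psi> \<epsilon> x - \<psi> \<epsilon> y) \<le> (L + 2 * B) * min (norm (x - y)) 1"
    using BLR \<psi>_lipschitz \<psi>_bound assms by (intro increment_le_min) auto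
  also have "\<dots> \<le> (L + 2 * B) * norm (x - y) powr s"
    using BLR assms min_powr_le[of "norm (x - y)" s] by (intro mult_left_mono) auto
  finally show ?thesis .
qed

lemma integrable_continuous_mult_compact:
  fixes f g :: "real ^ 'n \<Rightarrow> complex"
  assumes f: "continuous_on UNIV f" and g: "g \<in> borel_measurable borel" "\<And>x. norm (g x) \<le> B" "\<And>x. R < norm x \<Longrightarrow> g x = 0"
  shows "integrable lborel (\<lambda>x. f x * g x)"
proof -
  have "compact (f ` cball 0 R)" by (intro compact_continuous_image continuous_on_subset[OF f]) auto
  then obtain D where D: "\<forall>y\<in>f ` cball 0 R. norm y \<le> D"
    using compact_imp_bounded bounded_iff by metis
  show ?thesis
  proof (rule integrable_bounded_support[where R = R and B = "D * B"])
    show "norm (f x * g x) \<le> D * B" if "norm x \<le> R" for x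
      using that D g(2)[of x] norm_ge_zero[of "f x"] unfolding norm_mult
      by (intro mult_mono) (auto intro: order_trans[OF norm_ge_zero])
  qed (use borel_measurable_continuous_onI[OF f] g in auto)
qed

text \<open>
  Since \<open>\<psi> \<epsilon>\<close> has mean zero, the test function may be normalised to vanish at the origin.
\<close>

lemma dual_norm_finite:
  assumes \<epsilon>: "\<epsilon> \<in> A" and s: "0 < s" "s < 1"
  shows "holder_dual_norm s (\<psi> \<epsilon>) < \<top>"
proof -
  have "ennreal (norm (\<integral>x. f x * \<psi> \<epsilon> x \<partial>lborel)) \<le> ennreal (R powr s * (\<integral>x. norm (\<psi> \<epsilon> x) \<partial>lborel))"
    if "holder_seminorm s f \<le> 1" for f
  proof (rule ennreal_leI)
    have f: "norm (f x - f y) \<le> 1 * norm (x - y) powr s" for x y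
      using that holder_seminorm_le_iff[of 1 s f] by simp
    then have cont: "continuous_on UNIV f" using s by (rule_tac continuous_on_holder) 
    have int: "integrable lborel (\<psi> \<epsilon>)" "(\<integral>x. \<psi> \<epsilon> x \<partial>lborel) = 0"
      using mean_zero[OF \<epsilon>] by (auto simp: has_bochner_integral_iff)
    have int_f: "integrable lborel (\<lambda>x. f x * \<psi> \<epsilon> x)"
      by (intro integrable_continuous_mult_compact cont \<psi>_meas \<psi>_bound \<psi>_supp \<epsilon>)
    have "(\<integral>x. f x * \<psi> \<epsilon> x \<partial>lborel) = (\<integral>x. f x * \<psi> \<epsilon> x \<partial>lborel) - (\<integral>x. f 0 * \<psi> \<epsilon> x \<partial>lborel)"
      using int by simp
    also have "\<dots> = (\<integral>x. f x * \<psi> \<epsilon> x - f 0 * \<psi> \<epsilon> x \<partial>lborel)"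
      using int int_f by (intro Bochner_Integration.integral_diff[symmetric]) auto
    finally have "norm (\<integral>x. f x * \<psi> \<epsilon> x \<partial>lborel) \<le> (\<integral>x. norm (f x * \<psi> \<epsilon> x - f 0 * \<psi> \<epsilon> x) \<partial>lborel)"
      by (simp only: integral_norm_bound)
    also have "\<dots> \<le> (\<integral>x. R powr s * norm (\<psi> \<epsilon> x) \<partial>lborel)"
    proof (rule integral_mono)
      fix x
      show "norm (f x * \<psi> \<epsilon> x - f 0 * \<psi> \<epsilon> x) \<le> R powr s * norm (\<psi> \<epsilon> x)"
      proof (cases "R < norm x")
        case False
        then have "norm (f x - f 0) \<le> R powr s"
          using f[of x 0] s BLR powr_mono2[of s "norm x" R] by simp
        then show ?thesis
          by (simp add: norm_mult mult_right_mono flip: left_diff_distrib)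
      qed (simp add: \<psi>_supp[OF \<epsilon>])
    qed (use int int_f in auto)
    also have "\<dots> = R powr s * (\<integral>x. norm (\<psi> \<epsilon> x) \<partial>lborel)" by simp
    finally show "norm (\<integral>x. f x * \<psi> \<epsilon> x \<partial>lborel) \<le> R powr s * (\<integral>x. norm (\<psi> \<epsilon> x) \<partial>lborel)" .
  qed
  then have "holder_dual_norm s (\<psi> \<epsilon>) \<le> ennreal (R powr s * (\<integral>x. norm (\<psi> \<epsilon> x) \<partial>lborel))"
    unfolding holder_dual_norm_def by (intro SUP_least) auto
  then show ?thesis by (rule le_less_trans) simp
qed

text \<open>
  Test against a multiple of the complex conjugate of the wavelet, which is itself Hoelder continuous.
\<close>

lemma dual_norm_positive:
  assumes \<epsilon>: "\<epsilon> \<in> A" and s: "0 < s" "s < 1"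
  shows "0 < holder_dual_norm s (\<psi> \<epsilon>)"
proof -
  \<comment> \<open>The summand 1 only serves to make C positive.\<close>
  define C where "C = L + 2 * B + 1"
  have "C > 0" using BLR by (simp add: C_def)
  define f where "f x = complex_of_real (1 / C) * cnj (\<psi> \<epsilon> x)" for x
  have "norm (f x - f y) \<le> 1 * norm (x - y) powr s" for x y
  proof -
    have "norm (f x - f y) = (1 / C) * norm (\<psi> \<epsilon> x - \<psi> \<epsilon> y)"
      using \<open>C > 0\<close> complex_mod_cnj[of "\<psi> \<epsilon> x - \<psi> \<epsilon> y"]
      by (simp add: f_def norm_mult norm_divide flip: right_diff_distrib complex_cnj_diff diff_divide_distrib)
    also have "\<dots> \<le> (1 / C) * (C * norm (x - y) powr s)"
      using \<psi>_holder[OF \<epsilon> s, of x y] \<open>C > 0\<close>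
      by (intro mult_left_mono) (auto simp: C_def distrib_right intro: add_increasing2)
    finally show ?thesis using \<open>C > 0\<close> by simp
  qed
  then have "holder_seminorm s f \<le> 1" using holder_seminorm_le_iff[of 1 s f] by simp
  then have "ennreal (norm (\<integral>x. f x * \<psi> \<epsilon> x \<partial>lborel)) \<le> holder_dual_norm s (\<psi> \<epsilon>)"
    unfolding holder_dual_norm_def by (intro SUP_upper) simp
  moreover have "(\<integral>x. f x * \<psi> \<epsilon> x \<partial>lborel) = complex_of_real (1 / C)"
  proof -
    have "(\<integral>x. f x * \<psi> \<epsilon> x \<partial>lborel) = complex_of_real (1 / C) * L2_inner (\<psi> \<epsilon>) (\<psi> \<epsilon>)"
      unfolding f_def L2_inner_def mult.assoc by (subst integral_mult_right_zero) (simp add: mult.commute)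
    also have "L2_inner (\<psi> \<epsilon>) (\<psi> \<epsilon>) = 1"
      using \<psi>_basis(2)[of "(\<epsilon>, 0)" "(\<epsilon>, 0)" 0] \<epsilon> by (simp add: rescale_0)
    finally show ?thesis by simp
  qed
  ultimately have "ennreal (1 / C) \<le> holder_dual_norm s (\<psi> \<epsilon>)" using \<open>C > 0\<close> by (simp add: norm_divide)
  then show ?thesis using \<open>C > 0\<close> by (auto intro: less_le_trans[rotated])
qed

text \<open>
  After the change of variables, \<open>2 powr (j * s)\<close> times the dilated test function again has Hoelder
  seminorm at most 1.
\<close>

lemma dual_norm_scaling:
  fixes f :: "real ^ 'n \<Rightarrow> real"
  assumes \<epsilon>: "\<epsilon> \<in> A" and s: "0 < s" "s < 1"
    and f: "\<And>x y. \<bar>f x - f y\<bar> \<le> norm (x - y) powr s"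
  shows "norm (\<integral>x. complex_of_real (f x) * rescale (\<psi> \<epsilon>) j k x \<partial>lborel)
    \<le> 2 powr (- real_of_int j * (s + real CARD('n) / 2)) * enn2real (holder_dual_norm s (\<psi> \<epsilon>))"
proof -
  let ?c = "2 powr (real_of_int j * s)"
  let ?d = "2 powr (- real CARD('n) * real_of_int j / 2)"
  have "continuous_on UNIV f" using f s by (intro continuous_on_holder[where C = 1 and s = s]) auto
  then have f_meas: "f \<in> borel_measurable borel" by (rule borel_measurable_continuous_onI)
  define h where "h y = complex_of_real (?c * f ((1 / 2 powi j) *\<^sub>R (y + lattice_vec k)))" for y
  have "norm (h x - h y) \<le> 1 * norm (x - y) powr s" for x y
  proof -
    have "norm (h x - h y) = ?c * \<bar>f ((1 / 2 powi j) *\<^sub>R (x + lattice_vec k)) - f ((1 / 2 powi j) *\<^sub>R (y + lattice_vec k))\<bar>"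
      by (simp add: h_def abs_mult norm_mult flip: of_real_diff of_real_mult right_diff_distrib)
    also have "\<dots> \<le> ?c * norm ((1 / 2 powi j) *\<^sub>R (x + lattice_vec k) - (1 / 2 powi j) *\<^sub>R (y + lattice_vec k)) powr s"
      by (intro mult_left_mono f) simp
    also have "\<dots> = ?c * ((1 / 2 powi j) * norm (x - y)) powr s"
      by (simp flip: scaleR_diff_right)
    also have "\<dots> = norm (x - y) powr s"
      by (simp add: powr_mult powr_divide powi_eq_powr powr_powr)
    finally show ?thesis by simp
  qed
  then have "holder_seminorm s h \<le> 1" using holder_seminorm_le_iff[of 1 s h] by simp
  then have "ennreal (norm (\<integral>x. h x * \<psi> \<epsilon> x \<partial>lborel)) \<le> holder_dual_norm s (\<psi> \<epsilon>)"
    unfolding holder_dual_norm_def by (intro SUP_upper) simp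
  then have "norm (\<integral>x. h x * \<psi> \<epsilon> x \<partial>lborel) \<le> enn2real (holder_dual_norm s (\<psi> \<epsilon>))"
    using dual_norm_finite[OF \<epsilon> s] by (metis enn2real_ennreal enn2real_mono norm_ge_zero)
  moreover have "(\<integral>x. h x * \<psi> \<epsilon> x \<partial>lborel) = complex_of_real ?c *
      (\<integral>y. complex_of_real (f ((1 / 2 powi j) *\<^sub>R (y + lattice_vec k))) * \<psi> \<epsilon> y \<partial>lborel)"
    unfolding h_def of_real_mult mult.assoc by (rule integral_mult_right_zero)
  ultimately have le: "?c * norm (\<integral>y. complex_of_real (f ((1 / 2 powi j) *\<^sub>R (y + lattice_vec k))) * \<psi> \<epsilon> y \<partial>lborel)
      \<le> enn2real (holder_dual_norm s (\<psi> \<epsilon>))" (is "?c * ?I \<le> ?M")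
    by (simp add: norm_mult)
  have "norm (\<integral>x. complex_of_real (f x) * rescale (\<psi> \<epsilon>) j k x \<partial>lborel) = ?d * ?I"
    using f_meas \<psi>_meas[OF \<epsilon>] by (subst integral_mult_rescale) (auto simp: norm_mult)
  also have "\<dots> = ?d * 2 powr (- real_of_int j * s) * (?c * ?I)"
    by (simp add: powr_minus_divide)
  also have "\<dots> \<le> ?d * 2 powr (- real_of_int j * s) * ?M" using le by (intro mult_left_mono) auto
  also have "?d * 2 powr (- real_of_int j * s) = 2 powr (- real_of_int j * (s + real CARD('n) / 2))"
    by (simp add: powr_add[symmetric] algebra_simps)
  finally show ?thesis .
qed

text \<open>
  At scale \<open>j \<le> 0\<close> only lattice points of norm at most \<open>R + \<rho>\<close> contribute, a number that does not
  depend on \<open>j\<close>. Subtracting the value of \<open>\<phi>\<close> at the image of the origin, which the mean-zero condition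
  permits, makes a coefficient of order \<open>2 powr (n * j / 2 + j)\<close>. The test function grows
  like \<open>norm x powr s\<close> on a support of size of order \<open>2 powr (- j)\<close>, so its
  pairing with \<open>rescale \<phi> j k\<close> is of order \<open>2 powr (- n * j / 2 - j * s)\<close>.
\<close>

lemma coarse_estimate:
  fixes f :: "real ^ 'n \<Rightarrow> real"
  assumes j: "j \<le> 0" and s: "0 < s" "s < 1" and \<rho>: "0 \<le> \<rho>"
    and p: "p \<in> L2" "AE x in lborel. \<rho> < norm x \<longrightarrow> p x = 0" "integrable lborel p"
      "(\<integral>x. p x \<partial>lborel) = 0" "(\<integral>x. norm (p x) \<partial>lborel) \<le> 2"
    and f: "\<And>x y. \<bar>f x - f y\<bar> \<le> norm (x - y) powr s" "f 0 = 0"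
  shows "norm (\<integral>x. complex_of_real (f x) * proj j p x \<partial>lborel)
    \<le> real (card {k :: int ^ 'n. norm (lattice_vec k) \<le> R + \<rho>}) *
       (2 * L * \<rho> * ((2 * R + \<rho>) powr s * (\<integral>x. norm (\<phi> x) \<partial>lborel))) * 2 powr (real_of_int j * (1 - s))"
proof -
  let ?a = "2 powr (real CARD('n) * real_of_int j / 2)"
  let ?d = "2 powr (- real CARD('n) * real_of_int j / 2)"
  have cont: "continuous_on UNIV f" using f s by (intro continuous_on_holder[where C = 1 and s = s]) auto
  then have f_meas: "f \<in> borel_measurable borel" by (rule borel_measurable_continuous_onI)
  have pj: "2 powi j \<le> (1 :: real)" using j powr_mono[of "real_of_int j" 0 2] by (simp add: powi_eq_powr)
  define S where "S = {k :: int ^ 'n. L2_inner p (rescale \<phi> j k) \<noteq> 0}"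
  have S_sub: "S \<subseteq> {k. norm (lattice_vec k) \<le> R + \<rho>}"
  proof
    fix k assume "k \<in> S"
    then obtain x where x: "norm x \<le> \<rho>" "norm (2 powi j *\<^sub>R x - lattice_vec k) \<le> R"
      using rescale_coefficient_support[where g = \<phi> and R = R, OF p(2) \<phi>_supp] by (auto simp: S_def)
    have "norm (2 powi j *\<^sub>R x) \<le> 1 * \<rho>"
      unfolding norm_scaleR using x pj \<rho> by (intro mult_mono) auto
    then show "k \<in> {k. norm (lattice_vec k) \<le> R + \<rho>}"
      using norm_triangle_sub[of "lattice_vec k" "2 powi j *\<^sub>R x"] x by (simp add: norm_minus_commute)
  qed
  have coefficient: "norm (L2_inner p (rescale \<phi> j k)) \<le> ?a * (L * (2 powi j * \<rho>)) * 2" for k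
  proof -
    let ?r = "\<lambda>x. cnj (rescale \<phi> j k x)"
    have int: "integrable lborel (\<lambda>x. p x * ?r x)" by (rule L2_product_integrable[OF p(1) \<phi>_L2])
    have int0: "integrable lborel (\<lambda>x. p x * ?r 0)" using p(3) by simp
    have "L2_inner p (rescale \<phi> j k) = (\<integral>x. p x * ?r x \<partial>lborel) - (\<integral>x. p x * ?r 0 \<partial>lborel)"
      using p(4) by (simp add: L2_inner_def)
    also have "\<dots> = (\<integral>x. p x * ?r x - p x * ?r 0 \<partial>lborel)"
      using int int0 by (intro Bochner_Integration.integral_diff[symmetric])
    finally have "norm (L2_inner p (rescale \<phi> j k)) \<le> (\<integral>x. norm (p x * ?r x - p x * ?r 0) \<partial>lborel)"
      by (simp only: integral_norm_bound)
    also have "\<dots> \<le> (\<integral>x. ?a * (L * (2 powi j * \<rho>)) * norm (p x) \<partial>lborel)"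
    proof (rule integral_mono_AE)
      show "AE x in lborel. norm (p x * ?r x - p x * ?r 0) \<le> ?a * (L * (2 powi j * \<rho>)) * norm (p x)"
        using p(2)
      proof eventually_elim
        case (elim x)
        show ?case
        proof (cases "\<rho> < norm x")
          case False
          have "norm (?r x - ?r 0) = ?a * norm (\<phi> (2 powi j *\<^sub>R x - lattice_vec k) - \<phi> (- lattice_vec k))"
            unfolding complex_cnj_diff[symmetric] complex_mod_cnj
            by (simp add: rescale_def norm_mult flip: right_diff_distrib)
          also have "\<dots> \<le> ?a * (L * norm ((2 powi j *\<^sub>R x - lattice_vec k) - (- lattice_vec k)))"
            by (intro mult_left_mono \<phi>_lipschitz) simp
          also have "\<dots> \<le> ?a * (L * (2 powi j * \<rho>))"
            using False BLR by (intro mult_left_mono) auto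
          finally show ?thesis
            by (simp add: norm_mult mult.commute mult_left_mono flip: right_diff_distrib)
        qed (use elim in simp)
      qed
    qed (use int int0 p(3) in auto)
    also have "\<dots> = ?a * (L * (2 powi j * \<rho>)) * (\<integral>x. norm (p x) \<partial>lborel)" by simp
    also have "\<dots> \<le> ?a * (L * (2 powi j * \<rho>)) * 2"
      using p(5) BLR \<rho> by (intro mult_left_mono) auto
    finally show ?thesis .
  qed
  have test: "norm (\<integral>x. complex_of_real (f x) * rescale \<phi> j k x \<partial>lborel)
      \<le> ?d * (2 powr (- real_of_int j * s) * ((2 * R + \<rho>) powr s * (\<integral>x. norm (\<phi> x) \<partial>lborel)))"
    if k: "norm (lattice_vec k) \<le> R + \<rho>" for k
  proof -
    let ?h = "\<lambda>y. complex_of_real (f ((1 / 2 powi j) *\<^sub>R (y + lattice_vec k))) * \<phi> y"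
    have cont_h: "continuous_on UNIV (\<lambda>y. complex_of_real (f ((1 / 2 powi j) *\<^sub>R (y + lattice_vec k))))"
      by (intro continuous_intros continuous_on_compose2[OF cont]) auto
    have int: "integrable lborel ?h"
      by (intro integrable_continuous_mult_compact cont_h \<phi>_meas \<phi>_bound \<phi>_supp)
    have "integrable lborel \<phi>"
      using \<phi>_meas \<phi>_bound \<phi>_supp by (intro integrable_bounded_support[of _ R B])
    have "norm (\<integral>y. ?h y \<partial>lborel) \<le> (\<integral>y. norm (?h y) \<partial>lborel)" by (rule integral_norm_bound)
    also have "\<dots> \<le> (\<integral>y. 2 powr (- real_of_int j * s) * (2 * R + \<rho>) powr s * norm (\<phi> y) \<partial>lborel)"
    proof (rule integral_mono)
      fix y
      show "norm (?h y) \<le> 2 powr (- real_of_int j * s) * (2 * R + \<rho>) powr s * norm (\<phi> y)"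
      proof (cases "R < norm y")
        case False
        have "\<bar>f ((1 / 2 powi j) *\<^sub>R (y + lattice_vec k))\<bar> \<le> norm ((1 / 2 powi j) *\<^sub>R (y + lattice_vec k)) powr s"
          using f(1)[of "(1 / 2 powi j) *\<^sub>R (y + lattice_vec k)" 0] f(2) by simp
        also have "\<dots> \<le> ((1 / 2 powi j) * (2 * R + \<rho>)) powr s"
          unfolding norm_scaleR using False k s norm_triangle_ineq[of y "lattice_vec k"]
          by (intro powr_mono2 mult_mono) auto
        also have "\<dots> = 2 powr (- real_of_int j * s) * (2 * R + \<rho>) powr s"
          using BLR \<rho> by (simp add: powr_mult powr_divide powi_eq_powr powr_powr powr_minus_divide)
        finally show ?thesis by (simp add: norm_mult mult_right_mono)
      qed (simp add: \<phi>_supp)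
    qed (use int \<open>integrable lborel \<phi>\<close> in auto)
    finally have "norm (\<integral>y. ?h y \<partial>lborel)
        \<le> 2 powr (- real_of_int j * s) * ((2 * R + \<rho>) powr s * (\<integral>x. norm (\<phi> x) \<partial>lborel))"
      by (simp add: mult.assoc)
    moreover have "(\<integral>x. complex_of_real (f x) * rescale \<phi> j k x \<partial>lborel) = complex_of_real ?d * (\<integral>y. ?h y \<partial>lborel)"
      using f_meas \<phi>_meas by (subst integral_mult_rescale) auto
    ultimately show ?thesis by (simp add: norm_mult mult_left_mono)
  qed
  let ?T = "2 * L * \<rho> * ((2 * R + \<rho>) powr s * (\<integral>x. norm (\<phi> x) \<partial>lborel)) * 2 powr (real_of_int j * (1 - s))"
  have "0 \<le> (\<integral>x. norm (\<phi> x) \<partial>lborel)" by simp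
  then have T0: "0 \<le> ?T" using BLR \<rho> by (intro mult_nonneg_nonneg) auto
  have cont_c: "continuous_on UNIV (\<lambda>x. complex_of_real (f x))" by (intro continuous_intros cont)
  have int_r: "integrable lborel (\<lambda>x. complex_of_real (f x) * rescale \<phi> j k x)" for k
  proof -
    let ?R = "(R + norm (lattice_vec k)) / 2 powi j"
    have supp: "rescale \<phi> j k x = 0" if "?R < norm x" for x
    proof -
      have "R + norm (lattice_vec k) < norm (2 powi j *\<^sub>R x)" using that by (simp add: field_simps)
      then have "R < norm (2 powi j *\<^sub>R x - lattice_vec k)"
        using norm_triangle_sub[of "2 powi j *\<^sub>R x" "lattice_vec k"] by simp
      then show ?thesis by (simp add: rescale_def \<phi>_supp)
    qed
    have "compact ((\<lambda>x. complex_of_real (f x)) ` cball 0 ?R)"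
      by (intro compact_continuous_image continuous_on_subset[OF cont_c]) auto
    then obtain D where D: "\<forall>y\<in>(\<lambda>x. complex_of_real (f x)) ` cball 0 ?R. norm y \<le> D"
      using compact_imp_bounded bounded_iff by metis
    show ?thesis
    proof (rule integrable_bounded_support[where R = ?R and B = "D * (?a * B)"])
      show "norm (complex_of_real (f x) * rescale \<phi> j k x) \<le> D * (?a * B)" if "norm x \<le> ?R" for x
      proof -
        have "norm (complex_of_real (f x)) \<le> D" using D that by simp
        moreover have "norm (rescale \<phi> j k x) \<le> ?a * B"
          unfolding rescale_def norm_mult using \<phi>_bound by (simp add: mult_left_mono)
        ultimately show ?thesis
          unfolding norm_mult by (intro mult_mono) (auto intro: order_trans[OF norm_ge_zero])
      qed
      show "(\<lambda>x. complex_of_real (f x) * rescale \<phi> j k x) \<in> borel_measurable borel"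
        unfolding rescale_def using f_meas \<phi>_meas by measurable
    qed (use supp in simp)
  qed
  have "(\<integral>x. complex_of_real (f x) * proj j p x \<partial>lborel)
      = (\<integral>x. (\<Sum>k\<in>S. L2_inner p (rescale \<phi> j k) * (complex_of_real (f x) * rescale \<phi> j k x)) \<partial>lborel)"
    by (simp add: proj_def S_def sum_distrib_left mult_ac)
  also have "\<dots> = (\<Sum>k\<in>S. L2_inner p (rescale \<phi> j k) * (\<integral>x. complex_of_real (f x) * rescale \<phi> j k x \<partial>lborel))"
    using int_r by (subst Bochner_Integration.integral_sum) auto
  also have "norm \<dots> \<le> (\<Sum>k\<in>S. ?T)"
  proof (rule sum_norm_le)
    fix k assume "k \<in> S"
    then have k: "norm (lattice_vec k) \<le> R + \<rho>" using S_sub by auto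
    have "norm (L2_inner p (rescale \<phi> j k) * (\<integral>x. complex_of_real (f x) * rescale \<phi> j k x \<partial>lborel))
        \<le> (?a * (L * (2 powi j * \<rho>)) * 2) *
          (?d * (2 powr (- real_of_int j * s) * ((2 * R + \<rho>) powr s * (\<integral>x. norm (\<phi> x) \<partial>lborel))))"
      unfolding norm_mult using BLR \<rho> by (intro mult_mono coefficient test[OF k]) auto
    also have "\<dots> = 2 * L * \<rho> * ((2 * R + \<rho>) powr s * (\<integral>x. norm (\<phi> x) \<partial>lborel)) *
        (?a * ?d * (2 powi j * 2 powr (- real_of_int j * s)))" by (simp only: mult_ac)
    also have "?a * ?d * (2 powi j * 2 powr (- real_of_int j * s)) = 2 powr (real_of_int j * (1 - s))"
      by (simp add: powi_eq_powr powr_add[symmetric] algebra_simps)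
    finally show "norm (L2_inner p (rescale \<phi> j k) * (\<integral>x. complex_of_real (f x) * rescale \<phi> j k x \<partial>lborel)) \<le> ?T" .
  qed
  also have "(\<Sum>k\<in>S. ?T) = real (card S) * ?T" by simp
  also have "\<dots> \<le> real (card {k :: int ^ 'n. norm (lattice_vec k) \<le> R + \<rho>}) * ?T"
    using T0 card_mono[OF finite_lattice_ball S_sub] by (intro mult_right_mono) auto
  finally show ?thesis by (simp add: mult.assoc)
qed

end

section \<open>Upper bound for the wavelet distance\<close>

context compact_wavelet_system
begin

text \<open>
  At one scale boundedly many wavelets are nonzero at \<open>x\<close> or at \<open>y\<close>; the sum over the
  scales is the preceding dyadic sum.
\<close>

lemma increment_sum_bound:
  assumes s: "0 < s" "s < 1"
  obtains C where "0 < C" "\<And>F x y. finite F \<Longrightarrow> F \<subseteq> A \<times> UNIV \<times> UNIV \<Longrightarrow>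
    (\<Sum>(\<epsilon>, j, k)\<in>F. 2 powr (- real_of_int j * (s + real CARD('n) / 2)) *
       norm (rescale (\<psi> \<epsilon>) j k x - rescale (\<psi> \<epsilon>) j k y)) \<le> C * norm (x - y) powr s"
proof -
  obtain N where N: "\<And>z :: real ^ 'n. finite {k. norm (z - lattice_vec k) \<le> R}"
    "\<And>z :: real ^ 'n. card {k. norm (z - lattice_vec k) \<le> R} \<le> N"
    using lattice_points_near[of R] by blast
  obtain C0 where C0: "0 < C0" "\<And>J t. finite J \<Longrightarrow> 0 \<le> t \<Longrightarrow>
      (\<Sum>j\<in>J. 2 powr (- real_of_int j * s) * min (2 powr real_of_int j * t) 1) \<le> C0 * t powr s"
    using dyadic_sum_bound[OF s] by blast
  define C1 where "C1 = real (N + N) * (L + 2 * B)"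
  have "0 \<le> C1" using BLR by (simp add: C1_def)
  define \<Delta> where "\<Delta> x y \<epsilon> j k = norm (\<psi> \<epsilon> (2 powi j *\<^sub>R x - lattice_vec k) - \<psi> \<epsilon> (2 powi j *\<^sub>R y - lattice_vec k))"
    for x y \<epsilon> j and k :: "int ^ 'n"
  have weight: "2 powr (- real_of_int j * (s + real CARD('n) / 2)) * norm (rescale (\<psi> \<epsilon>) j k x - rescale (\<psi> \<epsilon>) j k y)
      = 2 powr (- real_of_int j * s) * \<Delta> x y \<epsilon> j k" for x y \<epsilon> j k
  proof -
    have "norm (rescale (\<psi> \<epsilon>) j k x - rescale (\<psi> \<epsilon>) j k y) = 2 powr (real CARD('n) * real_of_int j / 2) * \<Delta> x y \<epsilon> j k"
      by (simp add: rescale_def \<Delta>_def norm_mult flip: right_diff_distrib)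
    moreover have "2 powr (- real_of_int j * (s + real CARD('n) / 2)) * 2 powr (real CARD('n) * real_of_int j / 2)
        = 2 powr (- real_of_int j * s)"
      by (simp add: powr_add[symmetric] algebra_simps)
    ultimately show ?thesis by (simp flip: mult.assoc)
  qed
  have level: "(\<Sum>k\<in>Q. \<Delta> x y \<epsilon> j k) \<le> C1 * min (2 powr real_of_int j * norm (x - y)) 1"
    if "finite Q" "\<epsilon> \<in> A" for Q x y \<epsilon> j
  proof -
    let ?m = "min (2 powr real_of_int j * norm (x - y)) 1"
    let ?S = "{k. norm (2 powi j *\<^sub>R x - lattice_vec k) \<le> R} \<union> {k. norm (2 powi j *\<^sub>R y - lattice_vec k) \<le> R}"
    have "finite ?S" using N(1) by blast
    have "card ?S \<le> N + N" by (rule order_trans[OF card_Un_le add_mono[OF N(2) N(2)]])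
    have "norm (\<psi> \<epsilon> u - \<psi> \<epsilon> v) \<le> (L + 2 * B) * min (norm (u - v)) 1" for u v
      using BLR \<psi>_lipschitz[OF that(2)] \<psi>_bound[OF that(2)] by (intro increment_le_min) auto
    from this[of "2 powi j *\<^sub>R x - lattice_vec k" "2 powi j *\<^sub>R y - lattice_vec k" for k]
    have each: "\<Delta> x y \<epsilon> j k \<le> (L + 2 * B) * ?m" for k
      by (simp add: \<Delta>_def powi_eq_powr flip: scaleR_diff_right)
    have "(\<Sum>k\<in>Q. \<Delta> x y \<epsilon> j k) = (\<Sum>k\<in>Q \<inter> ?S. \<Delta> x y \<epsilon> j k)"
      using that by (intro sum.mono_neutral_right) (auto simp: \<Delta>_def \<psi>_supp not_le)
    also have "\<dots> \<le> (\<Sum>k\<in>Q \<inter> ?S. (L + 2 * B) * ?m)" by (intro sum_mono each)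
    also have "\<dots> = real (card (Q \<inter> ?S)) * ((L + 2 * B) * ?m)" by simp
    also have "\<dots> \<le> real (N + N) * ((L + 2 * B) * ?m)"
    proof (rule mult_right_mono)
      show "real (card (Q \<inter> ?S)) \<le> real (N + N)"
        using card_mono[OF \<open>finite ?S\<close> Int_lower2[of Q ?S]] \<open>card ?S \<le> N + N\<close> by linarith
    qed (use BLR in auto)
    finally show ?thesis by (simp only: C1_def mult.assoc)
  qed
  show thesis
  proof (rule that[of "real (card A) * C1 * C0 + 1"])
    show "0 < real (card A) * C1 * C0 + 1"
      using \<open>0 \<le> C1\<close> C0(1) by (intro add_nonneg_pos mult_nonneg_nonneg) auto
    fix F :: "('e \<times> int \<times> (int ^ 'n)) set" and x y :: "real ^ 'n"
    assume F: "finite F" "F \<subseteq> A \<times> UNIV \<times> UNIV"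
    define J where "J = (fst \<circ> snd) ` F"
    define Q where "Q = (snd \<circ> snd) ` F"
    have JQ: "finite J" "finite Q" "F \<subseteq> A \<times> J \<times> Q"
      using F by (force simp: J_def Q_def)+
    have "(\<Sum>(\<epsilon>, j, k)\<in>F. 2 powr (- real_of_int j * (s + real CARD('n) / 2)) *
         norm (rescale (\<psi> \<epsilon>) j k x - rescale (\<psi> \<epsilon>) j k y))
       = (\<Sum>(\<epsilon>, j, k)\<in>F. 2 powr (- real_of_int j * s) * \<Delta> x y \<epsilon> j k)"
      by (simp only: weight)
    also have "\<dots> \<le> (\<Sum>(\<epsilon>, j, k)\<in>A \<times> J \<times> Q. 2 powr (- real_of_int j * s) * \<Delta> x y \<epsilon> j k)"
      using JQ finite_A by (intro sum_mono2) (auto simp: \<Delta>_def)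
    also have "\<dots> = (\<Sum>\<epsilon>\<in>A. \<Sum>j\<in>J. 2 powr (- real_of_int j * s) * (\<Sum>k\<in>Q. \<Delta> x y \<epsilon> j k))"
      by (simp add: sum.cartesian_product sum_distrib_left)
    also have "\<dots> \<le> (\<Sum>\<epsilon>\<in>A. \<Sum>j\<in>J. 2 powr (- real_of_int j * s) * (C1 * min (2 powr real_of_int j * norm (x - y)) 1))"
      using JQ by (intro sum_mono mult_left_mono level) auto
    also have "\<dots> = real (card A) * C1 * (\<Sum>j\<in>J. 2 powr (- real_of_int j * s) * min (2 powr real_of_int j * norm (x - y)) 1)"
      by (simp add: sum_distrib_left mult_ac)
    also have "\<dots> \<le> real (card A) * C1 * (C0 * norm (x - y) powr s)"
      using \<open>0 \<le> C1\<close> JQ(1) by (intro mult_left_mono C0(2)) auto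
    also have "\<dots> \<le> (real (card A) * C1 * C0 + 1) * norm (x - y) powr s"
      by (simp add: distrib_right)
    finally show "(\<Sum>(\<epsilon>, j, k)\<in>F. 2 powr (- real_of_int j * (s + real CARD('n) / 2)) *
         norm (rescale (\<psi> \<epsilon>) j k x - rescale (\<psi> \<epsilon>) j k y)) \<le> (real (card A) * C1 * C0 + 1) * norm (x - y) powr s" .
  qed
qed

lemma rescale_\<psi>_measurable:
  assumes "\<epsilon> \<in> A"
  shows "rescale (\<psi> \<epsilon>) j k \<in> borel_measurable borel"
  unfolding rescale_def using \<psi>_meas[OF assms] by measurable

lemma rescale_\<psi>_bounded:
  assumes "\<epsilon> \<in> A"
  shows "norm (rescale (\<psi> \<epsilon>) j k x) \<le> 2 powr (real CARD('n) * real_of_int j / 2) * B"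
  unfolding rescale_def norm_mult using \<psi>_bound[OF assms] by (simp add: mult_left_mono)

text \<open>
  The coefficient is the difference of the means of the wavelet under the two marginals.
\<close>

lemma detail_coeff_le_coupling:
  assumes \<mu>: "\<mu> \<in> prob_ab2 K" and \<nu>: "\<nu> \<in> prob_ab2 K" and \<gamma>: "\<gamma> \<in> couplings \<mu> \<nu>" and \<epsilon>: "\<epsilon> \<in> A"
  shows "ennreal (norm (detail_coeff \<psi> (\<lambda>x. complex_of_real (lebesgue_density \<mu> x - lebesgue_density \<nu> x)) \<epsilon> j k))
    \<le> (\<integral>\<^sup>+p. ennreal (norm (rescale (\<psi> \<epsilon>) j k (fst p) - rescale (\<psi> \<epsilon>) j k (snd p))) \<partial>\<gamma>)"
proof -
  define g where "g x = cnj (rescale (\<psi> \<epsilon>) j k x)" for x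
  have g[measurable]: "g \<in> borel_measurable borel"
    unfolding g_def[abs_def] using rescale_\<psi>_measurable[OF \<epsilon>] by measurable
  define G where "G = 2 powr (real CARD('n) * real_of_int j / 2) * B"
  have gG: "norm (g x) \<le> G" for x unfolding g_def G_def complex_mod_cnj by (rule rescale_\<psi>_bounded[OF \<epsilon>])
  interpret \<mu>: prob_space \<mu> by (rule prob_ab2_density(1)[OF \<mu>])
  interpret \<nu>: prob_space \<nu> by (rule prob_ab2_density(1)[OF \<nu>])
  interpret \<gamma>: prob_space \<gamma> using \<gamma> by (simp add: couplings_def)
  have sets[measurable_cong]: "sets \<mu> = sets borel" "sets \<nu> = sets borel" "sets \<gamma> = sets (borel \<Otimes>\<^sub>M borel)"
    using \<gamma> prob_ab2_density(2)[OF \<mu>] prob_ab2_density(2)[OF \<nu>] unfolding borel_prod couplings_def by blast+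
  have marg: "distr \<gamma> borel fst = \<mu>" "distr \<gamma> borel snd = \<nu>" using \<gamma> by (auto simp: couplings_def)
  have int_\<mu>: "integrable \<mu> g" and int_\<nu>: "integrable \<nu> g"
    using gG by (auto intro!: \<mu>.integrable_const_bound[of _ G] \<nu>.integrable_const_bound[of _ G])
  have int_1: "integrable \<gamma> (\<lambda>p. g (fst p))" and int_2: "integrable \<gamma> (\<lambda>p. g (snd p))"
    using gG by (auto intro!: \<gamma>.integrable_const_bound[of _ G])
  have "detail_coeff \<psi> (\<lambda>x. complex_of_real (lebesgue_density \<mu> x - lebesgue_density \<nu> x)) \<epsilon> j k
      = (\<integral>x. lebesgue_density \<mu> x *\<^sub>R g x - lebesgue_density \<nu> x *\<^sub>R g x \<partial>lborel)"
    unfolding detail_coeff_def g_def by (simp add: scaleR_conv_of_real left_diff_distrib)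
  also have "\<dots> = (\<integral>x. g x \<partial>\<mu>) - (\<integral>x. g x \<partial>\<nu>)"
    using prob_ab2_integral[OF \<mu> g] prob_ab2_integral[OF \<nu> g] int_\<mu> int_\<nu>
    by (subst Bochner_Integration.integral_diff) auto
  also have "(\<integral>x. g x \<partial>\<mu>) = (\<integral>p. g (fst p) \<partial>\<gamma>)"
    unfolding marg(1)[symmetric] by (rule integral_distr) measurable
  also have "(\<integral>x. g x \<partial>\<nu>) = (\<integral>p. g (snd p) \<partial>\<gamma>)"
    unfolding marg(2)[symmetric] by (rule integral_distr) measurable
  also have "(\<integral>p. g (fst p) \<partial>\<gamma>) - (\<integral>p. g (snd p) \<partial>\<gamma>) = (\<integral>p. g (fst p) - g (snd p) \<partial>\<gamma>)"
    using int_1 int_2 by (intro Bochner_Integration.integral_diff[symmetric])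
  finally have "ennreal (norm (detail_coeff \<psi> (\<lambda>x. complex_of_real (lebesgue_density \<mu> x - lebesgue_density \<nu> x)) \<epsilon> j k))
      \<le> (\<integral>\<^sup>+p. ennreal (norm (g (fst p) - g (snd p))) \<partial>\<gamma>)"
    using integral_norm_bound_ennreal[OF Bochner_Integration.integrable_diff[OF int_1 int_2]] by simp
  also have "\<dots> = (\<integral>\<^sup>+p. ennreal (norm (rescale (\<psi> \<epsilon>) j k (fst p) - rescale (\<psi> \<epsilon>) j k (snd p))) \<partial>\<gamma>)"
    unfolding g_def complex_cnj_diff[symmetric] complex_mod_cnj ..
  finally show ?thesis .
qed

text \<open>
  The wavelet distance is a supremum of finite sums, and each of them is bounded for every coupling by
  integrating the pointwise estimate.
\<close>

lemma wavelet_distance_le: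
  assumes C: "0 < C" "\<And>F x y. finite F \<Longrightarrow> F \<subseteq> A \<times> UNIV \<times> UNIV \<Longrightarrow>
    (\<Sum>(\<epsilon>, j, k)\<in>F. 2 powr (- real_of_int j * (s + real CARD('n) / 2)) *
       norm (rescale (\<psi> \<epsilon>) j k x - rescale (\<psi> \<epsilon>) j k y)) \<le> C * norm (x - y) powr s"
    and \<mu>: "\<mu> \<in> prob_ab2 K" and \<nu>: "\<nu> \<in> prob_ab2 K"
  shows "wavelet_distance A \<psi> j0 s \<mu> \<nu> \<le> ennreal C * wasserstein s \<mu> \<nu>"
proof -
  let ?w = "\<lambda>j. 2 powr (- real_of_int j * (s + real CARD('n) / 2))"
  let ?p = "\<lambda>x. complex_of_real (lebesgue_density \<mu> x - lebesgue_density \<nu> x)"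
  have le_coupling: "wavelet_distance A \<psi> j0 s \<mu> \<nu> \<le> ennreal C * (\<integral>\<^sup>+(x, y). ennreal (norm (x - y) powr s) \<partial>\<gamma>)"
    if \<gamma>: "\<gamma> \<in> couplings \<mu> \<nu>" for \<gamma>
  proof -
    have sets[measurable_cong]: "sets \<gamma> = sets (borel \<Otimes>\<^sub>M borel)"
      using \<gamma> unfolding borel_prod couplings_def by blast
    have "(\<Sum>(\<epsilon>, j, k)\<in>F. ennreal (?w j * norm (detail_coeff \<psi> ?p \<epsilon> j k)))
        \<le> ennreal C * (\<integral>\<^sup>+(x, y). ennreal (norm (x - y) powr s) \<partial>\<gamma>)"
      if F: "finite F" "F \<subseteq> A \<times> {j0..} \<times> UNIV" for F
    proof -
      have F': "F \<subseteq> A \<times> UNIV \<times> UNIV" using F by auto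
      let ?g = "\<lambda>(\<epsilon>, j, k) p. ?w j * norm (rescale (\<psi> \<epsilon>) j k (fst p) - rescale (\<psi> \<epsilon>) j k (snd p))"
      have meas: "(\<lambda>p. ennreal (?g i p)) \<in> borel_measurable \<gamma>" if i: "i \<in> F" for i
      proof -
        obtain \<epsilon> j k where i_eq: "i = (\<epsilon>, j, k)" "\<epsilon> \<in> A" using i F by auto
        have [measurable]: "rescale (\<psi> \<epsilon>) j k \<in> borel_measurable borel"
          by (rule rescale_\<psi>_measurable[OF i_eq(2)])
        show ?thesis unfolding i_eq prod.case by measurable
      qed
      have "(\<Sum>(\<epsilon>, j, k)\<in>F. ennreal (?w j * norm (detail_coeff \<psi> ?p \<epsilon> j k))) \<le> (\<Sum>i\<in>F. \<integral>\<^sup>+p. ennreal (?g i p) \<partial>\<gamma>)"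
      proof (rule sum_mono)
        fix i assume i: "i \<in> F"
        obtain \<epsilon> j k where i_eq: "i = (\<epsilon>, j, k)" "\<epsilon> \<in> A" using i F by auto
        have [measurable]: "rescale (\<psi> \<epsilon>) j k \<in> borel_measurable borel"
          by (rule rescale_\<psi>_measurable[OF i_eq(2)])
        have "ennreal (?w j * norm (detail_coeff \<psi> ?p \<epsilon> j k)) = ennreal (?w j) * ennreal (norm (detail_coeff \<psi> ?p \<epsilon> j k))"
          by (simp add: ennreal_mult)
        also have "\<dots> \<le> ennreal (?w j) * (\<integral>\<^sup>+p. ennreal (norm (rescale (\<psi> \<epsilon>) j k (fst p) - rescale (\<psi> \<epsilon>) j k (snd p))) \<partial>\<gamma>)"
          by (intro mult_left_mono detail_coeff_le_coupling[OF \<mu> \<nu> \<gamma> i_eq(2)]) simp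
        also have "\<dots> = (\<integral>\<^sup>+p. ennreal (?g i p) \<partial>\<gamma>)"
          unfolding i_eq prod.case by (subst nn_integral_cmult[symmetric]) (auto simp: ennreal_mult)
        finally show "(case i of (\<epsilon>, j, k) \<Rightarrow> ennreal (?w j * norm (detail_coeff \<psi> ?p \<epsilon> j k))) \<le> (\<integral>\<^sup>+p. ennreal (?g i p) \<partial>\<gamma>)"
          by (simp add: i_eq)
      qed
      also have "\<dots> = (\<integral>\<^sup>+p. (\<Sum>i\<in>F. ennreal (?g i p)) \<partial>\<gamma>)"
        by (intro nn_integral_sum[symmetric] meas)
      also have "\<dots> \<le> (\<integral>\<^sup>+p. ennreal C * ennreal (norm (fst p - snd p) powr s) \<partial>\<gamma>)"
      proof (rule nn_integral_mono)
        fix p :: "(real ^ 'n) \<times> (real ^ 'n)"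
        have "(\<Sum>i\<in>F. ennreal (?g i p)) = ennreal (\<Sum>i\<in>F. ?g i p)"
          by (intro sum_ennreal) auto
        also have "(\<Sum>i\<in>F. ?g i p) \<le> C * norm (fst p - snd p) powr s"
          using C(2)[OF F(1) F', of "fst p" "snd p"] by (simp add: case_prod_unfold)
        finally show "(\<Sum>i\<in>F. ennreal (?g i p)) \<le> ennreal C * ennreal (norm (fst p - snd p) powr s)"
          using C(1) by (simp add: ennreal_mult[symmetric] ennreal_leI)
      qed
      also have "\<dots> = ennreal C * (\<integral>\<^sup>+p. ennreal (norm (fst p - snd p) powr s) \<partial>\<gamma>)"
        by (intro nn_integral_cmult) measurable
      finally show ?thesis by (simp add: case_prod_unfold)
    qed
    then show ?thesis
      unfolding wavelet_distance_def
      by (subst nonneg_infsum_complete) (auto intro!: SUP_least)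
  qed
  have cancel: "ennreal (1 / C) * (ennreal C * z) = z" "ennreal C * (ennreal (1 / C) * z) = z" for z
    using C(1) by (simp_all add: mult.assoc[symmetric] ennreal_mult[symmetric])
  have "ennreal (1 / C) * wavelet_distance A \<psi> j0 s \<mu> \<nu> \<le> wasserstein s \<mu> \<nu>"
    unfolding wasserstein_def
  proof (rule INF_greatest)
    fix \<gamma> assume "\<gamma> \<in> couplings \<mu> \<nu>"
    then have "ennreal (1 / C) * wavelet_distance A \<psi> j0 s \<mu> \<nu>
        \<le> ennreal (1 / C) * (ennreal C * (\<integral>\<^sup>+(x, y). ennreal (norm (x - y) powr s) \<partial>\<gamma>))"
      by (intro mult_left_mono le_coupling) auto
    then show "ennreal (1 / C) * wavelet_distance A \<psi> j0 s \<mu> \<nu> \<le> (\<integral>\<^sup>+(x, y). ennreal (norm (x - y) powr s) \<partial>\<gamma>)"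
      by (simp only: cancel)
  qed
  then have "ennreal C * (ennreal (1 / C) * wavelet_distance A \<psi> j0 s \<mu> \<nu>) \<le> ennreal C * wasserstein s \<mu> \<nu>"
    by (intro mult_left_mono) auto
  then show ?thesis by (simp only: cancel)
qed

end

section \<open>Lower bound for the wavelet distance\<close>

context compact_wavelet_system
begin

text \<open>
  Decompose \<open>p\<close> into the coarse projection, the details from \<open>j0\<close> to \<open>J\<close> and a remainder. The test function
  is unbounded, but every part is supported in a ball of radius \<open>R'\<close> that does not depend on \<open>J\<close>, so
  the truncation \<open>H\<close>, which is square integrable, gives the same pairings.
\<close>

lemma pairing_bound:
  fixes h :: "real ^ 'n \<Rightarrow> real"
  assumes s: "0 < s" "s < 1" and \<rho>: "0 \<le> \<rho>" and j0: "j0 \<le> 0"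
    and p: "p \<in> L2" "AE x in lborel. \<rho> < norm x \<longrightarrow> p x = 0" "integrable lborel p"
      "(\<integral>x. p x \<partial>lborel) = 0" "(\<integral>x. norm (p x) \<partial>lborel) \<le> 2"
    and h: "\<And>x y. \<bar>h x - h y\<bar> \<le> norm (x - y) powr s" "h 0 = 0"
    and M: "\<And>\<epsilon>. \<epsilon> \<in> A \<Longrightarrow> enn2real (holder_dual_norm s (\<psi> \<epsilon>)) \<le> M" "0 \<le> M"
    and D: "\<And>F. finite F \<Longrightarrow> F \<subseteq> A \<times> {j0..} \<times> UNIV \<Longrightarrow>
      (\<Sum>(\<epsilon>, j, k)\<in>F. 2 powr (- real_of_int j * (s + real CARD('n) / 2)) * norm (detail_coeff \<psi> p \<epsilon> j k)) \<le> D"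
  shows "norm (\<integral>x. p x * complex_of_real (h x) \<partial>lborel) \<le> M * D +
    real (card {k :: int ^ 'n. norm (lattice_vec k) \<le> R + \<rho>}) *
       (2 * L * \<rho> * ((2 * R + \<rho>) powr s * (\<integral>x. norm (\<phi> x) \<partial>lborel))) * 2 powr (real_of_int j0 * (1 - s))"
    (is "_ \<le> M * D + ?coarse")
proof (rule field_le_epsilon)
  fix e :: real assume "0 < e"
  define R' where "R' = \<rho> + 2 * R / 2 powi j0"
  have "0 \<le> R'" "\<rho> \<le> R'" using \<rho> BLR by (auto simp: R'_def)
  have "continuous_on UNIV h" using h s by (intro continuous_on_holder[where C = 1 and s = s]) auto
  then have h_meas[measurable]: "h \<in> borel_measurable borel" by (rule borel_measurable_continuous_onI)
  define H where "H x = (if norm x \<le> R' then complex_of_real (h x) else 0)" for x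
  have H: "H \<in> L2"
  proof (rule L2_bounded_support[where R = R' and B = "R' powr s"])
    show "H \<in> borel_measurable borel" unfolding H_def[abs_def] by measurable
    show "norm (H x) \<le> R' powr s" if "norm x \<le> R'" for x
      using that h(1)[of x 0] h(2) s powr_mono2[of s "norm x" R'] by (simp add: H_def)
  qed (simp add: H_def)
  have pairing: "L2_inner q H = (\<integral>x. q x * complex_of_real (h x) \<partial>lborel)"
    if "AE x in lborel. R' < norm x \<longrightarrow> q x = 0" "q \<in> L2" for q
    unfolding L2_inner_def
  proof (rule integral_cong_AE)
    show "AE x in lborel. q x * cnj (H x) = q x * complex_of_real (h x)"
      using that(1) by eventually_elim (auto simp: H_def)
  qed (use L2_measurable[OF that(2)] L2_measurable[OF H] in measurable)
  \<comment> \<open>Choose the fine scale J so that the remainder contributes at most e.\<close>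
  have "0 < e / (L2_norm H + 1)" using \<open>0 < e\<close> L2_norm_nonneg[of H] by (simp add: add_nonneg_pos)
  then obtain J where J: "j0 \<le> J" and small: "L2_norm (\<lambda>x. p x - proj J p x) < e / (L2_norm H + 1)"
    using proj_converges[OF p(1,2)] by blast
  note pL2 = proj_L2[OF p(1,2)] and dL2 = detail_L2[OF p(1,2)]
  define G where "G j = {i. i \<in> A \<times> (UNIV :: (int ^ 'n) set) \<and> L2_inner p (\<psi>' j i) \<noteq> 0}" for j
  have finG: "finite (G j)" for j using finite_\<psi>_coefficients[OF p(1,2), of j] by (simp add: G_def)
  have sumL2: "(\<lambda>x. \<Sum>j\<in>{j0..<J}. detail j p x) \<in> L2" by (intro L2_sum dL2)
  have "L2_inner p H = L2_inner (\<lambda>x. p x - proj J p x) H + L2_inner (proj J p) H"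
    using L2_inner_diff_left[OF p(1) pL2 H] by simp
  also have "L2_inner (proj J p) H = L2_inner (\<lambda>x. proj j0 p x + (\<Sum>j\<in>{j0..<J}. detail j p x)) H"
    unfolding L2_inner_def
  proof (rule integral_cong_AE)
    show "AE x in lborel. proj J p x * cnj (H x) = (proj j0 p x + (\<Sum>j\<in>{j0..<J}. detail j p x)) * cnj (H x)"
      using proj_telescope[OF p(1,2) J] by eventually_elim simp
  qed (use L2_measurable[OF pL2] L2_measurable[OF sumL2] L2_measurable[OF H] in measurable)
  also have "\<dots> = L2_inner (proj j0 p) H + (\<Sum>j\<in>{j0..<J}. L2_inner (detail j p) H)"
    using L2_inner_add_left[OF pL2 sumL2 H]
      L2_inner_sum_left[of "{j0..<J}" "\<lambda>j. detail j p" H "\<lambda>_. 1"] dL2 H by simp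
  also have "L2_inner (proj j0 p) H = (\<integral>x. proj j0 p x * complex_of_real (h x) \<partial>lborel)"
    using proj_support[OF p(1,2), of j0 j0] pL2 by (intro pairing) (auto simp: R'_def)
  finally have split: "L2_inner p H = L2_inner (\<lambda>x. p x - proj J p x) H +
      ((\<integral>x. proj j0 p x * complex_of_real (h x) \<partial>lborel) + (\<Sum>j\<in>{j0..<J}. L2_inner (detail j p) H))" .
  have tail: "norm (L2_inner (\<lambda>x. p x - proj J p x) H) \<le> e"
  proof -
    have "norm (L2_inner (\<lambda>x. p x - proj J p x) H) \<le> L2_norm (\<lambda>x. p x - proj J p x) * L2_norm H"
      by (intro L2_Cauchy_Schwarz L2_diff p pL2 H)
    also have "\<dots> \<le> e / (L2_norm H + 1) * L2_norm H"
      using small L2_norm_nonneg[of H] by (intro mult_right_mono) auto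
    also have "\<dots> \<le> e" using \<open>0 < e\<close> L2_norm_nonneg[of H] by (simp add: field_simps)
    finally show ?thesis .
  qed
  have coarse: "norm (\<integral>x. proj j0 p x * complex_of_real (h x) \<partial>lborel) \<le> ?coarse"
    using coarse_estimate[OF j0 s \<rho> p h] by (simp add: mult.commute)
  have level: "norm (L2_inner (detail j p) H)
      \<le> (\<Sum>(\<epsilon>, k)\<in>G j. M * (2 powr (- real_of_int j * (s + real CARD('n) / 2)) * norm (detail_coeff \<psi> p \<epsilon> j k)))"
    if j: "j0 \<le> j" for j
  proof -
    have "L2_inner (detail j p) H = (\<Sum>i\<in>G j. L2_inner p (\<psi>' j i) * L2_inner (\<psi>' j i) H)"
      unfolding detail_def[abs_def] G_def by (intro L2_inner_sum_left \<psi>_L2 H) simp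
    also have "norm \<dots> \<le> (\<Sum>(\<epsilon>, k)\<in>G j. M * (2 powr (- real_of_int j * (s + real CARD('n) / 2)) * norm (detail_coeff \<psi> p \<epsilon> j k)))"
    proof (rule sum_norm_le)
      fix i assume i: "i \<in> G j"
      obtain \<epsilon> k where i_eq: "i = (\<epsilon>, k)" by (cases i)
      have \<epsilon>: "\<epsilon> \<in> A" and nz: "L2_inner p (rescale (\<psi> \<epsilon>) j k) \<noteq> 0" using i by (auto simp: G_def i_eq)
      have "rescale (\<psi> \<epsilon>) j k x = 0" if "R' < norm x" for x
        using rescale_localised[where g = "\<psi> \<epsilon>" and R = R, OF p(2) \<psi>_supp[OF \<epsilon>] BLR(3) j nz] that
        by (simp add: R'_def)
      then have "L2_inner (rescale (\<psi> \<epsilon>) j k) H = (\<integral>x. rescale (\<psi> \<epsilon>) j k x * complex_of_real (h x) \<partial>lborel)"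
        using \<psi>_L2[of "(\<epsilon>, k)" j] \<epsilon> by (intro pairing) auto
      then have "norm (L2_inner (rescale (\<psi> \<epsilon>) j k) H)
          \<le> 2 powr (- real_of_int j * (s + real CARD('n) / 2)) * enn2real (holder_dual_norm s (\<psi> \<epsilon>))"
        using dual_norm_scaling[OF \<epsilon> s h(1), of j k] by (simp add: mult.commute)
      also have "\<dots> \<le> 2 powr (- real_of_int j * (s + real CARD('n) / 2)) * M"
        by (intro mult_left_mono M(1) \<epsilon>) simp
      finally have "norm (L2_inner p (rescale (\<psi> \<epsilon>) j k) * L2_inner (rescale (\<psi> \<epsilon>) j k) H)
          \<le> norm (L2_inner p (rescale (\<psi> \<epsilon>) j k)) * (2 powr (- real_of_int j * (s + real CARD('n) / 2)) * M)"
        unfolding norm_mult by (intro mult_left_mono) auto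
      then show "norm (L2_inner p (\<psi>' j i) * L2_inner (\<psi>' j i) H)
          \<le> (case i of (\<epsilon>, k) \<Rightarrow> M * (2 powr (- real_of_int j * (s + real CARD('n) / 2)) * norm (detail_coeff \<psi> p \<epsilon> j k)))"
        by (simp add: i_eq detail_coeff_def L2_inner_def mult_ac)
    qed
    finally show ?thesis .
  qed
  have details: "norm (\<Sum>j\<in>{j0..<J}. L2_inner (detail j p) H) \<le> M * D"
  proof -
    let ?F = "(\<lambda>(j, \<epsilon>, k). (\<epsilon>, j, k)) ` Sigma {j0..<J} G"
    have inj: "inj_on (\<lambda>(j, \<epsilon>, k). (\<epsilon>, j, k)) (Sigma {j0..<J} G)" by (auto simp: inj_on_def)
    have "norm (\<Sum>j\<in>{j0..<J}. L2_inner (detail j p) H)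
        \<le> (\<Sum>j\<in>{j0..<J}. \<Sum>(\<epsilon>, k)\<in>G j. M * (2 powr (- real_of_int j * (s + real CARD('n) / 2)) * norm (detail_coeff \<psi> p \<epsilon> j k)))"
      by (intro sum_norm_le level) simp
    also have "\<dots> = (\<Sum>(j, \<epsilon>, k)\<in>Sigma {j0..<J} G. M * (2 powr (- real_of_int j * (s + real CARD('n) / 2)) * norm (detail_coeff \<psi> p \<epsilon> j k)))"
      using finG by (subst sum.Sigma) auto
    also have "\<dots> = M * (\<Sum>(\<epsilon>, j, k)\<in>?F. 2 powr (- real_of_int j * (s + real CARD('n) / 2)) * norm (detail_coeff \<psi> p \<epsilon> j k))"
      by (subst sum.reindex[OF inj]) (simp add: sum_distrib_left case_prod_unfold)
    also have "\<dots> \<le> M * D"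
      using finG by (intro mult_left_mono D M(2) finite_imageI finite_SigmaI) (auto simp: G_def)
    finally show ?thesis .
  qed
  have "AE x in lborel. R' < norm x \<longrightarrow> p x = 0"
    using p(2) by eventually_elim (use \<open>\<rho> \<le> R'\<close> in auto)
  then have "norm (\<integral>x. p x * complex_of_real (h x) \<partial>lborel) = norm (L2_inner p H)"
    using pairing[of p] p(1) by simp
  also have "\<dots> \<le> e + (?coarse + M * D)"
    unfolding split by (intro norm_triangle_le add_mono tail coarse details)
  finally show "norm (\<integral>x. p x * complex_of_real (h x) \<partial>lborel) \<le> M * D + ?coarse + e" by simp
qed

lemma wasserstein_le_wavelet_distance:
  assumes s: "0 < s" "s < 1" and K: "compact K" "K \<subseteq> cball 0 \<rho>" and \<rho>: "0 \<le> \<rho>" and j0: "j0 \<le> 0"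
    and \<mu>: "\<mu> \<in> prob_ab2 K" and \<nu>: "\<nu> \<in> prob_ab2 K"
    and M: "\<And>\<epsilon>. \<epsilon> \<in> A \<Longrightarrow> enn2real (holder_dual_norm s (\<psi> \<epsilon>)) \<le> M" "0 \<le> M"
    and w: "wavelet_distance A \<psi> j0 s \<mu> \<nu> = ennreal w" "0 \<le> w"
    and \<delta>: "real (card {k :: int ^ 'n. norm (lattice_vec k) \<le> R + \<rho>}) *
       (2 * L * \<rho> * ((2 * R + \<rho>) powr s * (\<integral>x. norm (\<phi> x) \<partial>lborel))) * 2 powr (real_of_int j0 * (1 - s)) \<le> \<delta>"
  shows "wasserstein s \<mu> \<nu> \<le> ennreal (M * w + \<delta>)"
proof (rule wasserstein_le_dual[OF _ _ K(1)])
  have Kb: "K \<in> sets borel" using K(1) by (simp add: borel_compact)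
  let ?p = "\<lambda>x. complex_of_real (lebesgue_density \<mu> x - lebesgue_density \<nu> x)"
  let ?a = "\<lambda>\<epsilon> j k. 2 powr (- real_of_int j * (s + real CARD('n) / 2)) * norm (detail_coeff \<psi> ?p \<epsilon> j k)"
  have partial: "(\<Sum>(\<epsilon>, j, k)\<in>F. ?a \<epsilon> j k) \<le> w" if F: "finite F" "F \<subseteq> A \<times> {j0..} \<times> UNIV" for F
  proof -
    have "ennreal (\<Sum>(\<epsilon>, j, k)\<in>F. ?a \<epsilon> j k) = (\<Sum>(\<epsilon>, j, k)\<in>F. ennreal (?a \<epsilon> j k))"
      unfolding case_prod_unfold by (rule sum_ennreal[symmetric]) simp
    also have "\<dots> \<le> wavelet_distance A \<psi> j0 s \<mu> \<nu>"
      unfolding wavelet_distance_def using F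
      by (subst nonneg_infsum_complete) (auto intro: SUP_upper)
    finally show ?thesis using w by simp
  qed
  fix f :: "real ^ 'n \<Rightarrow> real" assume f: "\<And>x y. \<bar>f x - f y\<bar> \<le> norm (x - y) powr s"
  have "\<bar>(\<integral>x. f x \<partial>\<mu>) - (\<integral>x. f x \<partial>\<nu>)\<bar> = norm (\<integral>x. ?p x * complex_of_real (f x - f 0) \<partial>lborel)"
    unfolding test_function_difference[OF \<mu> \<nu> Kb K(2) s(1) less_imp_le[OF s(2)] f, symmetric] norm_of_real ..
  also have "\<dots> \<le> M * w + real (card {k :: int ^ 'n. norm (lattice_vec k) \<le> R + \<rho>}) *
       (2 * L * \<rho> * ((2 * R + \<rho>) powr s * (\<integral>x. norm (\<phi> x) \<partial>lborel))) * 2 powr (real_of_int j0 * (1 - s))"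
    by (rule pairing_bound[OF s \<rho> j0 density_difference[OF \<mu> \<nu> Kb K(2)] _ _ M partial]) (use f in auto)
  finally show "(\<integral>x. f x \<partial>\<mu>) - (\<integral>x. f x \<partial>\<nu>) \<le> M * w + \<delta>" using \<delta> by linarith
qed (use s prob_ab2_density(1-3)[OF \<mu>] prob_ab2_density(1-3)[OF \<nu>] in auto)

end

section \<open>Comparison of the two distances\<close>

context compact_wavelet_system
begin

text \<open>
  Flipping one sign isolates a single wavelet.
\<close>

lemma signed_sum_flip:
  assumes \<epsilon>0: "\<epsilon>0 \<in> A"
  shows "signed_sum A (\<lambda>_. 1) (\<lambda>\<epsilon> k. rescale (\<psi> \<epsilon>) 0 k) x
    - signed_sum A ((\<lambda>_. 1)((\<epsilon>0, 0) := -1)) (\<lambda>\<epsilon> k. rescale (\<psi> \<epsilon>) 0 k) x = 2 * \<psi> \<epsilon>0 x"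
proof -
  define g where "g i = (case i of (\<epsilon>, k) \<Rightarrow> rescale (\<psi> \<epsilon>) 0 k x)" for i
  define T where "T = insert (\<epsilon>0, 0) {i \<in> A \<times> (UNIV :: (int ^ 'n) set). g i \<noteq> 0}"
  have "{i \<in> A \<times> (UNIV :: (int ^ 'n) set). g i \<noteq> 0} \<subseteq> A \<times> {k. norm (x - lattice_vec k) \<le> R}"
    using \<psi>_supp by (force simp: g_def rescale_def not_le)
  moreover obtain N where "\<And>z :: real ^ 'n. finite {k. norm (z - lattice_vec k) \<le> R}"
    using lattice_points_near[of R] by metis
  ultimately have "finite T"
    unfolding T_def using finite_A by (auto intro: finite_subset)
  have fin_sum: "signed_sum A \<sigma> (\<lambda>\<epsilon> k. rescale (\<psi> \<epsilon>) 0 k) x = (\<Sum>i\<in>T. complex_of_real (\<sigma> i) * g i)" for \<sigma>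
  proof -
    have "signed_sum A \<sigma> (\<lambda>\<epsilon> k. rescale (\<psi> \<epsilon>) 0 k) x = (\<Sum>\<^sub>\<infinity>i\<in>A \<times> UNIV. complex_of_real (\<sigma> i) * g i)"
      unfolding signed_sum_def g_def by (intro infsum_cong) auto
    also have "\<dots> = (\<Sum>\<^sub>\<infinity>i\<in>T. complex_of_real (\<sigma> i) * g i)"
      using \<epsilon>0 by (intro infsum_cong_neutral) (auto simp: T_def)
    finally show ?thesis using \<open>finite T\<close> by simp
  qed
  have "(\<Sum>i\<in>T. complex_of_real 1 * g i) - (\<Sum>i\<in>T. complex_of_real (((\<lambda>_. 1)((\<epsilon>0, 0) := -1)) i) * g i)
      = (\<Sum>i\<in>T. if i = (\<epsilon>0, 0) then 2 * g i else 0)"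
    unfolding sum_subtractf[symmetric] by (intro sum.cong) auto
  also have "\<dots> = 2 * g (\<epsilon>0, 0)" using \<open>finite T\<close> by (simp add: T_def)
  also have "g (\<epsilon>0, 0) = \<psi> \<epsilon>0 x" by (simp add: g_def rescale_0)
  finally show ?thesis unfolding fin_sum .
qed

text \<open>
  If all signed sums were constant, then by flipping one sign a wavelet would be constant; having
  compact support it would vanish, against its unit norm.
\<close>

lemma a23_positive: "0 < a23 A \<psi> s"
proof (rule ccontr)
  assume "\<not> 0 < a23 A \<psi> s"
  then have zero: "a23 A \<psi> s = 0" by simp
  obtain \<epsilon>0 where \<epsilon>0: "\<epsilon>0 \<in> A" using A_nonempty by blast
  define S where "S \<sigma> = signed_sum A \<sigma> (\<lambda>\<epsilon> k. rescale (\<psi> \<epsilon>) 0 k)" for \<sigma>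
  have const: "S \<sigma> x = S \<sigma> y" if "\<sigma> \<in> signs" for \<sigma> x y
  proof -
    have "holder_seminorm s (S \<sigma>) \<le> a23 A \<psi> s"
      unfolding a23_def S_def using that by (rule SUP_upper)
    then have "holder_seminorm s (S \<sigma>) \<le> ennreal 0" using zero by simp
    then show ?thesis using holder_seminorm_le_iff[of 0 s "S \<sigma>"] by simp
  qed
  have signs: "(\<lambda>_. 1) \<in> signs" "(\<lambda>_. 1)((\<epsilon>0, 0) := -1) \<in> signs" by (auto simp: signs_def)
  obtain z :: "real ^ 'n" where z: "R < norm z"
  proof -
    have "norm ((R + 1) *\<^sub>R axis undefined 1 :: real ^ 'n) = R + 1" using BLR by (simp add: norm_axis_1)
    then show thesis using that[of "(R + 1) *\<^sub>R axis undefined 1"] by simp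
  qed
  have "\<psi> \<epsilon>0 x = 0" for x
  proof -
    have "2 * \<psi> \<epsilon>0 x = 2 * \<psi> \<epsilon>0 z"
      using signed_sum_flip[OF \<epsilon>0, of x] signed_sum_flip[OF \<epsilon>0, of z]
        const[OF signs(1), of x z] const[OF signs(2), of x z] by (simp add: S_def)
    then show ?thesis using \<psi>_supp[OF \<epsilon>0 z] by simp
  qed
  then have "L2_inner (\<psi> \<epsilon>0) (\<psi> \<epsilon>0) = 0" by (simp add: L2_inner_def)
  then show False using \<psi>_basis(2)[of "(\<epsilon>0, 0)" "(\<epsilon>0, 0)" 0] \<epsilon>0 by (simp add: rescale_0)
qed

end

lemma compact_wavelet_system_of_regular:
  fixes \<phi> :: "real ^ 'n \<Rightarrow> complex" and \<psi> :: "'e \<Rightarrow> real ^ 'n \<Rightarrow> complex"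
  assumes "wavelet_system A \<phi> \<psi>" "1 \<le> r" "regular_system r A \<phi> \<psi>" "compactly_supported_system A \<phi> \<psi>"
  obtains V B L R where "compact_wavelet_system A \<phi> \<psi> V B L R"
proof -
  obtain V where "finite A" and V: "multiresolution V \<phi>"
    "\<And>\<epsilon>. \<epsilon> \<in> A \<Longrightarrow> has_bochner_integral lborel (\<psi> \<epsilon>) 0"
    "\<And>j. L2_orthonormal_basis (L2_orth_complement_in (V (j + 1)) (V j)) (A \<times> UNIV) (\<lambda>(\<epsilon>, k). rescale (\<psi> \<epsilon>) j k)"
    using assms(1) unfolding wavelet_system_def Let_def by blast
  define good where "good f t \<longleftrightarrow> (case t of (B, L, R) \<Rightarrow> 0 \<le> B \<and> 0 \<le> L \<and> 0 \<le> R \<and> (\<forall>x. norm (f x) \<le> B) \<and>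
      (\<forall>x y. norm (f x - f y) \<le> L * norm (x - y)) \<and> (\<forall>x. R < norm x \<longrightarrow> f x = 0) \<and> f \<in> borel_measurable borel)"
    for f :: "real ^ 'n \<Rightarrow> complex" and t :: "real \<times> real \<times> real"
  have ex: "\<exists>t. good f t" if f: "regular_function r f" "compactly_supported f" for f
  proof -
    obtain B L R where "0 \<le> B" "0 \<le> L" "0 \<le> R" "\<And>x. norm (f x) \<le> B"
      "\<And>x y. norm (f x - f y) \<le> L * norm (x - y)" "\<And>x. R < norm x \<Longrightarrow> f x = 0" "f \<in> borel_measurable borel"
      using regular_compactly_supported_bounds[OF f(1) assms(2) f(2)] by blast
    then have "good f (B, L, R)" by (simp add: good_def)
    then show ?thesis by blast
  qed
  obtain t\<phi> where t\<phi>: "good \<phi> t\<phi>"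
    using ex[of \<phi>] assms by (auto simp: regular_system_def compactly_supported_system_def)
  have "\<forall>\<epsilon>\<in>A. \<exists>t. good (\<psi> \<epsilon>) t"
    using ex assms by (auto simp: regular_system_def compactly_supported_system_def)
  then obtain t where t: "\<And>\<epsilon>. \<epsilon> \<in> A \<Longrightarrow> good (\<psi> \<epsilon>) (t \<epsilon>)" using bchoice by metis
  define B where "B = fst t\<phi> + (\<Sum>\<epsilon>\<in>A. fst (t \<epsilon>))"
  define L where "L = fst (snd t\<phi>) + (\<Sum>\<epsilon>\<in>A. fst (snd (t \<epsilon>)))"
  define R where "R = snd (snd t\<phi>) + (\<Sum>\<epsilon>\<in>A. snd (snd (t \<epsilon>)))"
  have nonneg: "0 \<le> fst t\<phi>" "0 \<le> fst (snd t\<phi>)" "0 \<le> snd (snd t\<phi>)"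
    "\<And>\<epsilon>. \<epsilon> \<in> A \<Longrightarrow> 0 \<le> fst (t \<epsilon>)" "\<And>\<epsilon>. \<epsilon> \<in> A \<Longrightarrow> 0 \<le> fst (snd (t \<epsilon>))" "\<And>\<epsilon>. \<epsilon> \<in> A \<Longrightarrow> 0 \<le> snd (snd (t \<epsilon>))"
    using t\<phi> t by (auto simp: good_def case_prod_unfold)
  have dom\<phi>: "fst t\<phi> \<le> B" "fst (snd t\<phi>) \<le> L" "snd (snd t\<phi>) \<le> R"
    unfolding B_def L_def R_def using nonneg by (auto intro!: sum_nonneg)
  have dom\<psi>: "fst (t \<epsilon>) \<le> B" "fst (snd (t \<epsilon>)) \<le> L" "snd (snd (t \<epsilon>)) \<le> R" if "\<epsilon> \<in> A" for \<epsilon>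
    unfolding B_def L_def R_def using nonneg that \<open>finite A\<close>
      member_le_sum[of \<epsilon> A "\<lambda>\<epsilon>. fst (t \<epsilon>)"] member_le_sum[of \<epsilon> A "\<lambda>\<epsilon>. fst (snd (t \<epsilon>))"]
      member_le_sum[of \<epsilon> A "\<lambda>\<epsilon>. snd (snd (t \<epsilon>))"]
    by (auto intro: add_increasing)
  have enlarge: "norm (f x) \<le> B" "norm (f x - f y) \<le> L * norm (x - y)" "R < norm x \<Longrightarrow> f x = 0"
      "f \<in> borel_measurable borel"
    if "good f u" "fst u \<le> B" "fst (snd u) \<le> L" "snd (snd u) \<le> R" for f u x y
  proof -
    have g: "norm (f x) \<le> fst u" "norm (f x - f y) \<le> fst (snd u) * norm (x - y)"
      "snd (snd u) < norm x \<Longrightarrow> f x = 0" "f \<in> borel_measurable borel"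
      using that(1) by (auto simp: good_def case_prod_unfold)
    show "norm (f x) \<le> B" using g(1) that(2) by linarith
    show "norm (f x - f y) \<le> L * norm (x - y)"
      using g(2) mult_right_mono[OF that(3) norm_ge_zero[of "x - y"]] by linarith
    show "R < norm x \<Longrightarrow> f x = 0" using g(3) that(4) by linarith
    show "f \<in> borel_measurable borel" by (rule g(4))
  qed
  have "compact_wavelet_system A \<phi> \<psi> V B L R"
  proof
    show "finite A" by fact
    show "multiresolution V \<phi>" by (rule V(1))
    show "has_bochner_integral lborel (\<psi> \<epsilon>) 0" if "\<epsilon> \<in> A" for \<epsilon> by (rule V(2)[OF that])
    show "L2_orthonormal_basis (L2_orth_complement_in (V (j + 1)) (V j)) (A \<times> UNIV) (\<lambda>(\<epsilon>, k). rescale (\<psi> \<epsilon>) j k)" for j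
      by (rule V(3))
    show "0 \<le> B" "0 \<le> L" "0 \<le> R" using nonneg(1-3) dom\<phi> by linarith+
    show "\<phi> \<in> borel_measurable borel" by (rule enlarge(4)[OF t\<phi> dom\<phi>])
    show "norm (\<phi> x) \<le> B" for x by (rule enlarge(1)[OF t\<phi> dom\<phi>])
    show "norm (\<phi> x - \<phi> y) \<le> L * norm (x - y)" for x y by (rule enlarge(2)[OF t\<phi> dom\<phi>])
    show "\<phi> x = 0" if "R < norm x" for x by (rule enlarge(3)[OF t\<phi> dom\<phi> that])
    fix \<epsilon> assume \<epsilon>: "\<epsilon> \<in> A"
    show "\<psi> \<epsilon> \<in> borel_measurable borel" by (rule enlarge(4)[OF t[OF \<epsilon>] dom\<psi>[OF \<epsilon>]])
    show "norm (\<psi> \<epsilon> x) \<le> B" for x by (rule enlarge(1)[OF t[OF \<epsilon>] dom\<psi>[OF \<epsilon>]])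
    show "norm (\<psi> \<epsilon> x - \<psi> \<epsilon> y) \<le> L * norm (x - y)" for x y by (rule enlarge(2)[OF t[OF \<epsilon>] dom\<psi>[OF \<epsilon>]])
    show "\<psi> \<epsilon> x = 0" if "R < norm x" for x by (rule enlarge(3)[OF t[OF \<epsilon>] dom\<psi>[OF \<epsilon>] that])
  qed
  then show thesis by (rule that)
qed

theorem theorem3p13:
  fixes K :: "(real ^ 'n) set" and s :: real and r :: nat
    and A :: "'e set" and \<phi> :: "real ^ 'n \<Rightarrow> complex" and \<psi> :: "'e \<Rightarrow> real ^ 'n \<Rightarrow> complex"
  assumes "compact K"
    and "0 < s" and "s < 1"
    and "wavelet_system A \<phi> \<psi>"
    and "r \<ge> 1" and "regular_system r A \<phi> \<psi>"
    and "compactly_supported_system A \<phi> \<psi>"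
  shows "\<forall>\<eta>>0. \<exists>j0::int. \<forall>\<mu>\<in>prob_ab2 K. \<forall>\<nu>\<in>prob_ab2 K.
    enn2ereal (E_lower A \<psi> s * wasserstein s \<mu> \<nu>) - ereal \<eta>
      \<le> enn2ereal (wavelet_distance A \<psi> j0 s \<mu> \<nu>) \<and>
    wavelet_distance A \<psi> j0 s \<mu> \<nu> \<le> E_upper A \<psi> s j0 * wasserstein s \<mu> \<nu>"
proof (intro allI impI)
  fix \<eta> :: real assume "\<eta> > 0"
  note s = assms(2,3)
  obtain V B L R where "compact_wavelet_system A \<phi> \<psi> V B L R"
    using compact_wavelet_system_of_regular[OF assms(4-7)] by blast
  then interpret compact_wavelet_system A \<phi> \<psi> V B L R .
  define M where "M = Max ((\<lambda>\<epsilon>. holder_dual_norm s (\<psi> \<epsilon>)) ` A)"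
  have M_ge: "holder_dual_norm s (\<psi> \<epsilon>) \<le> M" if "\<epsilon> \<in> A" for \<epsilon>
    unfolding M_def using finite_A that by (intro Max_ge) auto
  have "M \<in> (\<lambda>\<epsilon>. holder_dual_norm s (\<psi> \<epsilon>)) ` A"
    unfolding M_def using finite_A A_nonempty by (intro Max_in) auto
  then have "0 < M" "M < \<top>" using dual_norm_positive dual_norm_finite s by auto
  define m where "m = enn2real M"
  have m: "M = ennreal m" "0 < m"
    using \<open>0 < M\<close> \<open>M < \<top>\<close> by (auto simp: m_def enn2real_positive_iff)
  have m_ge: "enn2real (holder_dual_norm s (\<psi> \<epsilon>)) \<le> m" if "\<epsilon> \<in> A" for \<epsilon>
    unfolding m_def using M_ge[OF that] \<open>M < \<top>\<close> by (intro enn2real_mono) auto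
  have "bounded K" using assms(1) by (rule compact_imp_bounded)
  then obtain \<rho> where "0 < \<rho>" "\<forall>x\<in>K. norm x \<le> \<rho>" unfolding bounded_pos by blast
  then have \<rho>: "0 < \<rho>" "K \<subseteq> cball 0 \<rho>" by auto
  obtain C where C: "0 < C" "\<And>F x y. finite F \<Longrightarrow> F \<subseteq> A \<times> UNIV \<times> UNIV \<Longrightarrow>
    (\<Sum>(\<epsilon>, j, k)\<in>F. 2 powr (- real_of_int j * (s + real CARD('n) / 2)) *
       norm (rescale (\<psi> \<epsilon>) j k x - rescale (\<psi> \<epsilon>) j k y)) \<le> C * norm (x - y) powr s"
    using increment_sum_bound[OF s] by blast
  define c where "c = real (card {k :: int ^ 'n. norm (lattice_vec k) \<le> R + \<rho>}) *
       (2 * L * \<rho> * ((2 * R + \<rho>) powr s * (\<integral>x. norm (\<phi> x) \<partial>lborel)))"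
  have "\<forall>\<^sub>F n in sequentially. c * 2 powr (real_of_int (- int n) * (1 - s)) \<le> m * \<eta>"
  proof -
    have "(\<lambda>n. c * (2 powr (- (1 - s))) ^ n) \<longlonglongrightarrow> c * 0"
      using s powr_less_mono[of "- (1 - s)" 0 "2 :: real"]
      by (intro tendsto_mult_left LIMSEQ_realpow_zero) auto
    then have "\<forall>\<^sub>F n in sequentially. c * (2 powr (- (1 - s))) ^ n < m * \<eta>"
      using m \<open>\<eta> > 0\<close> by (intro order_tendstoD(2)[where y = 0]) auto
    moreover have "(2 powr (- (1 - s))) ^ n = 2 powr (real_of_int (- int n) * (1 - s))" for n
      by (simp add: powr_realpow[symmetric] powr_powr algebra_simps)
    ultimately show ?thesis by (auto elim: eventually_mono)
  qed
  moreover have "\<forall>\<^sub>F n in sequentially. ennreal C \<le> ennreal (real n) * a23 A \<psi> s"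
  proof (cases "a23 A \<psi> s")
    case top
    have "\<forall>\<^sub>F n in sequentially. (0 :: nat) < n" by (rule eventually_gt_at_top)
    then show ?thesis by eventually_elim (simp add: top ennreal_mult_top)
  next
    case (real a)
    then have "0 < a" using a23_positive[of s] by auto
    have "\<forall>\<^sub>F n in sequentially. C / a \<le> real n"
      using filterlim_real_sequentially by (simp add: filterlim_at_top)
    then show ?thesis
    proof eventually_elim
      case (elim n)
      then have "C \<le> real n * a" using \<open>0 < a\<close> by (simp add: field_simps)
      then show ?case using \<open>0 < a\<close> real by (simp add: ennreal_mult[symmetric] ennreal_leI)
    qed
  qed
  moreover have "\<forall>\<^sub>F n in sequentially. (0 :: nat) < n" by (rule eventually_gt_at_top)
  ultimately have "\<forall>\<^sub>F n in sequentially. c * 2 powr (real_of_int (- int n) * (1 - s)) \<le> m * \<eta> \<and>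
      ennreal C \<le> ennreal (real n) * a23 A \<psi> s \<and> 0 < n"
    by (intro eventually_conj)
  then obtain n where n: "c * 2 powr (real_of_int (- int n) * (1 - s)) \<le> m * \<eta>"
    "ennreal C \<le> ennreal (real n) * a23 A \<psi> s" "0 < n"
    using eventually_happens'[OF sequentially_bot] by blast
  \<comment> \<open>n is chosen large enough for the coarse part to be at most m * \<eta> and for n * a23 to exceed C.\<close>
  define j0 where "j0 = - int n"
  have j0: "j0 < 0" "real_of_int \<bar>j0\<bar> = real n" using n(3) by (auto simp: j0_def)
  have E_upper: "ennreal C \<le> E_upper A \<psi> s j0"
    using n(2) j0 by (simp add: E_upper_def add_increasing)
  show "\<exists>j0::int. \<forall>\<mu>\<in>prob_ab2 K. \<forall>\<nu>\<in>prob_ab2 K.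
    enn2ereal (E_lower A \<psi> s * wasserstein s \<mu> \<nu>) - ereal \<eta>
      \<le> enn2ereal (wavelet_distance A \<psi> j0 s \<mu> \<nu>) \<and>
    wavelet_distance A \<psi> j0 s \<mu> \<nu> \<le> E_upper A \<psi> s j0 * wasserstein s \<mu> \<nu>"
  proof (intro exI[of _ j0] ballI conjI)
    fix \<mu> \<nu> assume \<mu>: "\<mu> \<in> prob_ab2 K" and \<nu>: "\<nu> \<in> prob_ab2 K"
    have "wavelet_distance A \<psi> j0 s \<mu> \<nu> \<le> ennreal C * wasserstein s \<mu> \<nu>"
      by (rule wavelet_distance_le[OF C \<mu> \<nu>])
    also have "\<dots> \<le> E_upper A \<psi> s j0 * wasserstein s \<mu> \<nu>" by (intro mult_right_mono E_upper) simp
    finally show "wavelet_distance A \<psi> j0 s \<mu> \<nu> \<le> E_upper A \<psi> s j0 * wasserstein s \<mu> \<nu>" .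
    show "enn2ereal (E_lower A \<psi> s * wasserstein s \<mu> \<nu>) - ereal \<eta> \<le> enn2ereal (wavelet_distance A \<psi> j0 s \<mu> \<nu>)"
    proof (cases "wavelet_distance A \<psi> j0 s \<mu> \<nu>")
      case top
      then show ?thesis by simp
    next
      case (real w)
      have "wasserstein s \<mu> \<nu> \<le> ennreal (m * w + m * \<eta>)"
        by (rule wasserstein_le_wavelet_distance[OF s assms(1) \<rho>(2) less_imp_le[OF \<rho>(1)] less_imp_le[OF j0(1)]
              \<mu> \<nu> m_ge less_imp_le[OF m(2)] real(2) real(1)])
          (use n(1) in \<open>auto simp: c_def j0_def\<close>)
      then have "E_lower A \<psi> s * wasserstein s \<mu> \<nu> \<le> ennreal (1 / m) * ennreal (m * w + m * \<eta>)"
        unfolding E_lower_def a14_def M_def[symmetric] m(1)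
        using m(2) divide_ennreal[of 1 m] by (intro mult_mono) auto
      also have "\<dots> = ennreal (w + \<eta>)"
        using m(2) real(1) \<open>\<eta> > 0\<close> by (simp add: ennreal_mult[symmetric] field_simps)
      finally have "enn2ereal (E_lower A \<psi> s * wasserstein s \<mu> \<nu>) \<le> ereal (w + \<eta>)"
        using real(1) \<open>\<eta> > 0\<close> by (simp add: less_eq_ennreal.rep_eq del: ennreal_plus)
      then show ?thesis using real by (simp add: ereal_minus_le)
    qed
  qed
qed

end
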